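(* Assume that conditions (C1), (C2) and (C3) stated in the context hold. Let $\mathcal{C}\subset[J]$ be nonempty and let $\Theta\subset\operatorname{dom}(\Lambda)$ be a finite set. Suppose that $\{\beta^j:j\in\mathcal{C}\}\subset\Theta$ and that for each $j\in[J]\setminus\mathcal{C}$ there exists $\gamma\in\Theta$ such that $v_j(\gamma)\ge 2r_{\mathcal{C}}$, where $r_{\mathcal{C}}=\min_{j\in\mathcal{C}}r_j$. Then $r_*=r_{\mathcal{C}}$, and $\mathbb{P}_\Theta$ is an asymptotically efficient proposal for estimating $\mathbb{P}(\tau_b^*<\tau_b^0)$; that is, $$\lim_{b\to\infty}\frac1b\log\mathbb{E}_\Theta\left[\left(\widehat{\mathbb{W}}_b(\Theta)\right)^2\right]=-2r_*=2\lim_{b\to\infty}\frac1b\log\mathbb{P}(\tau_b^*<\tau_b^0).$$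
   Context: $X_1,X_2,\ldots$ are i.i.d. $\mathbb{R}^d$-valued random vectors on a probability space $(\Omega,\mathcal{F},\mathbb{P})$, $S_0=0$, $S_n=\sum_{i=1}^nX_i$, $\mathcal{F}_n=\sigma(X_1,\ldots,X_n)$ ($\mathcal{F}_0$ trivial). For $\theta,x\in\mathbb{R}^d$: $\Lambda(\theta)=\log\mathbb{E}[e^{\theta\cdot X_1}]\in(-\infty,\infty]$, $\Lambda^*(x)=\sup_{\theta\in\mathbb{R}^d}\{\theta\cdot x-\Lambda(\theta)\}$, $I(x)=\sup\{\theta\cdot x:\Lambda(\theta)\le 0\}$. For a function $f$, $\operatorname{dom}(f)=\{f<\infty\}$; $\operatorname{cone}(A)=\{\lambda x:\lambda>0,x\in A\}$; $B(x,r)$ is the open Euclidean ball; $[J]=\{1,\ldots,J\}$. $W^1,\ldots,W^J\subset\mathbb{R}^d$ are open convex sets and $W^0\subset\mathbb{R}^d$ is an open set (not necessarily convex, possibly empty). For $b>0$, $\tau_b^j=\inf\{n\ge0:S_n\in bW^j\}$ for $j=0,1,\ldots,J$ (with $\inf\emptyset=\infty$), $\tau_b^*=\min_{j\in[J]}\tau_b^j$. For $j\in[J]$, $r_j=\inf_{x\in W^j}I(x)$; $r_*=\min_{j\in[J]}r_j$. (C1) There is $\delta>0$ such that $\operatorname{cone}(B(\mathbb{E}[X_1],\delta))\cap W^j=\emptyset$ for every $j\in[J]$. (C2) $\operatorname{dom}(\Lambda)$ is open, and $\operatorname{int}(\operatorname{cone}(\operatorname{dom}(\Lambda^* )))\cap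 W^j\neq\emptyset$ for every $j\in[J]$. (C3) $\operatorname{cone}(W^j)\cap\operatorname{cone}(W^{j'})=\emptyset$ for all $0\le j\ne j'\le J$, and there is $\delta>0$ such that $B(\mathbf 0,\delta)\cap W^j=\emptyset$ for each $j\in\{0\}\cup[J]$. Under (C1)–(C2), for each $j\in[J]$ there is a unique $\beta^j\in\mathbb{R}^d$ (the optimal tilting associated with $W^j$) with $\Lambda(\beta^j)=0$, $W^j\subset\{v:\beta^j\cdot v\ge r_j\}$ and $\{x:I(x)\le r_j\}\subset\{v:\beta^j\cdot v\le r_j\}$ (known result of Collamore). For $\theta\in\operatorname{dom}(\Lambda)$, $\mathcal{V}_\theta(x)=\sup\{\alpha\cdot x:\alpha\in\mathbb{R}^d,\ \Lambda(\theta)+\Lambda(\alpha-\theta)\le0\}$ (sup of the empty set is $-\infty$), and $v_j(\theta)=\inf_{x\in\overline{W^j}}\mathcal{V}_\theta(x)$. For $\theta\in\operatorname{dom}(\Lambda)$, $\mathbb{P}_\theta$ is the probability measure with $\frac{d\mathbb{P}_\theta}{d\mathbb{P}}(\mathcal{F}_n)=\exp(\theta\cdot S_n-n\Lambda(\theta))$ for all $n$. For a finite $\Theta\subset\operatorname{dom}(\Lambda)$, $\mathbb{P}_\Theta=\frac1{|\Theta|}\sum_{\theta\in\Theta}\mathbb{P}_\theta$ with expectation $\mathbb{E}_\Theta$. For a stopping time $T$, $\mathbb{L}_\theta(T)=\exp(\theta\cdot S_T-T\Lambda(\theta))\mathbf 1\{T<\infty\}$, and $$\widehat{\mathbb{W}}_b(\Theta)=\Big(\frac1{|\Theta|}\sum_{\theta\in\Theta}\mathbb{L}_\theta(\tau_b^*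 )\Big)^{-1}\mathbf 1\{\tau_b^*<\tau_b^0\}$$ (equal to $0$ off the event $\{\tau_b^*<\tau_b^0\}$), an unbiased estimator of $\mathbb{P}(\tau_b^*<\tau_b^0)$ under $\mathbb{P}_\Theta$. $\mathbb{P}_\Theta$ is called asymptotically efficient for estimating $\mathbb{P}(\tau_b^*<\tau_b^0)$ if $\log\mathbb{E}_\Theta[(\widehat{\mathbb{W}}_b(\Theta))^2]\big/\big(2\log\mathbb{P}(\tau_b^*<\tau_b^0)\big)\to1$ as $b\to\infty$. *)

theory Defs
  imports "HOL-Probability.Probability"
begin

section \<open>Convex-analytic functionals\<close>

definition log_ennreal :: "ennreal \<Rightarrow> ereal" where
  "log_ennreal x = (if x = 0 then -\<infinity> else if x = \<infinity> then \<infinity> else ereal (ln (enn2real x)))"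

definition log_mgf :: "'a measure \<Rightarrow> ('a \<Rightarrow> 'd::euclidean_space) \<Rightarrow> 'd \<Rightarrow> ereal" where
  "log_mgf M Y \<theta> = log_ennreal (\<integral>\<^sup>+ \<omega>. ennreal (exp (\<theta> \<bullet> Y \<omega>)) \<partial>M)"

definition eff_dom :: "('d \<Rightarrow> ereal) \<Rightarrow> 'd set" where
  "eff_dom f = {x. f x < \<infinity>}"

definition legendre :: "('d::euclidean_space \<Rightarrow> ereal) \<Rightarrow> 'd \<Rightarrow> ereal" where
  "legendre \<Lambda> x = (SUP \<theta>. ereal (\<theta> \<bullet> x) - \<Lambda> \<theta>)"

definition rate_I :: "('d::euclidean_space \<Rightarrow> ereal) \<Rightarrow> 'd \<Rightarrow> ereal" where
  "rate_I \<Lambda> x = (SUP \<theta>\<in>{\<theta>. \<Lambda> \<theta> \<le> 0}. ereal (\<theta> \<bullet> x))"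

definition set_rate :: "('d::euclidean_space \<Rightarrow> ereal) \<Rightarrow> 'd set \<Rightarrow> ereal" where
  "set_rate \<Lambda> U = (INF x\<in>U. rate_I \<Lambda> x)"

text \<open>In \<^typ>\<open>ereal\<close> the supremum of the empty set is \<open>-\<infinity>\<close>, as required for \<open>tilt_V\<close>.\<close>

definition tilt_V :: "('d::euclidean_space \<Rightarrow> ereal) \<Rightarrow> 'd \<Rightarrow> 'd \<Rightarrow> ereal" where
  "tilt_V \<Lambda> \<theta> x = (SUP \<alpha>\<in>{\<alpha>. \<Lambda> \<theta> + \<Lambda> (\<alpha> - \<theta>) \<le> 0}. ereal (\<alpha> \<bullet> x))"

definition tilt_v :: "('d::euclidean_space \<Rightarrow> ereal) \<Rightarrow> 'd \<Rightarrow> 'd set \<Rightarrow> ereal" where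
  "tilt_v \<Lambda> \<theta> U = (INF x\<in>closure U. tilt_V \<Lambda> \<theta> x)"

definition optimal_tilting :: "('d::euclidean_space \<Rightarrow> ereal) \<Rightarrow> 'd set \<Rightarrow> 'd \<Rightarrow> bool" where
  "optimal_tilting \<Lambda> U \<beta> \<longleftrightarrow>
     \<Lambda> \<beta> = 0 \<and>
     U \<subseteq> {v. ereal (\<beta> \<bullet> v) \<ge> set_rate \<Lambda> U} \<and>
     {x. rate_I \<Lambda> x \<le> set_rate \<Lambda> U} \<subseteq> {v. ereal (\<beta> \<bullet> v) \<le> set_rate \<Lambda> U}"

text \<open>Unlike the library's \<^const>\<open>cone\<close> and cone hull, only strictly positive multiples are
  taken, so the origin is not added.\<close>

definition pos_cone :: "'d::real_vector set \<Rightarrow> 'd set" where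
  "pos_cone A = {c *\<^sub>R x | c x. c > 0 \<and> x \<in> A}"


section \<open>Random walk and hitting times\<close>

text \<open>The increments are indexed from \<open>1\<close>; \<open>X 0\<close> is never used.\<close>

definition walk :: "(nat \<Rightarrow> 'a \<Rightarrow> 'd::euclidean_space) \<Rightarrow> nat \<Rightarrow> 'a \<Rightarrow> 'd" where
  "walk X n \<omega> = (\<Sum>i=1..n. X i \<omega>)"

definition nat_filt :: "'a measure \<Rightarrow> (nat \<Rightarrow> 'a \<Rightarrow> 'd::euclidean_space) \<Rightarrow> nat \<Rightarrow> 'a measure" where
  "nat_filt M X n =
     sigma (space M) (\<Union>i\<in>{1..n}. {X i -` A \<inter> space M | A. A \<in> sets borel})"

definition hit_time ::
  "(nat \<Rightarrow> 'a \<Rightarrow> 'd::euclidean_space) \<Rightarrow> 'd set \<Rightarrow> real \<Rightarrow> 'a \<Rightarrow> enat" where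
  "hit_time X U b \<omega> = (INF n\<in>{n. walk X n \<omega> \<in> (\<lambda>x. b *\<^sub>R x) ` U}. enat n)"

definition hit_time_min ::
  "(nat \<Rightarrow> 'a \<Rightarrow> 'd::euclidean_space) \<Rightarrow> (nat \<Rightarrow> 'd set) \<Rightarrow> nat \<Rightarrow> real \<Rightarrow> 'a \<Rightarrow> enat" where
  "hit_time_min X W J b \<omega> = (MIN j\<in>{1..J}. hit_time X (W j) b \<omega>)"

definition rare_event ::
  "'a measure \<Rightarrow> (nat \<Rightarrow> 'a \<Rightarrow> 'd::euclidean_space) \<Rightarrow> (nat \<Rightarrow> 'd set) \<Rightarrow> nat \<Rightarrow> real \<Rightarrow> 'a set" where
  "rare_event M X W J b =
     {\<omega>\<in>space M. hit_time_min X W J b \<omega> < hit_time X (W 0) b \<omega>}"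


section \<open>Tilted measures, mixtures and the importance sampling estimator\<close>

definition tilted_measure ::
  "'a measure \<Rightarrow> (nat \<Rightarrow> 'a \<Rightarrow> 'd::euclidean_space) \<Rightarrow> 'd \<Rightarrow> 'a measure \<Rightarrow> bool" where
  "tilted_measure M X \<theta> Q \<longleftrightarrow>
     prob_space Q \<and> sets Q = sets M \<and>
     (\<forall>n. restr_to_subalg Q (nat_filt M X n) =
          density (restr_to_subalg M (nat_filt M X n))
            (\<lambda>\<omega>. ennreal (exp (\<theta> \<bullet> walk X n \<omega> - real n * real_of_ereal (log_mgf M (X 1) \<theta>)))))"

definition mixture :: "'a measure \<Rightarrow> 'd set \<Rightarrow> ('d \<Rightarrow> 'a measure) \<Rightarrow> 'a measure" where
  "mixture M \<Theta> Q =
     measure_of (space M) (sets M) (\<lambda>A. (\<Sum>\<theta>\<in>\<Theta>. emeasure (Q \<theta>) A) / of_nat (card \<Theta>))"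

lemma space_mixture [simp]: "space (mixture M \<Theta> Q) = space M"
  by (simp add: mixture_def)

lemma sets_mixture [simp, measurable_cong]: "sets (mixture M \<Theta> Q) = sets M"
  by (simp add: mixture_def)

lemma emeasure_mixture:
  assumes sets: "\<And>\<theta>. \<theta> \<in> \<Theta> \<Longrightarrow> sets (Q \<theta>) = sets M" and A: "A \<in> sets M"
  shows "emeasure (mixture M \<Theta> Q) A = (\<Sum>\<theta>\<in>\<Theta>. emeasure (Q \<theta>) A) / of_nat (card \<Theta>)"
  unfolding mixture_def
proof (rule emeasure_measure_of_sigma)
  show "sigma_algebra (space M) (sets M)" ..
  show "positive (sets M) (\<lambda>A. (\<Sum>\<theta>\<in>\<Theta>. emeasure (Q \<theta>) A) / of_nat (card \<Theta>))"
    by (simp add: positive_def)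
  show "countably_additive (sets M) (\<lambda>A. (\<Sum>\<theta>\<in>\<Theta>. emeasure (Q \<theta>) A) / of_nat (card \<Theta>))"
  proof (rule countably_additiveI)
    fix A :: "nat \<Rightarrow> _"
    assume A: "range A \<subseteq> sets M" "disjoint_family A"
    have "(\<Sum>i. (\<Sum>\<theta>\<in>\<Theta>. emeasure (Q \<theta>) (A i)) / of_nat (card \<Theta>))
        = (\<Sum>\<theta>\<in>\<Theta>. \<Sum>i. emeasure (Q \<theta>) (A i)) / of_nat (card \<Theta>)"
      by (simp add: suminf_sum)
    also have "(\<Sum>\<theta>\<in>\<Theta>. \<Sum>i. emeasure (Q \<theta>) (A i)) = (\<Sum>\<theta>\<in>\<Theta>. emeasure (Q \<theta>) (\<Union>i. A i))"
      using A by (intro sum.cong refl suminf_emeasure) (auto simp: sets)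
    finally show "(\<Sum>i. (\<Sum>\<theta>\<in>\<Theta>. emeasure (Q \<theta>) (A i)) / of_nat (card \<Theta>))
        = (\<Sum>\<theta>\<in>\<Theta>. emeasure (Q \<theta>) (\<Union>i. A i)) / of_nat (card \<Theta>)" .
  qed
qed (fact A)

definition lik_ratio ::
  "'a measure \<Rightarrow> (nat \<Rightarrow> 'a \<Rightarrow> 'd::euclidean_space) \<Rightarrow> 'd \<Rightarrow> ('a \<Rightarrow> enat) \<Rightarrow> 'a \<Rightarrow> real" where
  "lik_ratio M X \<theta> T \<omega> =
     (case T \<omega> of
        enat n \<Rightarrow> exp (\<theta> \<bullet> walk X n \<omega> - real n * real_of_ereal (log_mgf M (X 1) \<theta>))
      | \<infinity> \<Rightarrow> 0)"

definition is_weight ::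
  "'a measure \<Rightarrow> (nat \<Rightarrow> 'a \<Rightarrow> 'd::euclidean_space) \<Rightarrow> (nat \<Rightarrow> 'd set) \<Rightarrow> nat \<Rightarrow> 'd set
     \<Rightarrow> real \<Rightarrow> 'a \<Rightarrow> real" where
  "is_weight M X W J \<Theta> b \<omega> =
     (if hit_time_min X W J b \<omega> < hit_time X (W 0) b \<omega>
      then inverse ((\<Sum>\<theta>\<in>\<Theta>. lik_ratio M X \<theta> (hit_time_min X W J b) \<omega>) / real (card \<Theta>))
      else 0)"

definition second_moment ::
  "'a measure \<Rightarrow> (nat \<Rightarrow> 'a \<Rightarrow> 'd::euclidean_space) \<Rightarrow> (nat \<Rightarrow> 'd set) \<Rightarrow> nat \<Rightarrow> 'd set
     \<Rightarrow> ('d \<Rightarrow> 'a measure) \<Rightarrow> real \<Rightarrow> ennreal" where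
  "second_moment M X W J \<Theta> Q b =
     (\<integral>\<^sup>+ \<omega>. ennreal ((is_weight M X W J \<Theta> b \<omega>)\<^sup>2) \<partial>(mixture M \<Theta> Q))"

definition asymptotically_efficient ::
  "'a measure \<Rightarrow> (nat \<Rightarrow> 'a \<Rightarrow> 'd::euclidean_space) \<Rightarrow> (nat \<Rightarrow> 'd set) \<Rightarrow> nat \<Rightarrow> 'd set
     \<Rightarrow> ('d \<Rightarrow> 'a measure) \<Rightarrow> bool" where
  "asymptotically_efficient M X W J \<Theta> Q \<longleftrightarrow>
     ((\<lambda>b. log_ennreal (second_moment M X W J \<Theta> Q b)
           / (2 * log_ennreal (emeasure M (rare_event M X W J b)))) \<longlongrightarrow> 1) at_top"

end

theory Submission
  imports Defs "HOL-Real_Asymp.Real_Asymp"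
begin

text \<open>
  The value \<open>r = r\<^sub>\<C>\<close> is reached by convex duality. Let \<open>m(f)\<close> and \<open>H(f)\<close> be the mean and the relative
  entropy of a tilted law with bounded density \<open>f\<close>. The cone of points \<open>(t m(f), h)\<close> with
  \<open>h > t H(f)\<close> is convex, so either it meets \<open>W\<^sup>j \<times> (-\<infinity>, R)\<close>, or a hyperplane separates the two and,
  by the Gibbs variational principle, its normal is a dual vector \<open>\<alpha>\<close> with \<open>\<Lambda>(\<alpha>) \<le> 0\<close> and \<open>\<alpha> \<cdot> y \<ge> R\<close>
  on \<open>W\<^sup>j\<close>. The same dichotomy with \<open>H\<close> shifted by an affine functional of \<open>m(f)\<close> handles \<open>\<V>\<^sub>\<gamma>\<close>: for
  every \<open>j\<close> there are \<open>\<gamma> \<in> \<Theta>\<close> and \<open>\<alpha>\<close> with \<open>\<Lambda>(\<gamma>) + \<Lambda>(\<alpha> - \<gamma>) \<le> 0\<close> and \<open>\<alpha> \<cdot> y \<ge> 2 r\<close> on \<open>W\<^sup>j\<close>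
  (for \<open>j \<in> \<C>\<close> take \<open>\<gamma> = \<beta>\<^sup>j\<close> and \<open>\<alpha> = 2 \<beta>\<^sup>j\<close>).

  The second moment equals the integral of the weight under the original measure. Bounding the
  weight by \<open>|\<Theta>| e\<^sup>-\<^sup>2\<^sup>r\<^sup>b\<close> times the likelihood ratio of \<open>\<alpha> - \<gamma>\<close> and stopping that martingale gives
  \<open>J |\<Theta>| e\<^sup>-\<^sup>2\<^sup>r\<^sup>b\<close>. By Cauchy-Schwarz the second moment is at least the squared probability, so only a
  lower bound \<open>e\<^sup>-\<^sup>(\<^sup>r\<^sup>+\<^sup>\<epsilon>\<^sup>)\<^sup>b\<close> for the probability remains. It comes from tilting every step by a
  near-optimal \<open>f\<close>: the walk then stays close to the segment towards \<open>b t m(f) \<in> b W\<^sup>j\<close>, which keeps it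
  outside \<open>b W\<^sup>0\<close> because the cones are disjoint and \<open>W\<^sup>0\<close> avoids a ball around the origin. Condition
  (C1) makes \<open>r\<close> positive, which is needed only to divide by the logarithm of the probability.
\<close>

section \<open>Relative entropy duality\<close>

lemma log_ennreal_le_iff: "log_ennreal x \<le> ereal c \<longleftrightarrow> x \<le> ennreal (exp c)"
proof (cases x)
  case (real r)
  then show ?thesis
    using ln_le_cancel_iff[of r "exp c"] by (cases "r = 0") (auto simp: log_ennreal_def ennreal_le_iff)
next
  case top
  then show ?thesis by (simp add: log_ennreal_def top_unique)
qed

lemma log_ennreal_finite_iff: "log_ennreal x < \<infinity> \<longleftrightarrow> x < \<infinity>"
  by (auto simp: log_ennreal_def top.not_eq_extremum)

text \<open>The tangent bound \<open>ln z \<le> z - 1\<close> at \<open>z = v / u\<close>,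
  multiplied by \<open>u\<close>. This one pointwise inequality is behind the nonnegativity and
  convexity of the entropy and behind the Gibbs bound.\<close>

lemma ln_mult_le_diff:
  fixes u v :: real
  assumes "u \<ge> 0" "v > 0"
  shows "u * (ln v - ln u) \<le> v - u"
proof (cases "u = 0")
  case False
  then have u: "u > 0" using assms by simp
  have "ln (v / u) \<le> v / u - 1" using u assms by (intro ln_le_minus_one) auto
  then have "u * ln (v / u) \<le> u * (v / u - 1)" using u by (intro mult_left_mono) auto
  also have "u * (v / u - 1) = v - u" using u by (simp add: field_simps)
  finally show ?thesis using u assms by (simp add: ln_div)
qed (use assms in simp)

text \<open>Compare both points with their weighted mean by \<open>ln_mult_le_diff\<close>; the
  first-order terms cancel. Unlike a second-derivative test, this includes the boundary value
  0.\<close>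

lemma convex_xlnx:
  fixes u v p q :: real
  assumes "u \<ge> 0" "v \<ge> 0" "p > 0" "q > 0" "p + q = 1"
  shows "(p * u + q * v) * ln (p * u + q * v) \<le> p * (u * ln u) + q * (v * ln v)"
proof (cases "p * u + q * v = 0")
  case True
  moreover have "p * u \<ge> 0" "q * v \<ge> 0" using assms by auto
  ultimately have "p * u = 0" "q * v = 0" by linarith+
  then show ?thesis using assms by auto
next
  case False
  define w where "w = p * u + q * v"
  have "p * u \<ge> 0" "q * v \<ge> 0" using assms by auto
  then have w: "w > 0" using False by (simp add: w_def)
  have "p * (u * (ln w - ln u)) + q * (v * (ln w - ln v)) \<le> p * (w - u) + q * (w - v)"
    using ln_mult_le_diff[of u w] ln_mult_le_diff[of v w] assms w
    by (intro add_mono mult_left_mono) auto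
  also have "\<dots> = (p + q) * w - w" by (simp add: w_def algebra_simps)
  also have "\<dots> = 0" using assms by simp
  finally show ?thesis by (simp add: w_def algebra_simps)
qed

text \<open>Let \<open>t\<close> tend to 0 for the first sign and to infinity for the second. This
  turns a bound for a linear functional along a ray into sign conditions on offset and
  slope.\<close>

lemma linear_lower_bound_nonneg:
  fixes b k :: real
  assumes k: "\<And>t. t > 0 \<Longrightarrow> b \<le> t * k"
  shows "b \<le> 0 \<and> 0 \<le> k"
proof
  show "b \<le> 0"
  proof (rule field_le_epsilon)
    fix e :: real assume e: "e > 0"
    have "b \<le> e / (\<bar>k\<bar> + 1) * k" using e by (intro k) auto
    also have "\<dots> \<le> e / (\<bar>k\<bar> + 1) * (\<bar>k\<bar> + 1)" using e by (intro mult_left_mono) auto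
    finally show "b \<le> 0 + e" by simp
  qed
  show "0 \<le> k"
  proof (rule ccontr)
    assume "\<not> 0 \<le> k"
    then have "k < 0" by simp
    then have "b \<le> (\<bar>b\<bar> + 1) / (- k) * k" by (intro k divide_pos_pos) auto
    also have "\<dots> = - (\<bar>b\<bar> + 1)" using \<open>k < 0\<close> by (simp add: field_simps)
    finally show False by simp
  qed
qed

section \<open>Tilted laws, their entropy, and the Gibbs variational principle\<close>

locale borel_prob = prob_space \<mu> for \<mu> :: "'d::euclidean_space measure" +
  assumes sets_mu [simp, measurable_cong]: "sets \<mu> = sets borel"
begin

lemma space_mu [simp]: "space \<mu> = UNIV"
  using sets_eq_imp_space_eq[OF sets_mu] by simp

text \<open>Boundedness from below on the support makes \<open>ln f\<close> bounded there, so that the log-likelihood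
  has exponential moments; this class is still closed under nontrivial mixtures.\<close>

definition tame_density :: "('d \<Rightarrow> real) \<Rightarrow> bool" where
  "tame_density f \<longleftrightarrow> f \<in> borel_measurable borel \<and> (\<integral>x. f x \<partial>\<mu>) = 1 \<and>
     (\<exists>N>0. \<forall>x. f x = 0 \<or> (1 / N \<le> f x \<and> f x \<le> N \<and> norm x \<le> N))"

definition tame_mean :: "('d \<Rightarrow> real) \<Rightarrow> 'd" where
  "tame_mean f = (\<integral>x. f x *\<^sub>R x \<partial>\<mu>)"

definition rel_ent :: "('d \<Rightarrow> real) \<Rightarrow> real" where
  "rel_ent f = (\<integral>x. f x * ln (f x) \<partial>\<mu>)"

abbreviation "\<Lambda> \<equiv> log_mgf \<mu> (\<lambda>x. x)"

lemma tame_measurable [measurable_dest]: "tame_density f \<Longrightarrow> f \<in> borel_measurable borel"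
  by (simp add: tame_density_def)

lemma tame_nonneg: assumes "tame_density f" shows "f x \<ge> 0"
proof -
  obtain N where "N > 0" "f x = 0 \<or> 1 / N \<le> f x" using assms by (auto simp: tame_density_def)
  moreover from this(1) have "1 / N > 0" by simp
  ultimately show ?thesis by linarith
qed

text \<open>The product vanishes off the support of \<open>f\<close>, so a bound for \<phi> there is
  enough; this admits unbounded functions such as the identity.\<close>

lemma tame_integrable:
  fixes \<phi> :: "'d \<Rightarrow> 'b::{banach, second_countable_topology}"
  assumes f: "tame_density f" and [measurable]: "\<phi> \<in> borel_measurable borel"
    and K: "\<And>x. f x \<noteq> 0 \<Longrightarrow> norm (\<phi> x) \<le> K"
  shows "integrable \<mu> (\<lambda>x. f x *\<^sub>R \<phi> x)"
proof -
  note tame_measurable[OF f, measurable]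
  obtain N where N: "N > 0" "\<And>x. f x = 0 \<or> (1 / N \<le> f x \<and> f x \<le> N \<and> norm x \<le> N)"
    using f by (auto simp: tame_density_def)
  have "norm (f x *\<^sub>R \<phi> x) \<le> N * \<bar>K\<bar>" for x
  proof (cases "f x = 0")
    case False
    then have "norm (\<phi> x) \<le> \<bar>K\<bar>" using K[of x] by linarith
    moreover have "\<bar>f x\<bar> \<le> N" using N(2)[of x] False tame_nonneg[OF f, of x] by simp
    ultimately show ?thesis by (simp add: mult_mono N(1) less_imp_le)
  qed (use N in simp)
  then show ?thesis by (intro integrable_const_bound[where B = "N * \<bar>K\<bar>"]) auto
qed

lemma tame_ln_bound:
  assumes "tame_density f"
  obtains K where "K > 0" "\<And>x. f x \<noteq> 0 \<Longrightarrow> \<bar>ln (f x)\<bar> \<le> K" "\<And>x. f x \<noteq> 0 \<Longrightarrow> norm x \<le> K"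
proof -
  obtain N where N: "N > 0" "\<And>x. f x = 0 \<or> (1 / N \<le> f x \<and> f x \<le> N \<and> norm x \<le> N)"
    using assms by (auto simp: tame_density_def)
  show thesis
  proof
    show "N + \<bar>ln N\<bar> > 0" using N by linarith
    fix x assume "f x \<noteq> 0"
    then have *: "1 / N \<le> f x" "f x \<le> N" "norm x \<le> N" using N(2)[of x] by auto
    then have pos: "f x > 0" using N(1) by (meson divide_pos_pos less_le_trans zero_less_one)
    have "ln (f x) \<le> ln N" using * pos N by (simp add: ln_le_cancel_iff)
    moreover have "ln (1 / N) \<le> ln (f x)" using * pos N by (subst ln_le_cancel_iff) auto
    ultimately show "\<bar>ln (f x)\<bar> \<le> N + \<bar>ln N\<bar>" using N(1) by (simp add: ln_div)
    show "norm x \<le> N + \<bar>ln N\<bar>" using * by simp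
  qed
qed

lemma tame_integrables:
  assumes f: "tame_density f"
  shows "integrable \<mu> f" "integrable \<mu> (\<lambda>x. f x *\<^sub>R x)"
    "integrable \<mu> (\<lambda>x. f x * ln (f x))" "integrable \<mu> (\<lambda>x. f x * (\<theta> \<bullet> x))"
proof -
  note tame_measurable[OF f, measurable]
  obtain K where K: "K > 0" "\<And>x. f x \<noteq> 0 \<Longrightarrow> \<bar>ln (f x)\<bar> \<le> K" "\<And>x. f x \<noteq> 0 \<Longrightarrow> norm x \<le> K"
    using tame_ln_bound[OF f] by metis
  show "integrable \<mu> f" using tame_integrable[OF f, of "\<lambda>_. 1::real" 1] by simp
  show i: "integrable \<mu> (\<lambda>x. f x *\<^sub>R x)" using tame_integrable[OF f, of "\<lambda>x. x" K] K by simp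
  show "integrable \<mu> (\<lambda>x. f x * ln (f x))"
    using tame_integrable[OF f, of "\<lambda>x. ln (f x)" K] K by simp
  show "integrable \<mu> (\<lambda>x. f x * (\<theta> \<bullet> x))"
    using integrable_inner_right[OF i, of \<theta>] by (simp add: inner_scaleR_right)
qed

lemma tame_integral: "tame_density f \<Longrightarrow> (\<integral>x. f x \<partial>\<mu>) = 1"
  by (simp add: tame_density_def)

lemma tame_nn_integral:
  assumes f: "tame_density f"
  shows "(\<integral>\<^sup>+x. ennreal (f x) \<partial>\<mu>) = 1"
  using nn_integral_eq_integral[OF tame_integrables(1)[OF f]] tame_nonneg[OF f]
  by (simp add: tame_integral[OF f])

lemma inner_tame_mean:
  "tame_density f \<Longrightarrow> \<theta> \<bullet> tame_mean f = (\<integral>x. f x * (\<theta> \<bullet> x) \<partial>\<mu>)"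
  using integral_inner_right[of \<theta> \<mu> "\<lambda>x. f x *\<^sub>R x"] tame_integrables(2)[of f]
  by (simp add: tame_mean_def)

text \<open>Integrate \<open>f x - 1 \<le> f x * ln (f x)\<close>; the left side has mean
  zero.\<close>

lemma rel_ent_nonneg: assumes f: "tame_density f" shows "rel_ent f \<ge> 0"
proof -
  have "0 = (\<integral>x. f x - 1 \<partial>\<mu>)"
    using tame_integrables(1)[OF f] f by (subst Bochner_Integration.integral_diff) (auto simp: tame_density_def prob_space[unfolded space_mu])
  also have "\<dots> \<le> rel_ent f" unfolding rel_ent_def
  proof (rule integral_mono)
    fix x show "f x - 1 \<le> f x * ln (f x)"
      using ln_mult_le_diff[OF tame_nonneg[OF f, of x], of 1] by simp
  qed (use tame_integrables[OF f] in auto)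
  finally show ?thesis .
qed

text \<open>This closure property makes the set \<open>T\<close> in \<open>tilt_alternative\<close>
  convex. Strictly positive weights matter: wherever \<open>h\<close> is nonzero, one of its
  summands is at least \<open>p / N\<close> or \<open>q / N'\<close>.\<close>

lemma tame_mix:
  assumes f: "tame_density f" and g: "tame_density g" and p: "p > 0" "q > 0" "p + q = 1"
  defines "h \<equiv> \<lambda>x. p * f x + q * g x"
  shows "tame_density h" "tame_mean h = p *\<^sub>R tame_mean f + q *\<^sub>R tame_mean g"
    "rel_ent h \<le> p * rel_ent f + q * rel_ent g"
proof -
  note tame_measurable[OF f, measurable] tame_measurable[OF g, measurable]
  note fi = tame_integrables[OF f] and gi = tame_integrables[OF g]
  obtain N where N: "N > 0" "\<And>x. f x = 0 \<or> (1 / N \<le> f x \<and> f x \<le> N \<and> norm x \<le> N)"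
    using f by (auto simp: tame_density_def)
  obtain N' where N': "N' > 0" "\<And>x. g x = 0 \<or> (1 / N' \<le> g x \<and> g x \<le> N' \<and> norm x \<le> N')"
    using g by (auto simp: tame_density_def)
  \<comment> \<open>The terms \<open>N / p\<close> and \<open>N' / q\<close> yield the lower bound
    \<open>1 / L\<close> on the support, \<open>N + N'\<close> the upper bound, and \<open>N\<close>
    and \<open>N'\<close> the bound on the norm.\<close>
  define L where "L = N + N' + N / p + N' / q"
  have L: "L > 0" "N \<le> L" "N' \<le> L" "N / p \<le> L" "N' / q \<le> L" "N + N' \<le> L"
    using N(1) N'(1) p by (auto simp: L_def add_pos_pos)
  have b: "1 / L \<le> p / N" "1 / L \<le> q / N'"
  proof -
    show "1 / L \<le> p / N" using L(4) L(1) N(1) p by (simp add: field_simps)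
    show "1 / L \<le> q / N'" using L(5) L(1) N'(1) p by (simp add: field_simps)
  qed
  have hb: "h x = 0 \<or> (1 / L \<le> h x \<and> h x \<le> L \<and> norm x \<le> L)" for x
  proof -
    have f0: "f x \<ge> 0" "g x \<ge> 0" using tame_nonneg f g by auto
    have pq: "p < 1" "q < 1" using p by linarith+
    have "f x \<le> N" "g x \<le> N'" using N(2)[of x] N'(2)[of x] N(1) N'(1) by auto
    then have "p * f x \<le> 1 * N" "q * g x \<le> 1 * N'" using pq p f0 by (intro mult_mono; simp)+
    then have u: "h x \<le> L" using L(6) by (simp add: h_def)
    consider "f x = 0" "g x = 0" | "f x \<noteq> 0" | "g x \<noteq> 0" by blast
    then show ?thesis
    proof cases
      case 2
      then have "1 / N \<le> f x" "norm x \<le> N" using N(2)[of x] by auto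
      then have "p * (1 / N) \<le> p * f x" using p by (intro mult_left_mono) auto
      moreover have "0 \<le> q * g x" using p f0 by simp
      ultimately have "1 / L \<le> h x" using b(1) unfolding h_def by simp
      then show ?thesis using u \<open>norm x \<le> N\<close> L by auto
    next
      case 3
      then have "1 / N' \<le> g x" "norm x \<le> N'" using N'(2)[of x] by auto
      then have "q * (1 / N') \<le> q * g x" using p by (intro mult_left_mono) auto
      moreover have "0 \<le> p * f x" using p f0 by simp
      ultimately have "1 / L \<le> h x" using b(2) unfolding h_def by simp
      then show ?thesis using u \<open>norm x \<le> N'\<close> L by auto
    qed (simp add: h_def)
  qed
  have "(\<integral>x. h x \<partial>\<mu>) = 1"
    using fi(1) gi(1) f g p unfolding h_def
    by (subst Bochner_Integration.integral_add) (auto simp: tame_density_def)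
  then show h: "tame_density h" unfolding tame_density_def using hb L(1)
    by (auto simp: h_def intro!: exI[of _ L])
  show "tame_mean h = p *\<^sub>R tame_mean f + q *\<^sub>R tame_mean g"
    using fi(2) gi(2) unfolding tame_mean_def h_def
    by (simp add: scaleR_add_left flip: scaleR_scaleR)
  have "rel_ent h \<le> (\<integral>x. p * (f x * ln (f x)) + q * (g x * ln (g x)) \<partial>\<mu>)"
    unfolding rel_ent_def
  proof (rule integral_mono)
    fix x show "h x * ln (h x) \<le> p * (f x * ln (f x)) + q * (g x * ln (g x))"
      unfolding h_def using tame_nonneg f g p by (intro convex_xlnx) auto
  qed (use tame_integrables[OF h] fi gi in auto)
  also have "\<dots> = p * rel_ent f + q * rel_ent g" using fi(3) gi(3) by (simp add: rel_ent_def)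
  finally show "rel_ent h \<le> p * rel_ent f + q * rel_ent g" .
qed

text \<open>Weak duality: integrate \<open>ln_mult_le_diff\<close> with
  \<open>v = exp (\<theta> \<bullet> x - c)\<close>. This function has mass at most 1, while
  \<open>f\<close> has mass exactly 1, so the right-hand side is at most 0.\<close>

lemma gibbs_le:
  assumes f: "tame_density f" and L: "\<Lambda> \<theta> \<le> ereal c"
  shows "\<theta> \<bullet> tame_mean f \<le> rel_ent f + c"
proof -
  note fi = tame_integrables[OF f]
  have le: "(\<integral>\<^sup>+x. ennreal (exp (\<theta> \<bullet> x)) \<partial>\<mu>) \<le> ennreal (exp c)"
    using L by (simp add: log_mgf_def log_ennreal_le_iff)
  then have int: "integrable \<mu> (\<lambda>x. exp (\<theta> \<bullet> x))"
    by (intro integrableI_nonneg) (auto simp: le_less_trans)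
  have "ennreal (\<integral>x. exp (\<theta> \<bullet> x) \<partial>\<mu>) \<le> ennreal (exp c)"
    using le int by (subst (asm) nn_integral_eq_integral) auto
  then have le': "(\<integral>x. exp (\<theta> \<bullet> x) \<partial>\<mu>) \<le> exp c" by (subst (asm) ennreal_le_iff) auto
  have "\<theta> \<bullet> tame_mean f - rel_ent f - c = (\<integral>x. f x * (\<theta> \<bullet> x) - f x * ln (f x) - f x * c \<partial>\<mu>)"
    using fi f by (simp add: inner_tame_mean rel_ent_def tame_density_def)
  also have "\<dots> \<le> (\<integral>x. exp (- c) * exp (\<theta> \<bullet> x) - f x \<partial>\<mu>)"
  proof (rule integral_mono)
    fix x
    have "exp (- c) * exp (\<theta> \<bullet> x) = exp (\<theta> \<bullet> x - c)" by (simp flip: exp_add)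
    then show "f x * (\<theta> \<bullet> x) - f x * ln (f x) - f x * c \<le> exp (- c) * exp (\<theta> \<bullet> x) - f x"
      using ln_mult_le_diff[OF tame_nonneg[OF f, of x], of "exp (\<theta> \<bullet> x - c)"]
      by (simp add: algebra_simps)
  qed (use fi int in auto)
  also have "\<dots> = exp (- c) * (\<integral>x. exp (\<theta> \<bullet> x) \<partial>\<mu>) - 1"
    using fi int f by (simp add: tame_density_def)
  also have "\<dots> \<le> exp (- c) * exp c - 1" using le' by (intro diff_right_mono mult_left_mono) auto
  also have "\<dots> = 0" by (simp flip: exp_add)
  finally show ?thesis by simp
qed

text \<open>Test against the law tilted by \<open>\<theta>\<close> and truncated to a ball.\<close>

lemma gibbs_ge:
  assumes f: "\<And>f. tame_density f \<Longrightarrow> \<theta> \<bullet> tame_mean f + c \<le> rel_ent f"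
  shows "\<Lambda> \<theta> \<le> ereal (- c)"
proof (rule ccontr)
  assume "\<not> \<Lambda> \<theta> \<le> ereal (- c)"
  then have gt: "(\<integral>\<^sup>+x. ennreal (exp (\<theta> \<bullet> x)) \<partial>\<mu>) > ennreal (exp (- c))"
    by (simp add: log_mgf_def log_ennreal_le_iff)
  define g where "g = (\<lambda>(n::nat) x. exp (\<theta> \<bullet> x) * indicator (cball 0 (real n)) x)"
  have [measurable]: "g n \<in> borel_measurable borel" for n unfolding g_def
    by (intro borel_measurable_times borel_measurable_indicator) auto
  have "(\<integral>\<^sup>+x. ennreal (exp (\<theta> \<bullet> x)) \<partial>\<mu>) = (\<integral>\<^sup>+x. (SUP n. ennreal (g n x)) \<partial>\<mu>)"
  proof (rule nn_integral_cong)
    fix x :: 'd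
    obtain m :: nat where m: "norm x \<le> real m" using real_arch_simple by blast
    show "ennreal (exp (\<theta> \<bullet> x)) = (SUP n. ennreal (g n x))"
    proof (rule antisym)
      have "ennreal (exp (\<theta> \<bullet> x)) = ennreal (g m x)" using m by (simp add: g_def)
      then show "ennreal (exp (\<theta> \<bullet> x)) \<le> (SUP n. ennreal (g n x))" by (metis SUP_upper UNIV_I)
      show "(SUP n. ennreal (g n x)) \<le> ennreal (exp (\<theta> \<bullet> x))"
        by (intro SUP_least ennreal_leI) (auto simp: g_def indicator_def)
    qed
  qed
  also have "\<dots> = (SUP n. (\<integral>\<^sup>+x. ennreal (g n x) \<partial>\<mu>))"
    by (intro nn_integral_monotone_convergence_SUP)
       (auto simp: incseq_def le_fun_def g_def indicator_def intro!: ennreal_leI)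
  \<comment> \<open>By monotone convergence a large enough ball already carries more than
    \<open>exp (- c)\<close>.\<close>
  finally obtain n where n: "(\<integral>\<^sup>+x. ennreal (g n x) \<partial>\<mu>) > ennreal (exp (- c))"
    using gt by (auto simp: less_SUP_iff)
  have inner: "\<bar>\<theta> \<bullet> x\<bar> \<le> norm \<theta> * n" if "norm x \<le> n" for x
    using Cauchy_Schwarz_ineq2[of \<theta> x] that by (meson mult_left_mono norm_ge_zero order_trans)
  have int: "integrable \<mu> (g n)"
    using inner by (intro integrable_const_bound[where B="exp (norm \<theta> * n)"])
      (auto simp: g_def indicator_def abs_le_iff)
  define Z where "Z = (\<integral>x. g n x \<partial>\<mu>)"
  have "ennreal Z > ennreal (exp (- c))"
    using n int unfolding Z_def by (subst (asm) nn_integral_eq_integral) (auto simp: g_def)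
  then have Z: "Z > exp (- c)" by (subst (asm) ennreal_less_iff) auto
  then have Z0: "Z > 0" by (meson exp_gt_zero less_trans)
  define f where "f = (\<lambda>x. g n x / Z)"
  \<comment> \<open>On the ball the exponent lies between \<open>- (norm \<theta> * n)\<close> and
    \<open>norm \<theta> * n\<close>, so this \<open>N\<close> bounds \<open>f\<close>,
    \<open>1 / f\<close> and the radius at once.\<close>
  define N where "N = exp (norm \<theta> * n) * (Z + 1 / Z) + n"
  have N: "N > 0" using Z0 by (simp add: N_def add_pos_nonneg)
  have "1 / N \<le> f x \<and> f x \<le> N \<and> norm x \<le> N" if "f x \<noteq> 0" for x
  proof (intro conjI)
    have nx: "norm x \<le> n" using that by (auto simp: f_def g_def indicator_def split: if_splits)
    have fx: "f x = exp (\<theta> \<bullet> x) / Z" using nx by (simp add: f_def g_def)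
    have ub: "exp (\<theta> \<bullet> x) \<le> exp (norm \<theta> * n)" and lb: "exp (- (norm \<theta> * n)) \<le> exp (\<theta> \<bullet> x)"
      using inner[OF nx] by auto
    have "exp (norm \<theta> * n) * Z \<le> N" "exp (norm \<theta> * n) / Z \<le> N"
      using Z0 by (simp_all add: N_def distrib_left)
    note this(1)
    then have "1 / N \<le> 1 / (exp (norm \<theta> * n) * Z)" using Z0 N by (intro divide_left_mono) (auto intro!: mult_pos_pos)
    also have "\<dots> = exp (- (norm \<theta> * n)) / Z" by (simp add: exp_minus field_simps)
    also have "\<dots> \<le> f x" unfolding fx using lb Z0 by (intro divide_right_mono) auto
    finally show "1 / N \<le> f x" .
    show "f x \<le> N" unfolding fx using \<open>exp (norm \<theta> * n) / Z \<le> N\<close> ub Z0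
      by (meson divide_right_mono less_imp_le order_trans)
    show "norm x \<le> N" using nx Z0 by (simp add: N_def add_increasing)
  qed
  then have tame: "tame_density f"
    using Z0 N by (auto simp: tame_density_def f_def Z_def)
  note fi = tame_integrables[OF tame]
  \<comment> \<open>Since \<open>ln f\<close> is affine on the ball, the entropy is
    \<open>\<theta> \<bullet> tame_mean f - ln Z\<close> exactly, and the hypothesis forces
    \<open>Z \<le> exp (- c)\<close>.\<close>
  have "rel_ent f = (\<integral>x. f x * (\<theta> \<bullet> x) - f x * ln Z \<partial>\<mu>)" unfolding rel_ent_def
  proof (rule Bochner_Integration.integral_cong)
    fix x show "f x * ln (f x) = f x * (\<theta> \<bullet> x) - f x * ln Z"
      using Z0 by (cases "norm x \<le> n")
        (simp_all add: f_def g_def ln_div diff_divide_distrib right_diff_distrib)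
  qed simp
  also have "\<dots> = \<theta> \<bullet> tame_mean f - ln Z"
    using fi tame by (simp add: inner_tame_mean tame_density_def)
  finally have "ln Z \<le> - c" using f[OF tame] by simp
  then have "Z \<le> exp (- c)" using Z0 by (metis exp_ln exp_le_cancel_iff)
  then show False using Z by simp
qed

text \<open>Otherwise \<open>gibbs_ge\<close> would apply vacuously and give \<open>\<Lambda> 0 < 0\<close>.\<close>

lemma tame_exists: "\<exists>f. tame_density f"
  using gibbs_ge[of 0 1] prob_space
  by (auto simp: log_mgf_def emeasure_space_1[unfolded space_mu] log_ennreal_def split: if_splits)

text \<open>With \<open>\<gamma> = 0\<close> and \<open>l = 0\<close> the dual branch bounds
  \<open>rate_I\<close>; with \<open>l\<close> the value of \<Lambda> at \<gamma> it is the
  constraint of \<open>tilt_V\<close>. A single \<alpha> serves all of \<open>W\<close>. The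
  interior condition rules out a vertical separating hyperplane.\<close>

lemma tilt_alternative:
  assumes W: "convex W" "W \<noteq> {}"
    and meet: "interior (pos_cone (eff_dom (legendre \<Lambda>))) \<inter> W \<noteq> {}"
  obtains (primal) f t where "tame_density f" "t > 0" "t *\<^sub>R tame_mean f \<in> W"
      "t * (rel_ent f + \<gamma> \<bullet> tame_mean f - l) < R"
    | (dual) \<alpha> where "\<Lambda> (\<alpha> - \<gamma>) \<le> ereal (- l)" "\<And>y. y \<in> W \<Longrightarrow> R \<le> \<alpha> \<bullet> y"
proof -
  \<comment> \<open>Strict inequalities in both sets make a common point equivalent to a primal
    solution: some level \<open>h\<close> fits strictly between its cost and
    \<open>R\<close>.\<close>
  define S where "S = {(x :: 'd, h :: real). x \<in> W \<and> h < R}"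
  define T where "T = {(t *\<^sub>R tame_mean f, h) | t f h.
     t > 0 \<and> tame_density f \<and> t * (rel_ent f + \<gamma> \<bullet> tame_mean f - l) < h}"
  show thesis
  proof (cases "S \<inter> T = {}")
    case False
    then obtain t f h where "t > 0" "tame_density f" "t *\<^sub>R tame_mean f \<in> W"
      "t * (rel_ent f + \<gamma> \<bullet> tame_mean f - l) < h" "h < R"
      by (auto simp: S_def T_def)
    then show thesis by (intro primal[of f t]) auto
  next
    case True
    have "S = W \<times> {..<R}" by (auto simp: S_def)
    then have cS: "convex S" and S0: "S \<noteq> {}" using W by (auto intro: convex_Times)
    have T0: "T \<noteq> {}"
    proof -
      obtain f where "tame_density f" using tame_exists by blast
      then have "(1 *\<^sub>R tame_mean f, 1 * (rel_ent f + \<gamma> \<bullet> tame_mean f - l) + 1) \<in> T"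
        unfolding T_def by (auto intro!: exI[of _ 1] exI[of _ f])
      then show ?thesis by blast
    qed
    have cT: "convex T"
    proof (rule convexI)
      fix x y and u v :: real assume xy: "x \<in> T" "y \<in> T" and uv: "0 \<le> u" "0 \<le> v" "u + v = 1"
      obtain t f h where x: "x = (t *\<^sub>R tame_mean f, h)" "t > 0" "tame_density f"
        "t * (rel_ent f + \<gamma> \<bullet> tame_mean f - l) < h" using xy by (auto simp: T_def)
      obtain s g k where y: "y = (s *\<^sub>R tame_mean g, k)" "s > 0" "tame_density g"
        "s * (rel_ent g + \<gamma> \<bullet> tame_mean g - l) < k" using xy by (auto simp: T_def)
      show "u *\<^sub>R x + v *\<^sub>R y \<in> T"
      proof (cases "u = 0 \<or> v = 0")
        case True then show ?thesis using uv xy by auto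
      next
        case False
        then have u: "u > 0" "v > 0" using uv by auto
        \<comment> \<open>The combination has total time \<open>z\<close>, and \<open>p\<close> and
          \<open>q\<close> are the shares of the two laws in it, so \<open>z\<close> times the mixed
          mean is the combination of the scaled means.\<close>
        define z where "z = u * t + v * s"
        have ut: "u * t > 0" "v * s > 0" using u x y by auto
        then have z: "z > 0" by (simp add: z_def)
        define p q where "p = u * t / z" and "q = v * s / z"
        have pq: "p > 0" "q > 0" "p + q = 1" using ut z
          by (auto simp: p_def q_def) (simp add: z_def flip: add_divide_distrib)
        define w where "w = (\<lambda>x. p * f x + q * g x)"
        note m = tame_mix[OF x(3) y(3) pq, folded w_def]
        have zp: "z * p = u * t" "z * q = v * s" using z by (auto simp: p_def q_def)
        have zm: "z *\<^sub>R tame_mean w = (u * t) *\<^sub>R tame_mean f + (v * s) *\<^sub>R tame_mean g"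
          by (simp add: m(2) scaleR_add_right zp)
        have "z * (rel_ent w + \<gamma> \<bullet> tame_mean w - l) = z * rel_ent w + \<gamma> \<bullet> (z *\<^sub>R tame_mean w) - z * l"
          by (simp add: algebra_simps)
        also have "\<dots> \<le> z * (p * rel_ent f + q * rel_ent g) + \<gamma> \<bullet> (z *\<^sub>R tame_mean w) - z * l"
          using m(3) z by simp
        also have "\<dots> = (z * p) * rel_ent f + (z * q) * rel_ent g + \<gamma> \<bullet> (z *\<^sub>R tame_mean w) - z * l"
          by (simp add: algebra_simps)
        also have "\<dots> = u * (t * (rel_ent f + \<gamma> \<bullet> tame_mean f - l))
                      + v * (s * (rel_ent g + \<gamma> \<bullet> tame_mean g - l))"
          unfolding zp zm by (simp add: z_def algebra_simps inner_add_right)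
        also have "\<dots> < u * h + v * k"
          using x(4) y(4) u by (intro add_strict_mono mult_strict_left_mono) auto
        finally have "(z *\<^sub>R tame_mean w, u * h + v * k) \<in> T"
          unfolding T_def using z m(1) by blast
        also have "(z *\<^sub>R tame_mean w, u * h + v * k) = u *\<^sub>R x + v *\<^sub>R y"
          by (simp add: x(1) y(1) zm)
        finally show ?thesis .
      qed
    qed
    obtain ac b where ac: "ac \<noteq> 0" "\<And>z. z \<in> S \<Longrightarrow> ac \<bullet> z \<le> b" "\<And>z. z \<in> T \<Longrightarrow> b \<le> ac \<bullet> z"
      using separating_hyperplane_sets[OF cS cT S0 T0 True] by blast
    obtain a c where ac_eq: "ac = (a, c)" by (cases ac)
    have onS: "a \<bullet> y + c * h \<le> b" if "y \<in> W" "h < R" for y h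
      using ac(2)[of "(y, h)"] that by (simp add: ac_eq S_def)
    have onT: "b \<le> t * (a \<bullet> tame_mean f) + c * h" if "t > 0" "tame_density f"
      "t * (rel_ent f + \<gamma> \<bullet> tame_mean f - l) < h" for t f h
    proof -
      have "(t *\<^sub>R tame_mean f, h) \<in> T" unfolding T_def using that by blast
      from ac(3)[OF this] show ?thesis by (simp add: ac_eq)
    qed
    obtain y0 where y0: "y0 \<in> W" using W by blast
    have c0: "c \<ge> 0"
    proof (rule ccontr)
      assume "\<not> c \<ge> 0"
      then have c: "c < 0" by simp
      \<comment> \<open>\<open>S\<close> is unbounded below in the second coordinate, so with
        negative \<open>c\<close> the functional would exceed \<open>b\<close> at this
        level.\<close>
      define h where "h = min (R - 1) ((b - a \<bullet> y0 + 1) / c)"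
      have "h \<le> (b - a \<bullet> y0 + 1) / c" by (simp add: h_def)
      then have "c * h \<ge> b - a \<bullet> y0 + 1" using c by (simp add: neg_le_divide_eq mult.commute)
      moreover have "a \<bullet> y0 + c * h \<le> b" using onS[OF y0, of h] by (simp add: h_def)
      ultimately show False by simp
    qed
    \<comment> \<open>The strict bound on the level is relaxed to its infimum by letting the excess
      \<open>e / (c + 1)\<close> vanish.\<close>
    have onT': "b \<le> t * (a \<bullet> tame_mean f + c * (rel_ent f + \<gamma> \<bullet> tame_mean f - l))"
      if "t > 0" "tame_density f" for t f
    proof (rule field_le_epsilon)
      fix e :: real assume e: "e > 0"
      let ?h = "t * (rel_ent f + \<gamma> \<bullet> tame_mean f - l)"
      have "b \<le> t * (a \<bullet> tame_mean f) + c * (?h + e / (c + 1))"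
        using c0 e by (intro onT that) auto
      also have "c * (e / (c + 1)) \<le> e" using c0 e by (simp add: field_simps)
      then have "t * (a \<bullet> tame_mean f) + c * (?h + e / (c + 1)) \<le>
        t * (a \<bullet> tame_mean f + c * (rel_ent f + \<gamma> \<bullet> tame_mean f - l)) + e"
        by (simp add: algebra_simps)
      finally show "b \<le> t * (a \<bullet> tame_mean f + c * (rel_ent f + \<gamma> \<bullet> tame_mean f - l)) + e" .
    qed
    \<comment> \<open>The previous bound holds for every \<open>t > 0\<close>, which splits it into
      two sign conditions.\<close>
    have key: "b \<le> 0 \<and> 0 \<le> a \<bullet> tame_mean f + c * (rel_ent f + \<gamma> \<bullet> tame_mean f - l)"
      if "tame_density f" for f
      using onT'[OF _ that] by (rule linear_lower_bound_nonneg)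
    have b0: "b \<le> 0" using key tame_exists by blast
    show thesis
    proof (cases "c = 0")
      case False
      then have c: "c > 0" using c0 by simp
      \<comment> \<open>Dividing by \<open>c\<close> writes the hyperplane as a graph; its slope is
        the dual vector.\<close>
      define \<alpha> where "\<alpha> = (- 1 / c) *\<^sub>R a"
      have a: "a = - (c *\<^sub>R \<alpha>)" using c by (simp add: \<alpha>_def)
      show thesis
      proof (rule dual)
        show "\<Lambda> (\<alpha> - \<gamma>) \<le> ereal (- l)"
        proof (rule gibbs_ge)
          fix f assume f: "tame_density f"
          have "0 \<le> c * (rel_ent f - ((\<alpha> - \<gamma>) \<bullet> tame_mean f + l))"
            using key[OF f] by (simp add: a algebra_simps inner_diff_left)
          then show "(\<alpha> - \<gamma>) \<bullet> tame_mean f + l \<le> rel_ent f"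
            using c by (simp add: zero_le_mult_iff)
        qed
        fix y assume y: "y \<in> W"
        show "R \<le> \<alpha> \<bullet> y"
        proof (rule field_le_epsilon)
          fix e :: real assume "e > 0"
          then have "a \<bullet> y + c * (R - e) \<le> b" by (intro onS y) auto
          then have "c * (R - e - \<alpha> \<bullet> y) \<le> 0" using b0 by (simp add: a algebra_simps)
          then show "R \<le> \<alpha> \<bullet> y + e" using c by (simp add: mult_le_0_iff)
        qed
      qed
    next
      \<comment> \<open>The hyperplane is vertical. Then every \<open>- s *\<^sub>R a\<close>
        satisfies \<open>\<Lambda> \<le> 0\<close>, which puts the domain of the Legendre transform
        into the half-space \<open>a \<bullet> x \<ge> 0\<close>. A point of \<open>W\<close>
        interior to its cone has \<open>a \<bullet> z > 0\<close>, against
        \<open>a \<bullet> z \<le> b \<le> 0\<close>.\<close>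
      case True
      then have a0: "a \<noteq> 0" using ac(1) by (auto simp: ac_eq zero_prod_def)
      have L: "\<Lambda> (- s *\<^sub>R a) \<le> 0" if "s \<ge> 0" for s
      proof -
        have "\<Lambda> (- s *\<^sub>R a) \<le> ereal (- 0)"
        proof (rule gibbs_ge)
          fix f assume f: "tame_density f"
          have "0 \<le> s * (a \<bullet> tame_mean f)" using key[OF f] True that by simp
          then show "- s *\<^sub>R a \<bullet> tame_mean f + 0 \<le> rel_ent f" using rel_ent_nonneg[OF f] by simp
        qed
        then show ?thesis by (simp add: zero_ereal_def)
      qed
      \<comment> \<open>Otherwise testing with \<open>- s *\<^sub>R a\<close> for arbitrarily large
        \<open>s\<close> would make the Legendre transform infinite at \<open>x\<close>.\<close>
      have dom: "a \<bullet> x \<ge> 0" if "x \<in> eff_dom (legendre \<Lambda>)" for x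
      proof (rule ccontr)
        assume "\<not> a \<bullet> x \<ge> 0"
        then have neg: "- (a \<bullet> x) > 0" by simp
        have "ereal (s * - (a \<bullet> x)) \<le> legendre \<Lambda> x" if "s \<ge> 0" for s
        proof -
          have "ereal ((- s *\<^sub>R a) \<bullet> x) \<le> ereal ((- s *\<^sub>R a) \<bullet> x) - \<Lambda> (- s *\<^sub>R a)"
            using L[OF that] by (cases "\<Lambda> (- s *\<^sub>R a)") auto
          also have "\<dots> \<le> legendre \<Lambda> x" unfolding legendre_def by (rule SUP_upper) simp
          finally show ?thesis by simp
        qed
        note le = this
        have "legendre \<Lambda> x < \<infinity>" using that by (simp add: eff_dom_def)
        then obtain B where B: "legendre \<Lambda> x \<le> ereal B" by (cases "legendre \<Lambda> x") auto
        have "ereal ((\<bar>B\<bar> + 1) / - (a \<bullet> x) * - (a \<bullet> x)) \<le> ereal B"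
          using neg by (intro order_trans[OF le B] divide_nonneg_pos) auto
        then have "\<bar>B\<bar> + 1 \<le> B" using neg by simp
        then show False by simp
      qed
      have cone: "a \<bullet> x \<ge> 0" if "x \<in> pos_cone (eff_dom (legendre \<Lambda>))" for x
        using that dom by (auto simp: pos_cone_def)
      obtain z where z: "z \<in> interior (pos_cone (eff_dom (legendre \<Lambda>)))" "z \<in> W"
        using meet by blast
      obtain e where e: "e > 0" "ball z e \<subseteq> pos_cone (eff_dom (legendre \<Lambda>))"
        using z(1) by (auto simp: mem_interior)
      define w where "w = z - (e / 2 / norm a) *\<^sub>R a"
      have "w \<in> ball z e" using e a0 by (simp add: w_def dist_norm)
      then have "0 \<le> a \<bullet> w" using e cone by blast
      also have "\<dots> = a \<bullet> z - (e / 2 / norm a) * (a \<bullet> a)" by (simp add: w_def inner_diff_right)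
      also have "\<dots> < a \<bullet> z" using e a0 by simp
      finally have "a \<bullet> z > 0" .
      moreover have "a \<bullet> z \<le> b" using onS[OF z(2), of "R - 1"] True by simp
      ultimately show thesis using b0 by simp
    qed
  qed
qed

end

text \<open>Hoeffding's lemma for the law with density \<open>f\<close>, under which \<phi> lies in
  \<open>[-K, K]\<close> almost surely; the squared interval length \<open>(2 * K)\<^sup>2\<close>
  divided by 8 gives the constant.\<close>

lemma (in borel_prob) tame_exp_moment:
  assumes f: "tame_density f" and [measurable]: "\<phi> \<in> borel_measurable borel"
    and K: "\<And>x. f x \<noteq> 0 \<Longrightarrow> \<bar>\<phi> x\<bar> \<le> K" and mean: "(\<integral>x. f x * \<phi> x \<partial>\<mu>) = 0" and l: "l > 0"
  shows "(\<integral>\<^sup>+x. ennreal (f x * exp (l * \<phi> x)) \<partial>\<mu>) \<le> ennreal (exp (l\<^sup>2 * K\<^sup>2 / 2))"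
proof -
  note tame_measurable[OF f, measurable] and nn = tame_nonneg[OF f]
  define \<nu> where "\<nu> = density \<mu> (\<lambda>x. ennreal (f x))"
  have "emeasure \<nu> (space \<nu>) = 1"
    by (simp add: \<nu>_def emeasure_density tame_nn_integral[OF f])
  then interpret \<nu>: prob_space \<nu> by (rule prob_spaceI)
  have "AE x in \<mu>. 0 < ennreal (f x) \<longrightarrow> \<phi> x \<in> {- K..K}"
    using K by (auto simp: abs_le_iff minus_le_iff)
  then have "AE x in \<nu>. \<phi> x \<in> {- K..K}" unfolding \<nu>_def by (subst AE_density) auto
  then interpret interval_bounded_random_variable \<nu> \<phi> "- K" K
    by unfold_locales (auto simp: \<nu>_def)
  have "\<nu>.expectation \<phi> = 0"
    unfolding \<nu>_def using mean nn by (subst integral_density) auto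
  from Hoeffdings_lemma_nn_integral_0[OF l this]
  have "(\<integral>\<^sup>+x. ennreal (exp (l * \<phi> x)) \<partial>\<nu>) \<le> ennreal (exp (l\<^sup>2 * K\<^sup>2 / 2))"
    by (simp add: power_mult_distrib mult.commute flip: mult_2)
  then show ?thesis unfolding \<nu>_def using nn
    by (subst (asm) nn_integral_density) (auto simp: ennreal_mult)
qed

text \<open>The integrand is strictly positive, so the integral is positive as well as finite and
  its logarithm is real. The second claim gives the factors of the likelihood ratio mean one, as
  \<open>optional_stopping\<close> requires.\<close>

lemma (in borel_prob) log_mgf_real:
  assumes "\<theta> \<in> eff_dom \<Lambda>"
  shows "\<Lambda> \<theta> = ereal (real_of_ereal (\<Lambda> \<theta>))"
    and "(\<integral>\<^sup>+x. ennreal (exp (\<theta> \<bullet> x - real_of_ereal (\<Lambda> \<theta>))) \<partial>\<mu>) = 1"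
proof -
  define Z where "Z = (\<integral>\<^sup>+x. ennreal (exp (\<theta> \<bullet> x)) \<partial>\<mu>)"
  have L: "\<Lambda> \<theta> = log_ennreal Z" by (simp add: log_mgf_def Z_def)
  have fin: "Z < \<infinity>" using assms unfolding eff_dom_def L mem_Collect_eq log_ennreal_finite_iff .
  have "Z \<noteq> 0"
    unfolding Z_def by (subst nn_integral_0_iff_AE) (auto simp: AE_False)
  then have Z: "Z = ennreal (enn2real Z)" "enn2real Z > 0"
    using fin by (auto simp: enn2real_positive_iff less_top zero_less_iff_neq_zero)
  then have L': "\<Lambda> \<theta> = ereal (ln (enn2real Z))"
    using \<open>Z \<noteq> 0\<close> fin by (simp add: L log_ennreal_def)
  then show "\<Lambda> \<theta> = ereal (real_of_ereal (\<Lambda> \<theta>))" by simp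
  have "(\<integral>\<^sup>+x. ennreal (exp (\<theta> \<bullet> x - real_of_ereal (\<Lambda> \<theta>))) \<partial>\<mu>)
      = (\<integral>\<^sup>+x. ennreal (1 / enn2real Z) * ennreal (exp (\<theta> \<bullet> x)) \<partial>\<mu>)"
    using Z(2) by (intro nn_integral_cong) (simp add: L' exp_diff flip: ennreal_mult)
  also have "\<dots> = ennreal (1 / enn2real Z) * Z" by (simp add: nn_integral_cmult Z_def)
  also have "\<dots> = ennreal (1 / enn2real Z * enn2real Z)"
    using Z by (metis ennreal_mult divide_nonneg_pos less_imp_le zero_le_one)
  finally show "(\<integral>\<^sup>+x. ennreal (exp (\<theta> \<bullet> x - real_of_ereal (\<Lambda> \<theta>))) \<partial>\<mu>) = 1" using Z(2) by simp
qed

text \<open>Factor out the total scale \<open>z = u * c + v * d\<close>; what remains is a convex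
  combination in \<open>A\<close>. The scale stays positive even if one weight is zero.\<close>

lemma convex_pos_cone:
  assumes "convex A"
  shows "convex (pos_cone A)"
proof (rule convexI)
  fix x y and u v :: real
  assume xy: "x \<in> pos_cone A" "y \<in> pos_cone A" and uv: "0 \<le> u" "0 \<le> v" "u + v = 1"
  obtain c x' where x: "x = c *\<^sub>R x'" "c > 0" "x' \<in> A" using xy by (auto simp: pos_cone_def)
  obtain d y' where y: "y = d *\<^sub>R y'" "d > 0" "y' \<in> A" using xy by (auto simp: pos_cone_def)
  define z where "z = u * c + v * d"
  have "u > 0 \<or> v > 0" using uv by linarith
  then have z: "z > 0" unfolding z_def using uv x y
    by (auto intro: add_pos_nonneg add_nonneg_pos)
  have "(u * c / z) *\<^sub>R x' + (v * d / z) *\<^sub>R y' \<in> A"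
  proof (rule convexD[OF assms x(3) y(3)])
    show "u * c / z + v * d / z = 1" using z by (simp add: z_def flip: add_divide_distrib)
  qed (use uv x y z in auto)
  moreover have "u *\<^sub>R x + v *\<^sub>R y = z *\<^sub>R ((u * c / z) *\<^sub>R x' + (v * d / z) *\<^sub>R y')"
    using z by (simp add: x y scaleR_add_right)
  ultimately show "u *\<^sub>R x + v *\<^sub>R y \<in> pos_cone A" using z unfolding pos_cone_def by blast
qed

text \<open>A second-order Taylor formula whose remainder is dominated by one exponential for all
  \<open>s \<le> r / 2\<close>: half of the exponent \<open>r * \<bar>z\<bar>\<close> bounds
  \<open>exp t\<close>, the other half bounds the square through
  \<open>y\<^sup>2 / 2 \<le> exp y\<close>.\<close>

lemma exp_quadratic_bound:
  fixes r s z :: real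
  assumes r: "r > 0" and s: "0 \<le> s" "s \<le> r / 2"
  shows "exp (s * z) \<le> 1 + s * z + s\<^sup>2 * (4 / r\<^sup>2 * exp (r * \<bar>z\<bar>))"
proof -
  obtain t where t: "\<bar>t\<bar> \<le> \<bar>s * z\<bar>"
    "exp (s * z) = (\<Sum>m<2. (s * z) ^ m / fact m) + exp t / fact 2 * (s * z) ^ 2"
    using Maclaurin_exp_le[of "s * z" 2] by blast
  define y where "y = r * \<bar>z\<bar> / 2"
  have y: "y \<ge> 0" using r by (simp add: y_def)
  have "\<bar>s * z\<bar> \<le> y" unfolding y_def abs_mult using s mult_right_mono[OF s(2), of "\<bar>z\<bar>"] by simp
  then have et: "exp t \<le> exp y" using t(1) by simp
  have "y\<^sup>2 / 2 \<le> exp y" using exp_lower_Taylor_quadratic[OF y] y by simp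
  then have "exp t * (y\<^sup>2 / 2) \<le> exp y * exp y" using et y by (intro mult_mono) auto
  also have "\<dots> = exp (r * \<bar>z\<bar>)" by (simp add: y_def flip: exp_add)
  finally have "exp t * (y\<^sup>2 / 2) \<le> exp (r * \<bar>z\<bar>)" .
  then have "s\<^sup>2 * (4 / r\<^sup>2) * (exp t * (y\<^sup>2 / 2)) \<le> s\<^sup>2 * (4 / r\<^sup>2) * exp (r * \<bar>z\<bar>)"
    by (intro mult_left_mono) auto
  also have "s\<^sup>2 * (4 / r\<^sup>2) * (exp t * (y\<^sup>2 / 2)) = exp t / 2 * (s * z)\<^sup>2"
    using r by (simp add: y_def power_mult_distrib power_divide field_simps)
  finally show ?thesis using t(2) by (simp add: numeral_2_eq_2 mult.assoc)
qed

section \<open>Negative drift, positivity of the rate, and the midpoint bound\<close>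

context borel_prob
begin

lemma zero_in_dom: "0 \<in> eff_dom \<Lambda>"
  unfolding eff_dom_def log_mgf_def mem_Collect_eq log_ennreal_finite_iff
  by (simp add: emeasure_space_1[unfolded space_mu])

lemma dom_integrable: "\<theta> \<in> eff_dom \<Lambda> \<Longrightarrow> integrable \<mu> (\<lambda>x. exp (\<theta> \<bullet> x))"
  unfolding eff_dom_def log_mgf_def mem_Collect_eq log_ennreal_finite_iff
  by (intro integrableI_nonneg) auto

text \<open>The origin lies in the open domain, so \<open>r *\<^sub>R a\<close> and its negative lie
  there for small \<open>r\<close>, and the sum of the two exponentials dominates
  \<open>exp (r * \<bar>a \<bullet> x\<bar>)\<close>.\<close>

lemma exp_moment:
  assumes "open (eff_dom \<Lambda>)"
  obtains r where "r > 0" "integrable \<mu> (\<lambda>x. exp (r * \<bar>a \<bullet> x\<bar>))"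
proof -
  obtain e where e: "e > 0" "ball 0 e \<subseteq> eff_dom \<Lambda>"
    using assms zero_in_dom by (auto simp: open_contains_ball)
  define r where "r = e / (2 * (norm a + 1))"
  have r: "r > 0" using e by (simp add: r_def add_nonneg_pos)
  have "r * norm a < e"
  proof -
    have "r * norm a \<le> r * (norm a + 1)" using r by simp
    also have "\<dots> = e / 2" by (simp add: r_def field_simps add_nonneg_eq_0_iff)
    finally show ?thesis using e by simp
  qed
  then have "r *\<^sub>R a \<in> eff_dom \<Lambda>" "- (r *\<^sub>R a) \<in> eff_dom \<Lambda>" using e r by (auto simp: subset_iff)
  from this[THEN dom_integrable]
  have i: "integrable \<mu> (\<lambda>x. exp ((r *\<^sub>R a) \<bullet> x) + exp ((- (r *\<^sub>R a)) \<bullet> x))"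
    by (rule Bochner_Integration.integrable_add)
  have "norm (exp (r * \<bar>a \<bullet> x\<bar>)) \<le> norm (exp ((r *\<^sub>R a) \<bullet> x) + exp ((- (r *\<^sub>R a)) \<bullet> x))" for x
    using exp_gt_zero[of "r * (a \<bullet> x)"] exp_gt_zero[of "- (r * (a \<bullet> x))"]
    by (cases "a \<bullet> x \<ge> 0") (auto simp del: exp_gt_zero)
  then have "integrable \<mu> (\<lambda>x. exp (r * \<bar>a \<bullet> x\<bar>))"
    by (intro Bochner_Integration.integrable_bound[OF i]) auto
  with r show thesis by (rule that)
qed

lemma integrable_inner:
  assumes "open (eff_dom \<Lambda>)"
  shows "integrable \<mu> (\<lambda>x. a \<bullet> x)"
proof -
  obtain r where r: "r > 0" and i: "integrable \<mu> (\<lambda>x. exp (r * \<bar>a \<bullet> x\<bar>))"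
    using exp_moment[OF assms] .
  have "norm (a \<bullet> x) \<le> norm (1 / r * exp (r * \<bar>a \<bullet> x\<bar>))" for x
  proof -
    have "r * \<bar>a \<bullet> x\<bar> \<le> exp (r * \<bar>a \<bullet> x\<bar>)"
      using exp_ge_add_one_self[of "r * \<bar>a \<bullet> x\<bar>"] by linarith
    then show ?thesis using r by (simp add: field_simps)
  qed
  then show ?thesis
    by (intro Bochner_Integration.integrable_bound[OF integrable_mult_right[OF i, of "1 / r"]]) auto
qed

lemma integrable_identity:
  assumes "open (eff_dom \<Lambda>)"
  shows "integrable \<mu> (\<lambda>x. x)"
proof -
  have "integrable \<mu> (\<lambda>x. \<Sum>e\<in>Basis. \<bar>e \<bullet> x\<bar>)"
    using integrable_inner[OF assms] by (intro Bochner_Integration.integrable_sum integrable_abs)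
  then show ?thesis
    by (rule Bochner_Integration.integrable_bound)
       (auto simp: inner_commute intro!: order_trans[OF norm_le_l1])
qed

text \<open>By \<open>exp_quadratic_bound\<close> the moment generating function at
  \<open>s *\<^sub>R a\<close> is at most \<open>1 + s * d + s\<^sup>2 * E\<close> with
  \<open>d < 0\<close>, so the linear term wins for small \<open>s\<close>.\<close>

lemma log_mgf_nonpos_of_neg_drift:
  assumes op: "open (eff_dom \<Lambda>)" and neg: "a \<bullet> (\<integral>x. x \<partial>\<mu>) < 0"
  obtains s0 where "s0 > 0" "\<And>s. 0 < s \<Longrightarrow> s \<le> s0 \<Longrightarrow> \<Lambda> (s *\<^sub>R a) \<le> 0"
proof -
  obtain r where r: "r > 0" and i: "integrable \<mu> (\<lambda>x. exp (r * \<bar>a \<bullet> x\<bar>))"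
    using exp_moment[OF op] .
  define d where "d = a \<bullet> (\<integral>x. x \<partial>\<mu>)"
  have d: "d = (\<integral>x. a \<bullet> x \<partial>\<mu>)"
    using integrable_identity[OF op] by (simp add: d_def)
  define E where "E = (\<integral>x. 4 / r\<^sup>2 * exp (r * \<bar>a \<bullet> x\<bar>) \<partial>\<mu>)"
  have E: "E \<ge> 0" by (simp add: E_def)
  note i' = integrable_mult_right[OF i, of "4 / r\<^sup>2"] and ia = integrable_inner[OF op, of a]
  \<comment> \<open>\<open>r / 2\<close> is the range of the Taylor bound; the second term ensures
    \<open>d + s * E \<le> 0\<close>, and adding 1 keeps its denominator positive.\<close>
  define s0 where "s0 = min (r / 2) (- d / (E + 1))"
  show thesis
  proof
    show "s0 > 0" using r neg E by (simp add: s0_def d_def divide_neg_pos)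
    fix s assume s: "0 < s" "s \<le> s0"
    then have s': "s \<le> r / 2" "s \<le> - d / (E + 1)" by (auto simp: s0_def)
    have "s * E \<le> s * (E + 1)" using s by simp
    also have "\<dots> \<le> - d" using s'(2) E by (subst (asm) pos_le_divide_eq) auto
    finally have "s * (d + s * E) \<le> 0" using s by (simp add: mult_le_0_iff)
    have "(\<integral>\<^sup>+x. ennreal (exp ((s *\<^sub>R a) \<bullet> x)) \<partial>\<mu>) \<le>
        (\<integral>\<^sup>+x. ennreal (1 + s * (a \<bullet> x) + s\<^sup>2 * (4 / r\<^sup>2 * exp (r * \<bar>a \<bullet> x\<bar>))) \<partial>\<mu>)"
      using exp_quadratic_bound[OF r less_imp_le[OF s(1)] s'(1)]
      by (intro nn_integral_mono ennreal_leI) simp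
    also have "\<dots> = ennreal (\<integral>x. 1 + s * (a \<bullet> x) + s\<^sup>2 * (4 / r\<^sup>2 * exp (r * \<bar>a \<bullet> x\<bar>)) \<partial>\<mu>)"
    proof (rule nn_integral_eq_integral)
      show "integrable \<mu> (\<lambda>x. 1 + s * (a \<bullet> x) + s\<^sup>2 * (4 / r\<^sup>2 * exp (r * \<bar>a \<bullet> x\<bar>)))"
        by (intro Bochner_Integration.integrable_add integrable_mult_right[OF i', of "s\<^sup>2"]
            integrable_mult_right[OF ia, of s]) simp
      have "0 \<le> 1 + s * (a \<bullet> x) + s\<^sup>2 * (4 / r\<^sup>2 * exp (r * \<bar>a \<bullet> x\<bar>))" for x
        using exp_quadratic_bound[OF r less_imp_le[OF s(1)] s'(1), of "a \<bullet> x"]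
        by (meson exp_ge_zero order_trans)
      then show "AE x in \<mu>. 0 \<le> 1 + s * (a \<bullet> x) + s\<^sup>2 * (4 / r\<^sup>2 * exp (r * \<bar>a \<bullet> x\<bar>))" by simp
    qed
    also have "(\<integral>x. 1 + s * (a \<bullet> x) + s\<^sup>2 * (4 / r\<^sup>2 * exp (r * \<bar>a \<bullet> x\<bar>)) \<partial>\<mu>)
        = 1 + s * d + s\<^sup>2 * E"
    proof -
      have "(\<integral>x. 1 + s * (a \<bullet> x) + s\<^sup>2 * (4 / r\<^sup>2 * exp (r * \<bar>a \<bullet> x\<bar>)) \<partial>\<mu>)
        = (\<integral>x. 1 \<partial>\<mu>) + (\<integral>x. s * (a \<bullet> x) \<partial>\<mu>) + (\<integral>x. s\<^sup>2 * (4 / r\<^sup>2 * exp (r * \<bar>a \<bullet> x\<bar>)) \<partial>\<mu>)"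
        using integrable_mult_right[OF i', of "s\<^sup>2"] integrable_mult_right[OF ia, of s]
        by (subst Bochner_Integration.integral_add; (intro Bochner_Integration.integrable_add)?; simp)+
      also have "\<dots> = 1 + s * d + s\<^sup>2 * E"
        unfolding d E_def integral_mult_right_zero using prob_space[unfolded space_mu] by simp
      finally show ?thesis .
    qed
    also have "1 + s * d + s\<^sup>2 * E \<le> exp 0"
      using \<open>s * (d + s * E) \<le> 0\<close> by (simp add: power2_eq_square algebra_simps)
    finally have "\<Lambda> (s *\<^sub>R a) \<le> ereal 0"
      unfolding log_mgf_def log_ennreal_le_iff by (simp add: ennreal_leI)
    then show "\<Lambda> (s *\<^sub>R a) \<le> 0" by (simp add: zero_ereal_def)
  qed
qed

text \<open>The witness may depend on the point, which lets \<open>set_rate_pos\<close> choose a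
  direction for each \<open>y\<close>.\<close>

lemma set_rate_geI:
  assumes "\<And>y. y \<in> U \<Longrightarrow> \<exists>\<theta>. \<Lambda> \<theta> \<le> 0 \<and> c \<le> \<theta> \<bullet> y"
  shows "ereal c \<le> set_rate \<Lambda> U"
  unfolding set_rate_def
proof (rule INF_greatest)
  fix y assume "y \<in> U"
  then obtain \<theta> where \<theta>: "\<Lambda> \<theta> \<le> 0" "c \<le> \<theta> \<bullet> y" using assms by blast
  have "ereal c \<le> ereal (\<theta> \<bullet> y)" using \<theta> by simp
  also have "\<dots> \<le> rate_I \<Lambda> y" unfolding rate_I_def using \<theta> by (intro SUP_upper) auto
  finally show "ereal c \<le> rate_I \<Lambda> y" .
qed

text \<open>A normal \<open>a\<close> separating \<open>W\<close> from the cone has strictly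
  negative drift, because the cone contains a ball around the mean, but on \<open>W\<close> only
  \<open>a \<bullet> y \<ge> 0\<close> is known. Small changes of \<open>a\<close> along the signed
  coordinate directions keep the drift negative, and since \<open>W\<close> avoids a ball around 0,
  at each of its points one of them is bounded below by a fixed positive number.\<close>

lemma set_rate_pos:
  assumes op: "open (eff_dom \<Lambda>)" and W: "convex W" "W \<noteq> {}"
    and \<delta>: "\<delta> > 0" "pos_cone (ball (\<integral>x. x \<partial>\<mu>) \<delta>) \<inter> W = {}"
    and \<rho>: "\<rho> > 0" "ball 0 \<rho> \<inter> W = {}"
  shows "set_rate \<Lambda> W > 0"
proof -
  define m where "m = (\<integral>x. x \<partial>\<mu>)"
  have cone: "t *\<^sub>R x \<in> pos_cone (ball m \<delta>)" if "x \<in> ball m \<delta>" "t > 0" for x t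
    using that unfolding pos_cone_def by blast
  have "m \<in> ball m \<delta>" using \<delta> by simp
  then have ne: "pos_cone (ball m \<delta>) \<noteq> {}" using cone[of m 1] by auto
  obtain a b where ab: "a \<noteq> 0" "\<And>x. x \<in> pos_cone (ball m \<delta>) \<Longrightarrow> a \<bullet> x \<le> b" "\<And>y. y \<in> W \<Longrightarrow> b \<le> a \<bullet> y"
    using separating_hyperplane_sets[OF convex_pos_cone[OF convex_ball] W(1) ne W(2) \<delta>(2)[folded m_def]]
    by blast
  have sep: "- b \<le> 0 \<and> 0 \<le> - (a \<bullet> x)" if x: "x \<in> ball m \<delta>" for x
    using ab(2)[OF cone[OF x]] by (intro linear_lower_bound_nonneg) simp
  have b: "b \<ge> 0" using sep[OF \<open>m \<in> ball m \<delta>\<close>] by simp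
  \<comment> \<open>Moving from the mean along \<open>a\<close> stays in the ball and turns the weak
    inequality into a strict one at \<open>m\<close>.\<close>
  define x where "x = m + (\<delta> / 2 / norm a) *\<^sub>R a"
  have "x \<in> ball m \<delta>" using \<delta> ab(1) by (simp add: x_def dist_norm)
  then have "a \<bullet> x \<le> 0" using sep by simp
  then have am: "a \<bullet> m \<le> - (\<delta> / 2 * norm a)"
    using ab(1) by (simp add: x_def inner_add_right dot_square_norm power2_eq_square)
  \<comment> \<open>So small that adding \<eta> times a unit vector raises the drift by less than
    \<open>\<delta> / 2 * norm a\<close>.\<close>
  define \<eta> where "\<eta> = \<delta> / 2 * norm a / (norm m + 1)"
  have \<eta>: "\<eta> > 0" using \<delta> ab(1) by (simp add: \<eta>_def add_nonneg_pos)
  have \<eta>m: "\<eta> * norm m < \<delta> / 2 * norm a"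
  proof -
    have "\<eta> * norm m < \<eta> * (norm m + 1)" using \<eta> by simp
    also have "\<dots> = \<delta> / 2 * norm a" by (simp add: \<eta>_def field_simps add_nonneg_eq_0_iff)
    finally show ?thesis .
  qed
  define V where "V = (\<lambda>e. a + \<eta> *\<^sub>R e) ` (Basis \<union> uminus ` Basis)"
  have finV: "finite V" by (simp add: V_def)
  have "v \<bullet> m < 0" if vV: "v \<in> V" for v
  proof -
    obtain e where e: "v = a + \<eta> *\<^sub>R e" "e \<in> Basis \<union> uminus ` Basis"
      using vV unfolding V_def by blast
    have "norm e = 1" using e(2) by auto
    have "e \<bullet> m \<le> norm m" using norm_cauchy_schwarz[of e m] \<open>norm e = 1\<close> by simp
    then have "\<eta> * (e \<bullet> m) \<le> \<eta> * norm m" using \<eta> by (intro mult_left_mono) auto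
    then show ?thesis using am \<eta>m by (simp add: e(1) inner_add_left)
  qed
  then have "\<exists>s0>0. \<forall>s. 0 < s \<longrightarrow> s \<le> s0 \<longrightarrow> \<Lambda> (s *\<^sub>R v) \<le> 0" if "v \<in> V" for v
    using log_mgf_nonpos_of_neg_drift[OF op, of v] that unfolding m_def by metis
  then obtain s0 where s0: "\<And>v. v \<in> V \<Longrightarrow> s0 v > 0 \<and> (\<forall>s. 0 < s \<longrightarrow> s \<le> s0 v \<longrightarrow> \<Lambda> (s *\<^sub>R v) \<le> 0)"
    by metis
  \<comment> \<open>Only finitely many directions occur, so one scale \<open>s\<close> works for all
    of them.\<close>
  define s where "s = Min (insert 1 (s0 ` V))"
  have s: "s > 0" using s0 finV by (simp add: s_def)
  have sV: "\<Lambda> (s *\<^sub>R v) \<le> 0" if "v \<in> V" for v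
  proof -
    have "s \<le> s0 v" unfolding s_def using finV that by (intro Min_le) auto
    then show ?thesis using s0[OF that] s by blast
  qed
  define D where "D = real DIM('d)"
  have D: "D > 0" by (simp add: D_def)
  have "ereal (s * (\<eta> * (\<rho> / D))) \<le> set_rate \<Lambda> W"
  proof (rule set_rate_geI)
    fix y assume y: "y \<in> W"
    then have "\<not> norm y < \<rho>" using \<rho>(2) by auto
    have "\<exists>e\<in>Basis. \<bar>y \<bullet> e\<bar> \<ge> \<rho> / D"
    proof (rule ccontr)
      assume "\<not> ?thesis"
      then have "(\<Sum>e\<in>Basis. \<bar>y \<bullet> e\<bar>) < (\<Sum>e\<in>(Basis::'d set). \<rho> / D)"
        by (intro sum_strict_mono) (auto simp: not_le)
      also have "\<dots> = \<rho>" using D by (simp add: D_def)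
      finally show False using norm_le_l1[of y] \<open>\<not> norm y < \<rho>\<close> by simp
    qed
    then obtain e where e: "e \<in> Basis" "\<bar>y \<bullet> e\<bar> \<ge> \<rho> / D" by blast
    define e' where "e' = (if y \<bullet> e \<ge> 0 then e else - e)"
    have e': "e' \<in> Basis \<union> uminus ` Basis" "e' \<bullet> y \<ge> \<rho> / D"
      using e by (auto simp: e'_def inner_commute)
    have v: "a + \<eta> *\<^sub>R e' \<in> V" using e'(1) by (auto simp: V_def)
    have "\<eta> * (\<rho> / D) \<le> \<eta> * (e' \<bullet> y)" using e'(2) \<eta> by (intro mult_left_mono) auto
    also have "\<dots> \<le> (a + \<eta> *\<^sub>R e') \<bullet> y" using ab(3)[OF y] b by (simp add: inner_add_left)
    finally have "s * (\<eta> * (\<rho> / D)) \<le> s * ((a + \<eta> *\<^sub>R e') \<bullet> y)" using s by (intro mult_left_mono) auto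
    then show "\<exists>\<theta>. \<Lambda> \<theta> \<le> 0 \<and> s * (\<eta> * (\<rho> / D)) \<le> \<theta> \<bullet> y"
      using sV[OF v] by (intro exI[of _ "s *\<^sub>R (a + \<eta> *\<^sub>R e')"]) simp
  qed
  moreover have "0 < ereal (s * (\<eta> * (\<rho> / D)))" using s \<eta> \<rho> D by simp
  ultimately show ?thesis by (rule less_le_trans[rotated])
qed

text \<open>Midpoint convexity of \<Lambda> at \<gamma> and \<open>\<alpha> - \<gamma>\<close>,
  obtained from \<open>u * v \<le> (u * u + v * v) / 2\<close>. It converts a lower bound
  \<open>2 * r\<close> for \<open>\<alpha> \<bullet> y\<close> on a set into a lower bound
  \<open>r\<close> for \<open>rate_I\<close> there.\<close>

lemma log_mgf_midpoint_nonpos: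
  assumes \<gamma>: "\<gamma> \<in> eff_dom \<Lambda>" and \<alpha>: "\<Lambda> (\<alpha> - \<gamma>) \<le> ereal (- real_of_ereal (\<Lambda> \<gamma>))"
  shows "\<Lambda> ((1 / 2) *\<^sub>R \<alpha>) \<le> 0"
proof -
  define l where "l = real_of_ereal (\<Lambda> \<gamma>)"
  have 1: "(\<integral>\<^sup>+x. ennreal (exp (\<gamma> \<bullet> x - l)) \<partial>\<mu>) = 1"
    using log_mgf_real(2)[OF \<gamma>] by (simp add: l_def)
  have "(\<integral>\<^sup>+x. ennreal (exp ((\<alpha> - \<gamma>) \<bullet> x + l)) \<partial>\<mu>) = ennreal (exp l) * (\<integral>\<^sup>+x. ennreal (exp ((\<alpha> - \<gamma>) \<bullet> x)) \<partial>\<mu>)"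
    by (subst nn_integral_cmult[symmetric]) (auto simp: exp_add mult.commute simp flip: ennreal_mult)
  also have "\<dots> \<le> ennreal (exp l) * ennreal (exp (- l))"
    using \<alpha> unfolding log_mgf_def log_ennreal_le_iff by (intro mult_left_mono) (auto simp: l_def log_mgf_def)
  also have "\<dots> = 1" by (simp flip: ennreal_mult exp_add)
  finally have 2: "(\<integral>\<^sup>+x. ennreal (exp ((\<alpha> - \<gamma>) \<bullet> x + l)) \<partial>\<mu>) \<le> 1" .
  have "(\<integral>\<^sup>+x. ennreal (exp (((1 / 2) *\<^sub>R \<alpha>) \<bullet> x)) \<partial>\<mu>) \<le>
      (\<integral>\<^sup>+x. ennreal (1 / 2) * (ennreal (exp (\<gamma> \<bullet> x - l)) + ennreal (exp ((\<alpha> - \<gamma>) \<bullet> x + l))) \<partial>\<mu>)"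
  proof (rule nn_integral_mono)
    fix x
    define u v where "u = exp ((\<gamma> \<bullet> x - l) / 2)" and "v = exp (((\<alpha> - \<gamma>) \<bullet> x + l) / 2)"
    have "exp (((1 / 2) *\<^sub>R \<alpha>) \<bullet> x) = u * v"
      unfolding u_def v_def exp_add[symmetric] by (simp add: inner_diff_left flip: add_divide_distrib)
    also have "\<dots> \<le> 1 / 2 * (u * u + v * v)"
      using sum_squares_bound[of u v] by (simp add: power2_eq_square)
    also have "u * u = exp (\<gamma> \<bullet> x - l)" by (simp add: u_def flip: exp_add)
    also have "v * v = exp ((\<alpha> - \<gamma>) \<bullet> x + l)" by (simp add: v_def flip: exp_add)
    finally have "ennreal (exp (((1 / 2) *\<^sub>R \<alpha>) \<bullet> x)) \<le>
        ennreal (1 / 2 * (exp (\<gamma> \<bullet> x - l) + exp ((\<alpha> - \<gamma>) \<bullet> x + l)))" by (rule ennreal_leI)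
    also have "\<dots> = ennreal (1 / 2) * (ennreal (exp (\<gamma> \<bullet> x - l)) + ennreal (exp ((\<alpha> - \<gamma>) \<bullet> x + l)))"
      by (subst ennreal_mult) auto
    finally show "ennreal (exp (((1 / 2) *\<^sub>R \<alpha>) \<bullet> x)) \<le>
      ennreal (1 / 2) * (ennreal (exp (\<gamma> \<bullet> x - l)) + ennreal (exp ((\<alpha> - \<gamma>) \<bullet> x + l)))" .
  qed
  also have "\<dots> = ennreal (1 / 2) * ((\<integral>\<^sup>+x. ennreal (exp (\<gamma> \<bullet> x - l)) \<partial>\<mu>)
      + (\<integral>\<^sup>+x. ennreal (exp ((\<alpha> - \<gamma>) \<bullet> x + l)) \<partial>\<mu>))"
    by (subst nn_integral_cmult, measurable) (subst nn_integral_add, auto)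
  also have "\<dots> \<le> ennreal (1 / 2) * (1 + 1)"
    using 1 2 by (intro mult_left_mono add_mono) auto
  also have "\<dots> = ennreal (1 / 2 * 2)" by (subst ennreal_mult) auto
  finally have "\<Lambda> ((1 / 2) *\<^sub>R \<alpha>) \<le> ereal 0" unfolding log_mgf_def log_ennreal_le_iff by simp
  then show ?thesis by (simp add: zero_ereal_def)
qed

end

section \<open>Dual vectors from \<open>tilt_v\<close> and near-optimal densities from
  \<open>set_rate\<close>\<close>

context borel_prob
begin

text \<open>A minimax step: \<open>tilt_v\<close> is about dual vectors chosen for each point
  separately, the conclusion about one vector for the whole set.\<close>

lemma dual_of_tilt_v:
  assumes \<gamma>: "\<gamma> \<in> eff_dom \<Lambda>" and W: "convex W" "W \<noteq> {}"
    and meet: "interior (pos_cone (eff_dom (legendre \<Lambda>))) \<inter> W \<noteq> {}"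
    and R: "ereal R \<le> tilt_v \<Lambda> \<gamma> W"
  shows "\<exists>\<alpha>. \<Lambda> (\<alpha> - \<gamma>) \<le> ereal (- real_of_ereal (\<Lambda> \<gamma>)) \<and> (\<forall>y\<in>W. R \<le> \<alpha> \<bullet> y)"
proof -
  define l where "l = real_of_ereal (\<Lambda> \<gamma>)"
  have l: "\<Lambda> \<gamma> = ereal l" unfolding l_def by (rule log_mgf_real(1)[OF \<gamma>])
  have "\<exists>\<alpha>. \<Lambda> (\<alpha> - \<gamma>) \<le> ereal (- l) \<and> (\<forall>y\<in>W. R \<le> \<alpha> \<bullet> y)" (is ?goal)
  proof (rule tilt_alternative[OF W meet, of \<gamma> l R])
    \<comment> \<open>The primal branch is contradictory: weak duality bounds every admissible
      \<alpha> at \<open>t *\<^sub>R tame_mean f\<close> by the left-hand side of \<open>lt\<close>,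
      while \<open>tilt_V\<close> exceeds it there.\<close>
    fix f t assume f: "tame_density f" and t: "t > 0" and x: "t *\<^sub>R tame_mean f \<in> W"
      and lt: "t * (rel_ent f + \<gamma> \<bullet> tame_mean f - l) < R"
    have "ereal (t * (rel_ent f + \<gamma> \<bullet> tame_mean f - l)) < ereal R" using lt by simp
    also have "\<dots> \<le> tilt_v \<Lambda> \<gamma> W" by (rule R)
    also have "\<dots> \<le> tilt_V \<Lambda> \<gamma> (t *\<^sub>R tame_mean f)"
      unfolding tilt_v_def using x closure_subset by (intro INF_lower) auto
    finally obtain \<alpha> where \<alpha>: "\<Lambda> \<gamma> + \<Lambda> (\<alpha> - \<gamma>) \<le> 0"
      "t * (rel_ent f + \<gamma> \<bullet> tame_mean f - l) < \<alpha> \<bullet> (t *\<^sub>R tame_mean f)"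
      unfolding tilt_V_def less_SUP_iff by auto
    have "\<Lambda> (\<alpha> - \<gamma>) \<le> ereal (- l)" using \<alpha>(1) unfolding l by (cases "\<Lambda> (\<alpha> - \<gamma>)") auto
    from gibbs_le[OF f this] have "\<alpha> \<bullet> tame_mean f \<le> rel_ent f + \<gamma> \<bullet> tame_mean f - l"
      by (simp add: inner_diff_left)
    then have "t * (\<alpha> \<bullet> tame_mean f) \<le> t * (rel_ent f + \<gamma> \<bullet> tame_mean f - l)"
      using t by (intro mult_left_mono) auto
    then show ?goal using \<alpha>(2) by simp
  qed auto
  then show ?thesis by (simp add: l_def)
qed

text \<open>The dual branch at \<open>\<gamma> = 0\<close> and \<open>l = 0\<close> would give a
  vector with \<open>\<Lambda> \<le> 0\<close> that forces the rate up to \<open>R\<close>.\<close>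

lemma primal_of_set_rate:
  assumes W: "convex W" "W \<noteq> {}"
    and meet: "interior (pos_cone (eff_dom (legendre \<Lambda>))) \<inter> W \<noteq> {}"
    and R: "set_rate \<Lambda> W < ereal R"
  obtains f t where "tame_density f" "t > 0" "t *\<^sub>R tame_mean f \<in> W" "t * rel_ent f < R"
proof (rule tilt_alternative[OF W meet, of 0 0 R])
  fix f t assume "tame_density f" "t > 0" "t *\<^sub>R tame_mean f \<in> W" "t * (rel_ent f + 0 \<bullet> tame_mean f - 0) < R"
  then show thesis using that by simp
next
  fix \<alpha> assume \<alpha>: "\<Lambda> (\<alpha> - 0) \<le> ereal (- 0)" "\<And>y. y \<in> W \<Longrightarrow> R \<le> \<alpha> \<bullet> y"
  have "ereal R \<le> set_rate \<Lambda> W"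
    using \<alpha> by (intro set_rate_geI) (auto simp: zero_ereal_def intro!: exI[of _ \<alpha>])
  with R show thesis by simp
qed

end

section \<open>Change of measure for the random walk\<close>

locale iid_walk = prob_space M for M :: "'a measure" +
  fixes X :: "nat \<Rightarrow> 'a \<Rightarrow> 'd::euclidean_space"
  assumes indep: "indep_vars (\<lambda>_. borel) X {1..}"
    and ident: "\<And>i. i \<ge> 1 \<Longrightarrow> distr M borel (X i) = distr M borel (X 1)"
begin

lemma X_measurable [measurable]: "i \<ge> 1 \<Longrightarrow> X i \<in> borel_measurable M"
  using indep by (auto simp: indep_vars_def)

sublocale law: borel_prob "distr M borel (X 1)"
  by (intro borel_prob.intro borel_prob_axioms.intro prob_space_distr) auto

lemma log_mgf_law: "law.\<Lambda> = log_mgf M (X 1)"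
  by (auto simp: log_mgf_def nn_integral_distr)

lemma nn_integral_X:
  assumes "i \<ge> 1" "g \<in> borel_measurable borel"
  shows "(\<integral>\<^sup>+\<omega>. g (X i \<omega>) \<partial>M) = (\<integral>\<^sup>+x. g x \<partial>distr M borel (X 1))"
  unfolding ident[OF assms(1), symmetric] using assms by (subst nn_integral_distr) auto

lemma nn_integral_prod_X:
  assumes g: "\<And>i. i \<in> {1..n} \<Longrightarrow> g i \<in> borel_measurable borel"
  shows "(\<integral>\<^sup>+\<omega>. (\<Prod>i=1..n. g i (X i \<omega>)) \<partial>M) = (\<Prod>i=1..n. \<integral>\<^sup>+x. g i x \<partial>distr M borel (X 1))"
proof -
  have "indep_vars (\<lambda>_. borel) X {1..n}" by (rule indep_vars_subset[OF indep]) auto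
  then have "indep_vars (\<lambda>_. borel) (\<lambda>i \<omega>. g i (X i \<omega>)) {1..n}"
    by (rule indep_vars_compose2) (use g in auto)
  then have "(\<integral>\<^sup>+\<omega>. (\<Prod>i=1..n. g i (X i \<omega>)) \<partial>M) = (\<Prod>i=1..n. \<integral>\<^sup>+\<omega>. g i (X i \<omega>) \<partial>M)"
    by (intro indep_vars_nn_integral) auto
  also have "\<dots> = (\<Prod>i=1..n. \<integral>\<^sup>+x. g i x \<partial>distr M borel (X 1))"
    using g by (intro prod.cong nn_integral_X) auto
  finally show ?thesis .
qed

abbreviation "F \<equiv> nat_filt M X"

lemma space_F [simp]: "space (F n) = space M" by (simp add: nat_filt_def space_measure_of_conv)

lemma sets_F:
  "sets (F n) = sigma_sets (space M) (\<Union>i\<in>{1..n}. {X i -` A \<inter> space M | A. A \<in> sets borel})"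
  unfolding nat_filt_def by (rule sets_measure_of) auto

lemma subalg_F: "subalgebra M (F n)"
  unfolding subalgebra_def sets_F by (auto intro!: sets.sigma_sets_subset measurable_sets)

lemma X_measurable_F: "i \<in> {1..n} \<Longrightarrow> X i \<in> borel_measurable (F n)"
  by (intro measurableI) (auto simp: sets_F simp del: One_nat_def intro!: sigma_sets.Basic UN_I[of i])

lemma walk_measurable_F: "k \<le> n \<Longrightarrow> walk X k \<in> borel_measurable (F n)"
  unfolding walk_def by (intro borel_measurable_sum X_measurable_F) auto

lemma walk_measurable [measurable]: "walk X k \<in> borel_measurable M"
  using measurable_from_subalg[OF subalg_F walk_measurable_F[OF order_refl]] .

lemma sets_F_subset: "A \<in> sets (F n) \<Longrightarrow> A \<in> sets M"
  using subalg_F by (auto simp: subalgebra_def)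

lemma F_mono: "m \<le> n \<Longrightarrow> sets (F m) \<subseteq> sets (F n)"
  unfolding sets_F by (intro sigma_sets_mono' UN_mono) auto

text \<open>\<open>F n\<close> and \<open>X (Suc n)\<close> are generated by disjoint blocks of an
  independent sequence, so the expectation factorises. This is the martingale step of
  \<open>optional_stopping\<close>.\<close>

lemma indep_step:
  assumes h: "h \<in> borel_measurable (F n)" and g: "g \<in> borel_measurable borel"
  shows "(\<integral>\<^sup>+\<omega>. h \<omega> * g (X (Suc n) \<omega>) \<partial>M)
       = (\<integral>\<^sup>+\<omega>. h \<omega> \<partial>M) * (\<integral>\<^sup>+x. g x \<partial>distr M borel (X 1))"
proof -
  define E where "E = (\<lambda>i. {X i -` A \<inter> space M | A. A \<in> sets borel})"
  \<comment> \<open>The index \<open>True\<close> stands for the past, \<open>False\<close> for the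
    next increment.\<close>
  define I where "I = (\<lambda>b. if b then {1..n} else {Suc n})"
  have "indep_sets E {1..}" using indep by (simp add: indep_vars_def2 E_def)
  then have "indep_sets E (\<Union>b\<in>UNIV. I b)"
    by (rule indep_sets_mono_index[rotated]) (auto simp: I_def split: if_splits)
  moreover have "Int_stable (E i)" for i
    unfolding E_def by (auto simp: Int_stable_def) (metis sets.Int vimage_Int Int_assoc Int_left_commute inf.idem)
  moreover have "disjoint_family_on I UNIV" by (auto simp: disjoint_family_on_def I_def)
  ultimately have *: "indep_sets (\<lambda>b. sigma_sets (space M) (\<Union>i\<in>I b. E i)) UNIV"
    by (intro indep_sets_collect_sigma) auto
  let ?g = "\<lambda>\<omega>. g (X (Suc n) \<omega>)"
  have "sigma_sets (space M) {h -` A \<inter> space M | A. A \<in> sets borel} \<subseteq> sets (F n)"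
    using measurable_sets[OF h] sets.sigma_sets_subset[of "{h -` A \<inter> space M | A. A \<in> sets borel}" "F n"]
    by auto
  moreover have "{?g -` A \<inter> space M | A. A \<in> sets borel} \<subseteq> E (Suc n)"
  proof safe
    fix A :: "ennreal set" assume "A \<in> sets borel"
    then have "g -` A \<in> sets borel" using measurable_sets[OF g] by simp
    then show "?g -` A \<inter> space M \<in> E (Suc n)" unfolding E_def by (auto simp: vimage_def)
  qed
  then have "sigma_sets (space M) {?g -` A \<inter> space M | A. A \<in> sets borel}
      \<subseteq> sigma_sets (space M) (E (Suc n))" by (rule sigma_sets_mono')
  ultimately have "indep_set (sigma_sets (space M) {h -` A \<inter> space M | A. A \<in> sets borel})
      (sigma_sets (space M) {?g -` A \<inter> space M | A. A \<in> sets borel})"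
    unfolding indep_set_def
    by (intro indep_sets_mono_sets[OF *]) (auto simp: I_def sets_F E_def split: bool.splits)
  then have "indep_var borel h borel ?g"
    unfolding indep_var_eq using g measurable_from_subalg[OF subalg_F h] by simp
  then have ind: "indep_vars (case_bool borel borel) (case_bool h ?g) UNIV"
    by (simp add: indep_var_def)
  have cb: "case_bool borel borel = (\<lambda>_. borel)" by (auto split: bool.split)
  have "(\<integral>\<^sup>+\<omega>. (\<Prod>b\<in>UNIV. case_bool h (\<lambda>\<omega>. g (X (Suc n) \<omega>)) b \<omega>) \<partial>M)
      = (\<Prod>b\<in>UNIV. \<integral>\<^sup>+\<omega>. case_bool h (\<lambda>\<omega>. g (X (Suc n) \<omega>)) b \<omega> \<partial>M)"
    using ind unfolding cb by (intro indep_vars_nn_integral) auto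
  then show ?thesis using nn_integral_X[of "Suc n" g] g by (simp add: UNIV_bool mult.commute)
qed

text \<open>The sets \<open>A n\<close> stand for the events that a stopping time equals
  \<open>n\<close>. On \<open>A n\<close> the product up to \<open>n\<close> may be replaced by the
  product up to a later \<open>N\<close>, and disjointness bounds the partial sums by the full mean
  1. Only an inequality remains, since the events need not exhaust the space.\<close>

lemma optional_stopping:
  fixes g :: "'d \<Rightarrow> ennreal"
  assumes [measurable]: "g \<in> borel_measurable borel"
    and g1: "(\<integral>\<^sup>+x. g x \<partial>distr M borel (X 1)) = 1"
    and A: "\<And>n. A n \<in> sets (F n)" and disj: "disjoint_family A"
  shows "(\<Sum>n. \<integral>\<^sup>+\<omega>. (\<Prod>i=1..n. g (X i \<omega>)) * indicator (A n) \<omega> \<partial>M) \<le> 1"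
proof -
  define L where "L = (\<lambda>n \<omega>. \<Prod>i=1..n. g (X i \<omega>))"
  have LF: "L n \<in> borel_measurable (F n)" for n
    unfolding L_def by (intro borel_measurable_prod_ennreal measurable_compose[OF X_measurable_F]) auto
  have LM [measurable]: "L n \<in> borel_measurable M" for n
    by (rule measurable_from_subalg[OF subalg_F LF])
  have AM [measurable]: "A n \<in> sets M" for n using A by (rule sets_F_subset)
  have mart: "(\<integral>\<^sup>+\<omega>. L N \<omega> * indicator B \<omega> \<partial>M) = (\<integral>\<^sup>+\<omega>. L n \<omega> * indicator B \<omega> \<partial>M)"
    if "n \<le> N" "B \<in> sets (F n)" for n N B
    using that(1)
  proof (induction N rule: dec_induct)
    case (step N)
    have "B \<in> sets (F N)" using that(2) F_mono step(1) by blast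
    then have h: "(\<lambda>\<omega>. L N \<omega> * indicator B \<omega>) \<in> borel_measurable (F N)"
      using LF[of N] by (intro borel_measurable_times_ennreal borel_measurable_indicator)
    have "(\<integral>\<^sup>+\<omega>. L (Suc N) \<omega> * indicator B \<omega> \<partial>M)
        = (\<integral>\<^sup>+\<omega>. (L N \<omega> * indicator B \<omega>) * g (X (Suc N) \<omega>) \<partial>M)"
      by (simp add: L_def mult_ac)
    then show ?case using indep_step[OF h assms(1)] step.IH g1 by simp
  qed simp
  have "(\<Sum>n<N. \<integral>\<^sup>+\<omega>. L n \<omega> * indicator (A n) \<omega> \<partial>M) \<le> 1" for N
  proof -
    have "(\<Sum>n<N. \<integral>\<^sup>+\<omega>. L n \<omega> * indicator (A n) \<omega> \<partial>M)
        = (\<Sum>n<N. \<integral>\<^sup>+\<omega>. L N \<omega> * indicator (A n) \<omega> \<partial>M)"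
      by (intro sum.cong mart[symmetric] A) auto
    also have "\<dots> = (\<integral>\<^sup>+\<omega>. L N \<omega> * (\<Sum>n<N. indicator (A n) \<omega>) \<partial>M)"
      by (subst nn_integral_sum[symmetric]) (auto simp: sum_distrib_left)
    also have "\<dots> \<le> (\<integral>\<^sup>+\<omega>. L N \<omega> \<partial>M)"
    proof (rule nn_integral_mono)
      fix \<omega>
      have "(\<Sum>n<N. indicator (A n) \<omega> :: ennreal) = indicator (\<Union>n<N. A n) \<omega>"
        using disj by (intro indicator_UN_disjoint[symmetric]) (auto simp: disjoint_family_on_def)
      also have "\<dots> \<le> 1" by (simp add: indicator_def)
      finally show "L N \<omega> * (\<Sum>n<N. indicator (A n) \<omega>) \<le> L N \<omega>"
        using mult_left_mono[of _ 1 "L N \<omega>"] by simp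
    qed
    also have "\<dots> = 1" unfolding L_def by (subst nn_integral_prod_X) (auto simp: g1 simp del: One_nat_def)
    finally show ?thesis .
  qed
  then show ?thesis unfolding L_def suminf_eq_SUP by (intro SUP_least)
qed

text \<open>The exponential Markov inequality under the tilted law, which appears only through the
  weight given by the product of the \<open>f (X i \<omega>)\<close>. Factors up to \<open>k\<close>
  carry the exponential and are bounded by \<open>tame_exp_moment\<close>; the later ones integrate
  to 1.\<close>

lemma tame_chernoff:
  assumes f: "law.tame_density f" and [measurable]: "\<phi> \<in> borel_measurable borel"
    and K: "\<And>x. f x \<noteq> 0 \<Longrightarrow> \<bar>\<phi> x\<bar> \<le> K"
    and mean: "(\<integral>x. f x * \<phi> x \<partial>distr M borel (X 1)) = 0" and l: "l > 0" and k: "k \<le> n"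
  shows "(\<integral>\<^sup>+\<omega>. ennreal (\<Prod>i=1..n. f (X i \<omega>)) * indicator {\<omega>. a \<le> (\<Sum>i=1..k. \<phi> (X i \<omega>))} \<omega> \<partial>M)
      \<le> ennreal (exp (real k * (l\<^sup>2 * K\<^sup>2 / 2) - l * a))"
proof -
  note law.tame_measurable[OF f, measurable] and nn = law.tame_nonneg[OF f]
  define g where "g = (\<lambda>i x. ennreal (f x * (if i \<le> k then exp (l * \<phi> x) else 1)))"
  have [measurable]: "g i \<in> borel_measurable borel" for i unfolding g_def by measurable
  have "(\<integral>\<^sup>+\<omega>. ennreal (\<Prod>i=1..n. f (X i \<omega>)) * indicator {\<omega>. a \<le> (\<Sum>i=1..k. \<phi> (X i \<omega>))} \<omega> \<partial>M)
      \<le> (\<integral>\<^sup>+\<omega>. ennreal (exp (- (l * a))) * (\<Prod>i=1..n. g i (X i \<omega>)) \<partial>M)"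
  proof (rule nn_integral_mono)
    fix \<omega>
    have "(\<Prod>i=1..n. if i \<le> k then exp (l * \<phi> (X i \<omega>)) else 1) = (\<Prod>i\<in>{1..n} \<inter> {i. i \<le> k}. exp (l * \<phi> (X i \<omega>)))"
      by (simp add: prod.If_cases)
    also have "{1..n} \<inter> {i. i \<le> k} = {1..k}" using k by auto
    finally have e: "(\<Prod>i=1..n. if i \<le> k then exp (l * \<phi> (X i \<omega>)) else 1) = exp (l * (\<Sum>i=1..k. \<phi> (X i \<omega>)))"
      by (simp add: exp_sum sum_distrib_left)
    have p: "(\<Prod>i=1..n. g i (X i \<omega>)) = ennreal ((\<Prod>i=1..n. f (X i \<omega>)) * exp (l * (\<Sum>i=1..k. \<phi> (X i \<omega>))))"
      unfolding g_def using nn by (subst prod_ennreal) (auto simp: prod.distrib e simp del: One_nat_def)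
    have f0: "(\<Prod>i=1..n. f (X i \<omega>)) \<ge> 0" using nn by (intro prod_nonneg) auto
    show "ennreal (\<Prod>i=1..n. f (X i \<omega>)) * indicator {\<omega>. a \<le> (\<Sum>i=1..k. \<phi> (X i \<omega>))} \<omega>
        \<le> ennreal (exp (- (l * a))) * (\<Prod>i=1..n. g i (X i \<omega>))"
    proof (cases "a \<le> (\<Sum>i=1..k. \<phi> (X i \<omega>))")
      case True
      then have "l * a \<le> l * (\<Sum>i=1..k. \<phi> (X i \<omega>))" using l by simp
      then have "1 \<le> exp (- (l * a)) * exp (l * (\<Sum>i=1..k. \<phi> (X i \<omega>)))"
        by (simp flip: exp_add)
      then have "(\<Prod>i=1..n. f (X i \<omega>)) * 1 \<le>
          (\<Prod>i=1..n. f (X i \<omega>)) * (exp (- (l * a)) * exp (l * (\<Sum>i=1..k. \<phi> (X i \<omega>))))"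
        by (rule mult_left_mono[OF _ f0])
      then show ?thesis using True f0 unfolding p
        by (simp add: ennreal_mult'[symmetric] ennreal_leI mult_ac)
    qed simp
  qed
  also have "\<dots> = ennreal (exp (- (l * a))) * (\<Prod>i=1..n. \<integral>\<^sup>+x. g i x \<partial>distr M borel (X 1))"
    by (subst nn_integral_cmult) (auto simp: nn_integral_prod_X simp del: One_nat_def)
  also have "(\<Prod>i=1..n. \<integral>\<^sup>+x. g i x \<partial>distr M borel (X 1))
      \<le> (\<Prod>i=1..n. if i \<le> k then ennreal (exp (l\<^sup>2 * K\<^sup>2 / 2)) else 1)"
  proof (rule prod_mono_ennreal)
    fix i
    have "(\<integral>\<^sup>+x. ennreal (f x) \<partial>distr M borel (X 1)) = 1"
      by (rule law.tame_nn_integral[OF f])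
    then show "(\<integral>\<^sup>+x. g i x \<partial>distr M borel (X 1))
        \<le> (if i \<le> k then ennreal (exp (l\<^sup>2 * K\<^sup>2 / 2)) else 1)"
      using law.tame_exp_moment[OF f assms(2) K mean l] by (auto simp: g_def)
  qed
  also have "\<dots> = (\<Prod>i\<in>{1..n} \<inter> {i. i \<le> k}. ennreal (exp (l\<^sup>2 * K\<^sup>2 / 2)))"
    by (simp add: prod.If_cases)
  also have "{1..n} \<inter> {i. i \<le> k} = {1..k}" using k by auto
  also have "(\<Prod>i\<in>{1..k}. ennreal (exp (l\<^sup>2 * K\<^sup>2 / 2))) = ennreal (exp (real k * (l\<^sup>2 * K\<^sup>2 / 2)))"
    by (simp add: ennreal_power exp_of_nat_mult[symmetric])
  finally show ?thesis
    by (simp add: mult_left_mono flip: ennreal_mult' exp_add)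
qed

end

section \<open>Concentration of the walk under a tilted law\<close>

context iid_walk begin

text \<open>A union bound over the functionals and the times \<open>k \<le> n\<close>: the number of
  bad events grows linearly in \<open>b\<close> and each has weight at most
  \<open>exp (- c * b)\<close>, so eventually the good event keeps half of the total weight
  1.\<close>

lemma tame_good_event:
  assumes f: "law.tame_density f" and \<Phi>: "finite \<Phi>" "\<And>\<phi>. \<phi> \<in> \<Phi> \<Longrightarrow> \<phi> \<in> borel_measurable borel"
    and K: "K > 0" "\<And>\<phi> x. \<phi> \<in> \<Phi> \<Longrightarrow> f x \<noteq> 0 \<Longrightarrow> \<bar>\<phi> x\<bar> \<le> K"
    and mean: "\<And>\<phi>. \<phi> \<in> \<Phi> \<Longrightarrow> (\<integral>x. f x * \<phi> x \<partial>distr M borel (X 1)) = 0"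
    and T: "T > 0" and \<kappa>: "\<kappa> > 0"
  shows "\<forall>\<^sub>F b in at_top. ennreal (1 / 2) \<le>
    (\<integral>\<^sup>+\<omega>. ennreal (\<Prod>i=1..nat \<lfloor>T * b\<rfloor>. f (X i \<omega>)) *
      indicator {\<omega>. \<forall>\<phi>\<in>\<Phi>. \<forall>k\<le>nat \<lfloor>T * b\<rfloor>. (\<Sum>i=1..k. \<phi> (X i \<omega>)) < \<kappa> * b} \<omega> \<partial>M)"
proof -
  note law.tame_measurable[OF f, measurable] and nn = law.tame_nonneg[OF f]
  define c where "c = \<kappa>\<^sup>2 / (2 * T * K\<^sup>2)"
  have c: "c > 0" using T \<kappa> K by (simp add: c_def)
  define N where "N = real (card \<Phi>)"
  have "((\<lambda>b. N * (T * b + 1) * exp (- c * b)) \<longlongrightarrow> 0) at_top" using c T by real_asymp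
  then have "\<forall>\<^sub>F b in at_top. N * (T * b + 1) * exp (- c * b) < 1 / 2"
    by (rule order_tendstoD) simp
  with eventually_gt_at_top[of 0] show ?thesis
  proof eventually_elim
    case (elim b)
    define n where "n = nat \<lfloor>T * b\<rfloor>"
    have n: "real n \<le> T * b" using T elim by (simp add: n_def)
    define P where "P = (\<lambda>\<omega>. ennreal (\<Prod>i=1..n. f (X i \<omega>)))"
    define B where "B = (\<lambda>(\<phi>, k). {\<omega>. \<kappa> * b \<le> (\<Sum>i=1..k. \<phi> (X i \<omega>))})"
    define G where "G = {\<omega>. \<forall>\<phi>\<in>\<Phi>. \<forall>k\<le>n. (\<Sum>i=1..k. \<phi> (X i \<omega>)) < \<kappa> * b}"
    have PM [measurable]: "P \<in> borel_measurable M" unfolding P_def by measurable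
    have BM: "(\<lambda>\<omega>. P \<omega> * indicator (B z) \<omega>) \<in> borel_measurable M" if zB: "z \<in> \<Phi> \<times> {..n}" for z
    proof -
      obtain \<phi> k where z: "z = (\<phi>, k)" "\<phi> \<in> \<Phi>" using zB by auto
      note \<Phi>(2)[OF z(2), measurable]
      show ?thesis unfolding z B_def prod.case by measurable
    qed
    have GM: "(\<lambda>\<omega>. P \<omega> * indicator G \<omega>) \<in> borel_measurable M"
    proof -
      have "Measurable.pred M (\<lambda>\<omega>. (\<Sum>i=1..k. \<phi> (X i \<omega>)) < \<kappa> * b)" if "\<phi> \<in> \<Phi>" for \<phi> k
      proof -
        note \<Phi>(2)[OF that, measurable]
        show ?thesis by measurable
      qed
      then have "Measurable.pred M (\<lambda>\<omega>. \<forall>\<phi>\<in>\<Phi>. \<forall>k\<le>n. (\<Sum>i=1..k. \<phi> (X i \<omega>)) < \<kappa> * b)"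
        using \<Phi>(1) by (intro pred_intros_finite) auto
      note [measurable] = this
      show ?thesis unfolding G_def by measurable
    qed
    have "1 = (\<integral>\<^sup>+\<omega>. P \<omega> \<partial>M)"
    proof -
      have "(\<integral>\<^sup>+\<omega>. P \<omega> \<partial>M) = (\<integral>\<^sup>+\<omega>. (\<Prod>i=1..n. ennreal (f (X i \<omega>))) \<partial>M)"
        unfolding P_def using nn by (subst prod_ennreal) auto
      also have "\<dots> = 1" using law.tame_nn_integral[OF f]
        by (subst nn_integral_prod_X[where g = "\<lambda>i x. ennreal (f x)"]) (auto simp del: One_nat_def)
      finally show ?thesis by simp
    qed
    also have "\<dots> \<le> (\<integral>\<^sup>+\<omega>. P \<omega> * indicator G \<omega> + (\<Sum>z\<in>\<Phi> \<times> {..n}. P \<omega> * indicator (B z) \<omega>) \<partial>M)"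
    proof (rule nn_integral_mono)
      fix \<omega>
      show "P \<omega> \<le> P \<omega> * indicator G \<omega> + (\<Sum>z\<in>\<Phi> \<times> {..n}. P \<omega> * indicator (B z) \<omega>)"
      proof (cases "\<omega> \<in> G")
        case False
        then obtain \<phi> k where "\<phi> \<in> \<Phi>" "k \<le> n" "\<not> (\<Sum>i=1..k. \<phi> (X i \<omega>)) < \<kappa> * b"
          by (auto simp: G_def)
        then have z: "(\<phi>, k) \<in> \<Phi> \<times> {..n}" "\<omega> \<in> B (\<phi>, k)" by (auto simp: B_def)
        have "P \<omega> = P \<omega> * indicator (B (\<phi>, k)) \<omega>" using z by simp
        also have "\<dots> \<le> (\<Sum>z\<in>\<Phi> \<times> {..n}. P \<omega> * indicator (B z) \<omega>)"
          using z \<Phi>(1) by (intro member_le_sum) auto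
        finally show ?thesis by (simp add: add_increasing)
      qed simp
    qed
    also have "\<dots> = (\<integral>\<^sup>+\<omega>. P \<omega> * indicator G \<omega> \<partial>M) + (\<Sum>z\<in>\<Phi> \<times> {..n}. \<integral>\<^sup>+\<omega>. P \<omega> * indicator (B z) \<omega> \<partial>M)"
      using BM GM by (subst nn_integral_add) (auto simp: nn_integral_sum)
    also have "(\<Sum>z\<in>\<Phi> \<times> {..n}. \<integral>\<^sup>+\<omega>. P \<omega> * indicator (B z) \<omega> \<partial>M) \<le> (\<Sum>z\<in>\<Phi> \<times> {..n}. ennreal (exp (- c * b)))"
    proof (rule sum_mono)
      fix z assume "z \<in> \<Phi> \<times> {..n}"
      then obtain \<phi> k where z: "z = (\<phi>, k)" "\<phi> \<in> \<Phi>" "k \<le> n" by auto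
      \<comment> \<open>This \<open>l\<close> minimises
        \<open>T * b * (l\<^sup>2 * K\<^sup>2 / 2) - l * (\<kappa> * b)\<close>, with minimum
        \<open>- c * b\<close>.\<close>
      define l where "l = \<kappa> / (T * K\<^sup>2)"
      have l: "l > 0" using \<kappa> T K by (simp add: l_def)
      have "(\<integral>\<^sup>+\<omega>. P \<omega> * indicator (B z) \<omega> \<partial>M) \<le> ennreal (exp (real k * (l\<^sup>2 * K\<^sup>2 / 2) - l * (\<kappa> * b)))"
        unfolding z P_def B_def prod.case
        by (rule tame_chernoff[OF f \<Phi>(2)[OF z(2)] K(2)[OF z(2)] mean[OF z(2)] l z(3)])
      also have "\<dots> \<le> ennreal (exp (- c * b))"
      proof (intro ennreal_leI, subst exp_le_cancel_iff)
        have "real k * (l\<^sup>2 * K\<^sup>2 / 2) \<le> T * b * (l\<^sup>2 * K\<^sup>2 / 2)"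
          using z(3) n by (intro mult_right_mono) auto
        also have "\<dots> = c * b"
          using T K \<kappa> by (simp add: l_def c_def field_simps power2_eq_square)
        finally have "real k * (l\<^sup>2 * K\<^sup>2 / 2) \<le> c * b" .
        moreover have "l * (\<kappa> * b) = 2 * (c * b)"
          using T K \<kappa> by (simp add: l_def c_def field_simps power2_eq_square)
        ultimately show "real k * (l\<^sup>2 * K\<^sup>2 / 2) - l * (\<kappa> * b) \<le> - c * b" by linarith
      qed
      finally show "(\<integral>\<^sup>+\<omega>. P \<omega> * indicator (B z) \<omega> \<partial>M) \<le> ennreal (exp (- c * b))" .
    qed
    also have "(\<Sum>z\<in>\<Phi> \<times> {..n}. ennreal (exp (- c * b))) = ennreal (N * (real n + 1) * exp (- c * b))"
      using \<Phi>(1) by (simp add: N_def ennreal_of_nat_eq_real_of_nat[symmetric] ennreal_mult' algebra_simps)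
    also have "\<dots> \<le> ennreal (1 / 2)"
    proof (rule ennreal_leI)
      have "N * (real n + 1) * exp (- c * b) \<le> N * (T * b + 1) * exp (- c * b)"
        using n by (intro mult_right_mono mult_left_mono) (auto simp: N_def)
      then show "N * (real n + 1) * exp (- c * b) \<le> 1 / 2" using elim by simp
    qed
    finally have "1 \<le> (\<integral>\<^sup>+\<omega>. P \<omega> * indicator G \<omega> \<partial>M) + ennreal (1 / 2)"
      by (simp add: add_left_mono)
    then have "ennreal (1 / 2) \<le> (\<integral>\<^sup>+\<omega>. P \<omega> * indicator G \<omega> \<partial>M)"
    proof (cases "\<integral>\<^sup>+\<omega>. P \<omega> * indicator G \<omega> \<partial>M" rule: ennreal_cases)
      case (real r)
      have "ennreal 1 \<le> ennreal r + ennreal (1 / 2)" using \<open>1 \<le> _\<close> real by simp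
      also have "\<dots> = ennreal (r + 1 / 2)" using real by (subst ennreal_plus) auto
      finally have "1 \<le> r + 1 / 2" using real by (subst (asm) ennreal_le_iff) auto
      then show ?thesis unfolding real by (intro ennreal_leI) simp
    qed simp
    then show ?case by (simp add: P_def G_def n_def)
  qed
qed

text \<open>On the good event the tilted weight is at most \<open>exp r\<close>, so weight at least
  \<open>1 / 2\<close> under the tilt forces probability at least \<open>exp (- r) / 2\<close> under
  the original measure.\<close>

lemma walk_tube:
  assumes f: "law.tame_density f" and T: "T > 0" and \<eta>: "\<eta> > 0"
  shows "\<forall>\<^sub>F b in at_top. 1 / 2 * exp (- (T * law.rel_ent f + \<eta>) * b) \<le>
    prob {\<omega>\<in>space M. \<forall>k\<le>nat \<lfloor>T * b\<rfloor>. norm (walk X k \<omega> - real k *\<^sub>R law.tame_mean f) < \<eta> * b}"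
proof -
  note law.tame_measurable[OF f, measurable] and nn = law.tame_nonneg[OF f]
  note fi = law.tame_integrables[OF f]
  define m where "m = law.tame_mean f"
  define H where "H = law.rel_ent f"
  have f1: "(\<integral>x. f x \<partial>distr M borel (X 1)) = 1" by (rule law.tame_integral[OF f])
  obtain K0 where K0: "K0 > 0" "\<And>x. f x \<noteq> 0 \<Longrightarrow> \<bar>ln (f x)\<bar> \<le> K0" "\<And>x. f x \<noteq> 0 \<Longrightarrow> norm x \<le> K0"
    using law.tame_ln_bound[OF f] by metis
  define D where "D = real DIM('d)"
  have D: "D \<ge> 1" unfolding D_def using DIM_positive[where 'a='d] by linarith
  \<comment> \<open>Bounding the norm by the sum of the coordinates costs the factor
    \<open>D\<close>.\<close>
  define \<kappa> where "\<kappa> = \<eta> / D"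
  have \<kappa>: "\<kappa> > 0" using \<eta> D by (simp add: \<kappa>_def)
  have \<kappa>_le: "\<kappa> \<le> \<eta>" using \<eta> D by (simp add: \<kappa>_def field_simps)
  define E :: "'d set" where "E = Basis \<union> uminus ` Basis"
  \<comment> \<open>The first functional controls the log-likelihood, that is, the price of the
    tilt; the signed coordinates control the position of the walk.\<close>
  define \<Phi> where "\<Phi> = insert (\<lambda>x. ln (f x) - H) ((\<lambda>e x. e \<bullet> (x - m)) ` E)"
  define K where "K = K0 + norm m + \<bar>H\<bar>"
  have "\<forall>\<^sub>F b in at_top. ennreal (1 / 2) \<le>
    (\<integral>\<^sup>+\<omega>. ennreal (\<Prod>i=1..nat \<lfloor>T * b\<rfloor>. f (X i \<omega>)) *
      indicator {\<omega>. \<forall>\<phi>\<in>\<Phi>. \<forall>k\<le>nat \<lfloor>T * b\<rfloor>. (\<Sum>i=1..k. \<phi> (X i \<omega>)) < \<kappa> * b} \<omega> \<partial>M)"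
  proof (rule tame_good_event[OF f _ _ _ _ _ T \<kappa>])
    show "finite \<Phi>" by (simp add: \<Phi>_def E_def)
    show "\<phi> \<in> borel_measurable borel" if "\<phi> \<in> \<Phi>" for \<phi> using that by (auto simp: \<Phi>_def)
    show "K > 0" using K0 by (simp add: K_def add_pos_nonneg)
    show "\<bar>\<phi> x\<bar> \<le> K" if \<phi>: "\<phi> \<in> \<Phi>" and fx: "f x \<noteq> 0" for \<phi> x
    proof -
      consider "\<phi> = (\<lambda>x. ln (f x) - H)" | e where "e \<in> E" "\<phi> = (\<lambda>x. e \<bullet> (x - m))"
        using \<phi> by (auto simp: \<Phi>_def)
      then show ?thesis
      proof cases
        case 1
        then show ?thesis using K0(2)[OF fx] by (simp add: K_def) (smt (verit) norm_ge_zero)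
      next
        case 2
        then have "norm e = 1" by (auto simp: E_def)
        then have "\<bar>\<phi> x\<bar> \<le> norm (x - m)" using Cauchy_Schwarz_ineq2[of e "x - m"] 2 by simp
        also have "\<dots> \<le> norm x + norm m" by (rule norm_triangle_ineq4)
        also have "\<dots> \<le> K" using K0(3)[OF fx] by (simp add: K_def)
        finally show ?thesis .
      qed
    qed
    show "(\<integral>x. f x * \<phi> x \<partial>distr M borel (X 1)) = 0" if \<phi>: "\<phi> \<in> \<Phi>" for \<phi>
    proof -
      consider "\<phi> = (\<lambda>x. ln (f x) - H)" | e where "e \<in> E" "\<phi> = (\<lambda>x. e \<bullet> (x - m))"
        using \<phi> by (auto simp: \<Phi>_def)
      then show ?thesis
      proof cases
        case 1
        then show ?thesis using fi f1 by (simp add: right_diff_distrib H_def law.rel_ent_def del: One_nat_def)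
      next
        case 2
        then show ?thesis using fi f1 law.inner_tame_mean[OF f, of e]
          by (simp add: inner_diff_right right_diff_distrib m_def)
      qed
    qed
  qed
  with eventually_gt_at_top[of 0] show ?thesis
  proof eventually_elim
    case (elim b)
    define n where "n = nat \<lfloor>T * b\<rfloor>"
    have n: "real n \<le> T * b" using T elim by (simp add: n_def)
    define Tube where "Tube = {\<omega>\<in>space M. \<forall>k\<le>n. norm (walk X k \<omega> - real k *\<^sub>R m) < \<eta> * b}"
    have [measurable]: "Tube \<in> sets M" unfolding Tube_def by measurable
    define G where "G = {\<omega>. \<forall>\<phi>\<in>\<Phi>. \<forall>k\<le>n. (\<Sum>i=1..k. \<phi> (X i \<omega>)) < \<kappa> * b}"
    define r where "r = (T * H + \<eta>) * b"
    have tube: "norm (walk X k \<omega> - real k *\<^sub>R m) < \<eta> * b" if "\<omega> \<in> G" "k \<le> n" for \<omega> k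
    proof -
      let ?v = "walk X k \<omega> - real k *\<^sub>R m"
      have v: "e \<bullet> ?v = (\<Sum>i=1..k. e \<bullet> (X i \<omega> - m))" for e
        by (simp add: walk_def inner_diff_right inner_sum_right sum_subtractf)
      have le: "e \<bullet> ?v < \<kappa> * b" if "e \<in> E" for e
        unfolding v using \<open>\<omega> \<in> G\<close> \<open>k \<le> n\<close> that by (auto simp: G_def \<Phi>_def)
      have "norm ?v \<le> (\<Sum>e\<in>Basis. \<bar>?v \<bullet> e\<bar>)" by (rule norm_le_l1)
      also have "\<dots> < (\<Sum>e\<in>(Basis :: 'd set). \<kappa> * b)"
      proof (rule sum_strict_mono)
        fix e :: 'd assume "e \<in> Basis"
        then have "e \<in> E" "- e \<in> E" by (auto simp: E_def)
        then show "\<bar>?v \<bullet> e\<bar> < \<kappa> * b" using le[of e] le[of "- e"] by (simp add: inner_commute abs_less_iff)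
      qed auto
      also have "\<dots> = \<eta> * b" using D by (simp add: \<kappa>_def D_def)
      finally show ?thesis .
    qed
    have "ennreal (1 / 2) \<le> (\<integral>\<^sup>+\<omega>. ennreal (\<Prod>i=1..n. f (X i \<omega>)) * indicator G \<omega> \<partial>M)"
      using elim by (simp add: n_def G_def)
    also have "\<dots> \<le> (\<integral>\<^sup>+\<omega>. ennreal (exp r) * indicator Tube \<omega> \<partial>M)"
    proof (rule nn_integral_mono)
      fix \<omega> assume \<omega>: "\<omega> \<in> space M"
      show "ennreal (\<Prod>i=1..n. f (X i \<omega>)) * indicator G \<omega> \<le> ennreal (exp r) * indicator Tube \<omega>"
      proof (cases "\<omega> \<in> G \<and> (\<Prod>i=1..n. f (X i \<omega>)) \<noteq> 0")
        case True
        then have "\<omega> \<in> Tube" using \<omega> tube by (auto simp: Tube_def)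
        have pos: "f (X i \<omega>) > 0" if "i \<in> {1..n}" for i
          using True nn[of "X i \<omega>"] that by (auto simp: less_le)
        have "(\<Sum>i=1..n. ln (f (X i \<omega>)) - H) < \<kappa> * b"
          using True by (auto simp: G_def \<Phi>_def)
        then have "(\<Sum>i=1..n. ln (f (X i \<omega>))) < real n * H + \<kappa> * b" by (simp add: sum_subtractf)
        \<comment> \<open>Replacing \<open>n\<close> by the larger \<open>T * b\<close> relies on
          the entropy being nonnegative.\<close>
        also have "\<dots> \<le> (T * b) * H + \<eta> * b"
          using n \<kappa>_le elim law.rel_ent_nonneg[OF f]
          by (intro add_mono mult_right_mono) (auto simp: H_def)
        also have "\<dots> = r" by (simp add: r_def algebra_simps)
        finally have "exp (\<Sum>i=1..n. ln (f (X i \<omega>))) \<le> exp r" by simp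
        also have "exp (\<Sum>i=1..n. ln (f (X i \<omega>))) = (\<Prod>i=1..n. f (X i \<omega>))"
          unfolding exp_sum[OF finite_atLeastAtMost] by (intro prod.cong) (use pos in auto)
        finally show ?thesis using True \<open>\<omega> \<in> Tube\<close> by (simp add: ennreal_leI)
      next
        case False
        then have "\<omega> \<notin> G \<or> (\<Prod>i=1..n. f (X i \<omega>)) = 0" by blast
        then show ?thesis by (elim disjE) (simp_all del: prod_zero_iff One_nat_def)
      qed
    qed
    also have "\<dots> = ennreal (exp r * prob Tube)"
      by (subst nn_integral_cmult_indicator) (auto simp: emeasure_eq_measure ennreal_mult)
    finally have "1 / 2 \<le> exp r * prob Tube" by (subst (asm) ennreal_le_iff) auto
    then have "exp (- r) * (1 / 2) \<le> exp (- r) * (exp r * prob Tube)" by (intro mult_left_mono) auto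
    also have "\<dots> = prob Tube" by (simp flip: mult.assoc exp_add)
    finally show ?case by (simp add: r_def Tube_def n_def m_def H_def algebra_simps)
  qed
qed

end

section \<open>Hitting times and the mixture estimator\<close>

text \<open>Comparing strictly with \<open>Suc n\<close> turns the infimum into the existence of a
  hitting index; this also covers walks that never hit, whose infimum is infinite.\<close>

lemma hit_time_le_iff:
  "hit_time X U b \<omega> \<le> enat n \<longleftrightarrow> (\<exists>k\<le>n. walk X k \<omega> \<in> (\<lambda>x. b *\<^sub>R x) ` U)"
proof -
  have "hit_time X U b \<omega> \<le> enat n \<longleftrightarrow> hit_time X U b \<omega> < enat (Suc n)"
    by (cases "hit_time X U b \<omega>") auto
  also have "\<dots> \<longleftrightarrow> (\<exists>k\<le>n. walk X k \<omega> \<in> (\<lambda>x. b *\<^sub>R x) ` U)"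
    unfolding hit_time_def INF_less_iff by (auto simp: less_Suc_eq_le)
  finally show ?thesis .
qed

lemma less_hit_time_iff:
  "enat n < hit_time X U b \<omega> \<longleftrightarrow> (\<forall>k\<le>n. walk X k \<omega> \<notin> (\<lambda>x. b *\<^sub>R x) ` U)"
  using hit_time_le_iff[of X U b \<omega> n] by (auto simp: not_le[symmetric])

text \<open>Puts the likelihood ratio into the product form required by
  \<open>optional_stopping\<close>.\<close>

lemma (in iid_walk) tilt_walk_prod:
  "ennreal (exp (\<theta> \<bullet> walk X n \<omega> - real n * l)) = (\<Prod>i=1..n. ennreal (exp (\<theta> \<bullet> X i \<omega> - l)))"
  by (subst prod_ennreal) (auto simp: walk_def inner_sum_right sum_subtractf simp flip: exp_sum)

section \<open>Stopping events and the lower bound for the rare event\<close>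

locale walk_hitting = iid_walk +
  fixes W :: "nat \<Rightarrow> 'b set" and J :: nat
  assumes J: "J \<ge> 1" and W_open: "\<And>j. j \<le> J \<Longrightarrow> open (W j)"
begin

lemma hit_time_min_le_iff:
  "hit_time_min X W J b \<omega> \<le> enat n \<longleftrightarrow>
    (\<exists>j\<in>{1..J}. \<exists>k\<le>n. walk X k \<omega> \<in> (\<lambda>x. b *\<^sub>R x) ` W j)"
  unfolding hit_time_min_def using J by (subst Min_le_iff) (auto simp: hit_time_le_iff)

text \<open>The rare event is split by the value of the stopping time because each piece lies in
  \<open>F n\<close>, where the tilted measures have explicit densities.\<close>

definition stop_event :: "real \<Rightarrow> nat \<Rightarrow> 'a set" where
  "stop_event b n = {\<omega>\<in>space M. hit_time_min X W J b \<omega> = enat n \<and> enat n < hit_time X (W 0) b \<omega>}"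

lemma disjoint_stop_event: "disjoint_family (stop_event b)"
  by (auto simp: disjoint_family_on_def stop_event_def)

lemma rare_event_eq: "rare_event M X W J b = (\<Union>n. stop_event b n)"
proof (intro equalityI subsetI)
  fix \<omega> assume "\<omega> \<in> rare_event M X W J b"
  then show "\<omega> \<in> (\<Union>n. stop_event b n)"
    by (cases "hit_time_min X W J b \<omega>") (auto simp: rare_event_def stop_event_def)
qed (auto simp: rare_event_def stop_event_def)

text \<open>Minimality of the stopping time excludes an earlier hit, so the hit occurs at
  \<open>n\<close> itself.\<close>

lemma stop_event_hit:
  assumes "\<omega> \<in> stop_event b n"
  obtains j where "j \<in> {1..J}" "walk X n \<omega> \<in> (\<lambda>x. b *\<^sub>R x) ` W j"
proof -
  have eq: "hit_time_min X W J b \<omega> = enat n" using assms by (simp add: stop_event_def)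
  then have "\<exists>j\<in>{1..J}. \<exists>k\<le>n. walk X k \<omega> \<in> (\<lambda>x. b *\<^sub>R x) ` W j"
    unfolding hit_time_min_le_iff[symmetric] by simp
  then obtain j k where jk: "j \<in> {1..J}" "k \<le> n" "walk X k \<omega> \<in> (\<lambda>x. b *\<^sub>R x) ` W j"
    by blast
  then have "hit_time_min X W J b \<omega> \<le> enat k" using hit_time_min_le_iff[of b \<omega> k] by blast
  then have "k = n" using eq jk(2) by simp
  then show thesis using jk that by blast
qed

lemma walk_hit_sets_F:
  assumes "b > 0" "j \<le> J" "k \<le> n"
  shows "{\<omega>\<in>space M. walk X k \<omega> \<in> (\<lambda>x. b *\<^sub>R x) ` W j} \<in> sets (F n)"
proof -
  have "(\<lambda>x. b *\<^sub>R x) ` W j \<in> sets borel"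
    using assms W_open[of j] by (intro borel_open open_scaling) auto
  from measurable_sets[OF walk_measurable_F[OF assms(3)] this] show ?thesis
    by (simp add: vimage_def Int_def conj_commute)
qed

lemma stop_event_F: assumes b: "b > 0" shows "stop_event b n \<in> sets (F n)"
proof -
  have *: "{\<omega>\<in>space M. hit_time_min X W J b \<omega> \<le> enat k} \<in> sets (F n)" if "k \<le> n" for k
  proof -
    have "{\<omega>\<in>space M. hit_time_min X W J b \<omega> \<le> enat k} =
      (\<Union>j\<in>{1..J}. \<Union>i\<in>{..k}. {\<omega>\<in>space M. walk X i \<omega> \<in> (\<lambda>x. b *\<^sub>R x) ` W j})"
      by (auto simp: hit_time_min_le_iff)
    also have "\<dots> \<in> sets (F n)" using b that by (intro sets.finite_UN walk_hit_sets_F) auto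
    finally show ?thesis .
  qed
  have "stop_event b n = {\<omega>\<in>space M. hit_time_min X W J b \<omega> \<le> enat n}
      - (\<Union>k\<in>{..<n}. {\<omega>\<in>space M. hit_time_min X W J b \<omega> \<le> enat k})
      - (\<Union>k\<in>{..n}. {\<omega>\<in>space M. walk X k \<omega> \<in> (\<lambda>x. b *\<^sub>R x) ` W 0})" (is "_ = ?A - ?B - ?C")
  proof -
    have "h = enat n \<longleftrightarrow> h \<le> enat n \<and> (\<forall>k<n. \<not> h \<le> enat k)" for h
    proof (cases h)
      case (enat m)
      then show ?thesis by (auto simp: not_le) (meson antisym_conv2 less_irrefl nat_less_le not_less)
    qed simp
    note * = this[of "hit_time_min X W J b _"]
    show ?thesis unfolding stop_event_def less_hit_time_iff by (auto simp: *)
  qed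
  also have "\<dots> \<in> sets (F n)"
    using b * by (intro sets.Diff sets.finite_UN walk_hit_sets_F) auto
  finally show ?thesis .
qed

lemma stop_event_sets: "b > 0 \<Longrightarrow> stop_event b n \<in> sets M"
  by (rule sets_F_subset[OF stop_event_F])

lemma rare_event_sets: "b > 0 \<Longrightarrow> rare_event M X W J b \<in> sets M"
  unfolding rare_event_eq by (intro sets.countable_UN) (auto intro: stop_event_sets)

text \<open>On the tube the rescaled walk ends in a ball inside \<open>W j\<close>. It does not
  visit \<open>W 0\<close> up to then: such a point would be away from the origin and close to the
  ray through \<open>m\<close>, hence a positive multiple of it would lie in that ball and the two
  cones would meet.\<close>

lemma rare_event_lower:
  assumes j: "j \<in> {1..J}" and f: "law.tame_density f" and t: "t > 0"
    and mean: "t *\<^sub>R law.tame_mean f \<in> W j"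
    and cone: "pos_cone (W j) \<inter> pos_cone (W 0) = {}"
    and \<delta>: "\<delta> > 0" "ball 0 \<delta> \<inter> W 0 = {}" and \<epsilon>: "\<epsilon> > 0"
  shows "\<forall>\<^sub>F b in at_top. 1 / 2 * exp (- (t * law.rel_ent f + \<epsilon>) * b) \<le> prob (rare_event M X W J b)"
proof -
  define m where "m = law.tame_mean f"
  obtain \<rho> where \<rho>: "\<rho> > 0" "ball (t *\<^sub>R m) \<rho> \<subseteq> W j"
    using W_open[of j] j mean by (auto simp: open_contains_ball m_def)
  \<comment> \<open>\<epsilon> absorbs the cost of the tube, \<open>\<rho> / 2\<close> places the
    endpoint, \<open>\<delta> / 2\<close> keeps visits to \<open>W 0\<close> away from time 0, and
    the last term keeps the error below \<rho> after rescaling by \<open>t / s\<close>.\<close>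
  define \<eta> where "\<eta> = Min {\<epsilon>, \<delta> / 2, \<rho> / 2, \<delta> * \<rho> / (2 * t * (norm m + 1))}"
  have "\<delta> * \<rho> / (2 * t * (norm m + 1)) > 0"
    using \<delta> \<rho> t by (intro divide_pos_pos mult_pos_pos) (auto simp: add_nonneg_pos)
  then have \<eta>0: "\<eta> > 0" using \<epsilon> \<delta> \<rho> by (simp add: \<eta>_def)
  have \<eta>: "\<eta> \<le> \<epsilon>" "\<eta> \<le> \<delta> / 2" "\<eta> \<le> \<rho> / 2" "\<eta> \<le> \<delta> * \<rho> / (2 * t * (norm m + 1))"
    unfolding \<eta>_def by (rule Min_le; simp)+
  \<comment> \<open>This absorbs the rounding of \<open>t * b\<close> to an integer.\<close>
  have "\<forall>\<^sub>F b in at_top. norm m / b < \<rho> / 2"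
    using \<rho>(1) by real_asymp
  with walk_tube[OF f t \<eta>0] eventually_gt_at_top[of 0] show ?thesis
  proof eventually_elim
    case (elim b)
    define n where "n = nat \<lfloor>t * b\<rfloor>"
    have n: "real n \<le> t * b" "t * b < real n + 1" using t elim by (simp_all add: n_def)
    define Tube where "Tube = {\<omega>\<in>space M. \<forall>k\<le>n. norm (walk X k \<omega> - real k *\<^sub>R m) < \<eta> * b}"
    have sub: "Tube \<subseteq> rare_event M X W J b"
    proof
      fix \<omega> assume \<omega>: "\<omega> \<in> Tube"
      have near: "norm ((1 / b) *\<^sub>R walk X k \<omega> - (real k / b) *\<^sub>R m) < \<eta>" if "k \<le> n" for k
      proof -
        have "(1 / b) *\<^sub>R walk X k \<omega> - (real k / b) *\<^sub>R m = (1 / b) *\<^sub>R (walk X k \<omega> - real k *\<^sub>R m)"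
          by (simp add: scaleR_diff_right)
        then have "norm ((1 / b) *\<^sub>R walk X k \<omega> - (real k / b) *\<^sub>R m) = norm (walk X k \<omega> - real k *\<^sub>R m) / b"
          using elim by simp
        also have "\<dots> < \<eta>" using \<omega> that elim by (simp add: Tube_def divide_less_eq)
        finally show ?thesis .
      qed
      have mem: "walk X k \<omega> \<in> (\<lambda>x. b *\<^sub>R x) ` U \<longleftrightarrow> (1 / b) *\<^sub>R walk X k \<omega> \<in> U" for k U
      proof
        assume "(1 / b) *\<^sub>R walk X k \<omega> \<in> U"
        then have "b *\<^sub>R ((1 / b) *\<^sub>R walk X k \<omega>) \<in> (\<lambda>x. b *\<^sub>R x) ` U" by (rule imageI)
        then show "walk X k \<omega> \<in> (\<lambda>x. b *\<^sub>R x) ` U" using elim by simp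
      qed (use elim in auto)
      have "norm ((1 / b) *\<^sub>R walk X n \<omega> - t *\<^sub>R m)
          \<le> norm ((1 / b) *\<^sub>R walk X n \<omega> - (real n / b) *\<^sub>R m) + norm ((real n / b) *\<^sub>R m - t *\<^sub>R m)"
        by (rule order_trans[OF _ norm_triangle_ineq]) simp
      also have "norm ((real n / b) *\<^sub>R m - t *\<^sub>R m) = \<bar>real n / b - t\<bar> * norm m"
        by (simp flip: scaleR_diff_left)
      also have "\<bar>real n / b - t\<bar> \<le> 1 / b"
      proof -
        have "real n / b \<le> t" using n elim by (simp add: pos_divide_le_eq)
        moreover have "t \<le> (real n + 1) / b" using n elim by (simp add: pos_le_divide_eq)
        ultimately show ?thesis by (simp add: add_divide_distrib)
      qed
      finally have "norm ((1 / b) *\<^sub>R walk X n \<omega> - t *\<^sub>R m)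
          \<le> norm ((1 / b) *\<^sub>R walk X n \<omega> - (real n / b) *\<^sub>R m) + 1 / b * norm m"
        by (simp add: mult_right_mono)
      also have "1 / b * norm m = norm m / b" by simp
      also have "norm ((1 / b) *\<^sub>R walk X n \<omega> - (real n / b) *\<^sub>R m) + norm m / b < \<rho>"
        using near[of n] \<open>norm m / b < \<rho> / 2\<close> \<eta>(3) by linarith
      finally have "(1 / b) *\<^sub>R walk X n \<omega> \<in> W j"
        using \<rho>(2) by (auto simp: dist_norm norm_minus_commute)
      then have hit: "hit_time_min X W J b \<omega> \<le> enat n"
        unfolding hit_time_min_le_iff mem using j by blast
      have "(1 / b) *\<^sub>R walk X k \<omega> \<notin> W 0" if k: "k \<le> n" for k
      proof
        define y where "y = (1 / b) *\<^sub>R walk X k \<omega>"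
        define s where "s = real k / b"
        assume "(1 / b) *\<^sub>R walk X k \<omega> \<in> W 0"
        then have y0: "y \<in> W 0" by (simp add: y_def)
        then have "\<not> norm y < \<delta>" using \<delta>(2) by auto
        moreover have ys: "norm (y - s *\<^sub>R m) < \<eta>" using near[OF k] by (simp add: y_def s_def)
        moreover have "norm y \<le> norm (y - s *\<^sub>R m) + norm (s *\<^sub>R m)"
          by (rule order_trans[OF _ norm_triangle_ineq]) simp
        moreover have s0: "s \<ge> 0" using elim by (simp add: s_def)
        \<comment> \<open>A visit to \<open>W 0\<close> needs \<open>s\<close> bounded away from 0,
          which bounds the rescaling factor \<open>t / s\<close>.\<close>
        ultimately have sm: "\<delta> / 2 < s * norm m" using \<eta>(2) by simp
        then have s: "s > 0" using s0 \<delta>(1) by (cases "s = 0") auto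
        have "(t / s) *\<^sub>R y \<in> ball (t *\<^sub>R m) \<rho>"
        proof -
          have "t *\<^sub>R m - (t / s) *\<^sub>R y = - ((t / s) *\<^sub>R (y - s *\<^sub>R m))"
            using s by (simp add: scaleR_diff_right)
          then have "norm (t *\<^sub>R m - (t / s) *\<^sub>R y) = t / s * norm (y - s *\<^sub>R m)" using t s by simp
          also have "\<dots> < t / s * \<eta>" using ys t s by (intro mult_strict_left_mono) auto
          also have "\<dots> \<le> \<rho>"
          proof -
            have "t * \<eta> \<le> t * (\<delta> * \<rho> / (2 * t * (norm m + 1)))" using \<eta>(4) t by (intro mult_left_mono) auto
            also have "\<dots> = \<delta> / 2 * \<rho> / (norm m + 1)" using t by simp
            also have "\<dots> \<le> (s * norm m) * \<rho> / (norm m + 1)"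
              using sm \<rho> by (intro divide_right_mono mult_right_mono) (auto simp: add_nonneg_nonneg)
            also have "\<dots> = s * \<rho> * (norm m / (norm m + 1))" by simp
            also have "\<dots> \<le> s * \<rho> * 1" using s \<rho>
              by (intro mult_left_mono) (auto simp: add_nonneg_pos)
            finally show ?thesis using s by (simp add: field_simps)
          qed
          finally show ?thesis by (simp add: dist_norm)
        qed
        then have "(t / s) *\<^sub>R y \<in> pos_cone (W j)"
          using \<rho>(2) by (force simp: pos_cone_def intro: exI[of _ 1])
        moreover have "(t / s) *\<^sub>R y \<in> pos_cone (W 0)"
          using y0 t s unfolding pos_cone_def by (auto intro!: exI[of _ "t / s"])
        ultimately show False using cone by blast
      qed
      then have "enat n < hit_time X (W 0) b \<omega>" unfolding less_hit_time_iff mem by blast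
      then show "\<omega> \<in> rare_event M X W J b"
        using hit \<omega> by (auto simp: rare_event_def Tube_def)
    qed
    have "1 / 2 * exp (- (t * law.rel_ent f + \<epsilon>) * b) \<le> 1 / 2 * exp (- (t * law.rel_ent f + \<eta>) * b)"
      using \<eta>(1) elim by simp
    also have "\<dots> \<le> prob Tube" using elim by (simp add: Tube_def n_def m_def)
    also have "\<dots> \<le> prob (rare_event M X W J b)"
      using sub rare_event_sets elim by (intro finite_measure_mono) auto
    finally show ?case .
  qed
qed

end

text \<open>The density of \<open>Q\<close> is prescribed only on \<open>F n\<close>; the integral
  is restricted to that sub-algebra, rewritten there, and lifted back to \<open>M\<close>.\<close>

lemma (in iid_walk) nn_integral_tilted:
  assumes Q: "tilted_measure M X \<theta> Q" and h: "h \<in> borel_measurable (F n)"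
  shows "(\<integral>\<^sup>+\<omega>. h \<omega> \<partial>Q) = (\<integral>\<^sup>+\<omega>.
    ennreal (exp (\<theta> \<bullet> walk X n \<omega> - real n * real_of_ereal (log_mgf M (X 1) \<theta>))) * h \<omega> \<partial>M)"
proof -
  define D where "D = (\<lambda>\<omega>. ennreal (exp (\<theta> \<bullet> walk X n \<omega> - real n * real_of_ereal (log_mgf M (X 1) \<theta>))))"
  have sets: "sets Q = sets M" using Q by (simp add: tilted_measure_def)
  then have sub: "subalgebra Q (F n)"
    using subalg_F[of n] sets_eq_imp_space_eq[OF sets] by (simp add: subalgebra_def)
  note walk_measurable_F[OF order_refl, of n, measurable]
  have D: "D \<in> borel_measurable (F n)" unfolding D_def by measurable
  have "(\<integral>\<^sup>+\<omega>. h \<omega> \<partial>Q) = (\<integral>\<^sup>+\<omega>. h \<omega> \<partial>restr_to_subalg Q (F n))"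
    by (rule nn_integral_subalgebra2[OF sub h, symmetric])
  also have "restr_to_subalg Q (F n) = density (restr_to_subalg M (F n)) D"
    using Q by (simp add: tilted_measure_def D_def)
  also have "(\<integral>\<^sup>+\<omega>. h \<omega> \<partial>density (restr_to_subalg M (F n)) D) =
      (\<integral>\<^sup>+\<omega>. D \<omega> * h \<omega> \<partial>restr_to_subalg M (F n))"
    by (intro nn_integral_density measurable_in_subalg[OF subalg_F] D h)
  also have "\<dots> = (\<integral>\<^sup>+\<omega>. D \<omega> * h \<omega> \<partial>M)"
    using D h by (intro nn_integral_subalgebra2[OF subalg_F] borel_measurable_times_ennreal)
  finally show ?thesis by (simp add: D_def)
qed

text \<open>Induction over measurable functions, starting from the values of the mixture on
  sets.\<close>

lemma nn_integral_mixture: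
  assumes sets: "\<And>\<theta>. \<theta> \<in> \<Theta> \<Longrightarrow> sets (Q \<theta>) = sets M" and h: "h \<in> borel_measurable M"
  shows "(\<integral>\<^sup>+\<omega>. h \<omega> \<partial>mixture M \<Theta> Q) = (\<Sum>\<theta>\<in>\<Theta>. \<integral>\<^sup>+\<omega>. h \<omega> \<partial>Q \<theta>) / of_nat (card \<Theta>)"
  using h
proof (induction rule: borel_measurable_induct)
  case (cong f g)
  have "(\<integral>\<^sup>+\<omega>. f \<omega> \<partial>mixture M \<Theta> Q) = (\<integral>\<^sup>+\<omega>. g \<omega> \<partial>mixture M \<Theta> Q)"
    using cong(3) by (intro nn_integral_cong) simp
  moreover have "(\<integral>\<^sup>+\<omega>. f \<omega> \<partial>Q \<theta>) = (\<integral>\<^sup>+\<omega>. g \<omega> \<partial>Q \<theta>)" if "\<theta> \<in> \<Theta>" for \<theta>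
    using cong(3) sets_eq_imp_space_eq[OF sets[OF that]] by (intro nn_integral_cong) simp
  ultimately show ?case using cong(4) by simp
next
  case (set A)
  then show ?case using sets by (simp add: emeasure_mixture)
next
  case (mult u c)
  have "u \<in> borel_measurable (Q \<theta>)" if "\<theta> \<in> \<Theta>" for \<theta>
    using mult(2) measurable_cong_sets[OF sets[OF that] refl] by blast
  then show ?case using mult(2,4)
    by (simp add: nn_integral_cmult sum_distrib_left[symmetric] ennreal_times_divide)
next
  case (add u v)
  have "u \<in> borel_measurable (Q \<theta>)" "v \<in> borel_measurable (Q \<theta>)" if "\<theta> \<in> \<Theta>" for \<theta>
    using add(1,2) add(3,4) measurable_cong_sets[OF sets[OF that] refl] by blast+
  then show ?case using add
    by (simp add: nn_integral_add sum.distrib add_divide_distrib_ennreal)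
next
  case (seq U)
  have meas: "U i \<in> borel_measurable (Q \<theta>)" if "\<theta> \<in> \<Theta>" for \<theta> i
    using seq(1) measurable_cong_sets[OF sets[OF that] refl] by blast
  have inc: "incseq (\<lambda>i. \<integral>\<^sup>+\<omega>. U i \<omega> \<partial>Q \<theta>)" for \<theta>
    by (intro incseq_SucI nn_integral_mono le_funD[OF incseq_SucD[OF seq(3)]])
  have "(\<integral>\<^sup>+\<omega>. (SUP i. U i) \<omega> \<partial>mixture M \<Theta> Q) = (SUP i. \<integral>\<^sup>+\<omega>. U i \<omega> \<partial>mixture M \<Theta> Q)"
    using seq(1,3) by (simp add: nn_integral_monotone_convergence_SUP image_comp)
  also have "\<dots> = (SUP i. (\<Sum>\<theta>\<in>\<Theta>. \<integral>\<^sup>+\<omega>. U i \<omega> \<partial>Q \<theta>)) / of_nat (card \<Theta>)"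
    using seq.IH by (simp add: SUP_divide_ennreal)
  also have "(SUP i. (\<Sum>\<theta>\<in>\<Theta>. \<integral>\<^sup>+\<omega>. U i \<omega> \<partial>Q \<theta>)) = (\<Sum>\<theta>\<in>\<Theta>. SUP i. \<integral>\<^sup>+\<omega>. U i \<omega> \<partial>Q \<theta>)"
    using inc by (intro ennreal_SUP_sum)
  also have "\<dots> = (\<Sum>\<theta>\<in>\<Theta>. \<integral>\<^sup>+\<omega>. (SUP i. U i) \<omega> \<partial>Q \<theta>)"
    using seq(3) meas by (intro sum.cong refl) (simp add: nn_integral_monotone_convergence_SUP image_comp)
  finally show ?case by (simp add: seq(4))
qed

section \<open>Two-sided bounds for the second moment of the estimator\<close>

locale mixture_sampling = walk_hitting +
  fixes \<Theta> :: "'b set" and Q :: "'b \<Rightarrow> 'a measure"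
  assumes fin: "finite \<Theta>" and ne: "\<Theta> \<noteq> {}"
    and dom: "\<Theta> \<subseteq> eff_dom (log_mgf M (X 1))"
    and tilted: "\<And>\<theta>. \<theta> \<in> \<Theta> \<Longrightarrow> tilted_measure M X \<theta> (Q \<theta>)"
begin

definition lik :: "'b \<Rightarrow> nat \<Rightarrow> 'a \<Rightarrow> real" where
  "lik \<theta> n \<omega> = exp (\<theta> \<bullet> walk X n \<omega> - real n * real_of_ereal (log_mgf M (X 1) \<theta>))"

text \<open>The density of the mixture with respect to \<open>M\<close> on \<open>F n\<close>; on
  \<open>stop_event b n\<close> the weight is its inverse.\<close>

definition mix_lik :: "nat \<Rightarrow> 'a \<Rightarrow> real" where
  "mix_lik n \<omega> = (\<Sum>\<theta>\<in>\<Theta>. lik \<theta> n \<omega>) / real (card \<Theta>)"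

lemma card_pos: "real (card \<Theta>) > 0" using fin ne by (simp add: card_gt_0_iff)

lemma lik_pos: "lik \<theta> n \<omega> > 0" by (simp add: lik_def)

lemma mix_lik_pos: "mix_lik n \<omega> > 0"
  unfolding mix_lik_def using fin ne card_pos by (intro divide_pos_pos sum_pos lik_pos) auto

lemma lik_measurable_F: "lik \<theta> n \<in> borel_measurable (F n)"
proof -
  note walk_measurable_F[OF order_refl, of n, measurable]
  show ?thesis unfolding lik_def by measurable
qed

lemma mix_lik_measurable_F: "mix_lik n \<in> borel_measurable (F n)"
  unfolding mix_lik_def using lik_measurable_F by (intro borel_measurable_divide borel_measurable_sum) auto

lemma lik_measurable [measurable]: "lik \<theta> n \<in> borel_measurable M"
  and mix_lik_measurable [measurable]: "mix_lik n \<in> borel_measurable M"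
  by (rule measurable_from_subalg[OF subalg_F lik_measurable_F]
        measurable_from_subalg[OF subalg_F mix_lik_measurable_F])+

lemma nn_integral_mixture_F:
  assumes h: "h \<in> borel_measurable (F n)"
  shows "(\<integral>\<^sup>+\<omega>. h \<omega> \<partial>mixture M \<Theta> Q) = (\<integral>\<^sup>+\<omega>. ennreal (mix_lik n \<omega>) * h \<omega> \<partial>M)"
proof -
  have hM [measurable]: "h \<in> borel_measurable M" by (rule measurable_from_subalg[OF subalg_F h])
  have "(\<integral>\<^sup>+\<omega>. h \<omega> \<partial>mixture M \<Theta> Q) = (\<Sum>\<theta>\<in>\<Theta>. \<integral>\<^sup>+\<omega>. h \<omega> \<partial>Q \<theta>) / of_nat (card \<Theta>)"
    using tilted by (intro nn_integral_mixture hM) (auto simp: tilted_measure_def)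
  also have "(\<Sum>\<theta>\<in>\<Theta>. \<integral>\<^sup>+\<omega>. h \<omega> \<partial>Q \<theta>) = (\<Sum>\<theta>\<in>\<Theta>. \<integral>\<^sup>+\<omega>. ennreal (lik \<theta> n \<omega>) * h \<omega> \<partial>M)"
    unfolding lik_def by (intro sum.cong refl nn_integral_tilted[OF tilted h])
  also have "\<dots> = (\<integral>\<^sup>+\<omega>. (\<Sum>\<theta>\<in>\<Theta>. ennreal (lik \<theta> n \<omega>)) * h \<omega> \<partial>M)"
    by (subst nn_integral_sum[symmetric]) (auto simp: sum_distrib_right)
  also have "(\<integral>\<^sup>+\<omega>. (\<Sum>\<theta>\<in>\<Theta>. ennreal (lik \<theta> n \<omega>)) * h \<omega> \<partial>M) / of_nat (card \<Theta>)
      = (\<integral>\<^sup>+\<omega>. (\<Sum>\<theta>\<in>\<Theta>. ennreal (lik \<theta> n \<omega>)) * h \<omega> / of_nat (card \<Theta>) \<partial>M)"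
    by (rule nn_integral_divide[symmetric]) measurable
  also have "\<dots> = (\<integral>\<^sup>+\<omega>. ennreal (mix_lik n \<omega>) * h \<omega> \<partial>M)"
  proof (rule nn_integral_cong)
    fix \<omega>
    have "ennreal (mix_lik n \<omega>) = (\<Sum>\<theta>\<in>\<Theta>. ennreal (lik \<theta> n \<omega>)) / of_nat (card \<Theta>)"
      unfolding mix_lik_def using card_pos
      by (subst divide_ennreal[symmetric])
         (auto intro!: sum_nonneg less_imp_le[OF lik_pos] simp: ennreal_of_nat_eq_real_of_nat less_imp_le[OF lik_pos])
    then show "(\<Sum>\<theta>\<in>\<Theta>. ennreal (lik \<theta> n \<omega>)) * h \<omega> / of_nat (card \<Theta>) = ennreal (mix_lik n \<omega>) * h \<omega>"
      by (simp add: divide_ennreal_def mult_ac)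
  qed
  finally show ?thesis .
qed

lemma is_weight_stop:
  assumes "\<omega> \<in> stop_event b n"
  shows "is_weight M X W J \<Theta> b \<omega> = inverse (mix_lik n \<omega>)"
  using assms by (simp add: stop_event_def is_weight_def lik_ratio_def mix_lik_def lik_def)

lemma is_weight_no_stop:
  assumes "\<omega> \<in> space M" "\<omega> \<notin> rare_event M X W J b"
  shows "is_weight M X W J \<Theta> b \<omega> = 0"
  using assms by (auto simp: rare_event_def is_weight_def)

text \<open>At most one of the disjoint events occurs, so the series has at most one nonzero term;
  \<open>g 0 = 0\<close> covers the complement of the rare event.\<close>

lemma weight_suminf:
  assumes "\<omega> \<in> space M" "g 0 = 0"
  shows "(g (is_weight M X W J \<Theta> b \<omega>) :: ennreal)
    = (\<Sum>n. g (inverse (mix_lik n \<omega>)) * indicator (stop_event b n) \<omega>)"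
proof (cases "\<omega> \<in> rare_event M X W J b")
  case True
  then obtain n where n: "\<omega> \<in> stop_event b n" by (auto simp: rare_event_eq)
  then show ?thesis using suminf_cmult_indicator[OF disjoint_stop_event n] is_weight_stop[OF n] by simp
next
  case False
  then have "\<omega> \<notin> stop_event b n" for n by (auto simp: rare_event_eq)
  then show ?thesis using is_weight_no_stop[OF assms(1) False] assms(2) by simp
qed

text \<open>Passing from the mixture to \<open>M\<close> brings in the factor
  \<open>mix_lik n\<close>, which cancels one of the two inverse factors.\<close>

lemma second_moment_suminf:
  assumes b: "b > 0"
  shows "second_moment M X W J \<Theta> Q b
    = (\<Sum>n. \<integral>\<^sup>+\<omega>. ennreal (inverse (mix_lik n \<omega>)) * indicator (stop_event b n) \<omega> \<partial>M)"
proof -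
  define h where "h = (\<lambda>n \<omega>. ennreal ((inverse (mix_lik n \<omega>))\<^sup>2) * indicator (stop_event b n) \<omega>)"
  have h: "h n \<in> borel_measurable (F n)" for n
  proof -
    note mix_lik_measurable_F[measurable] stop_event_F[OF b, measurable]
    show ?thesis unfolding h_def by measurable
  qed
  then have hM: "h n \<in> borel_measurable M" for n by (rule measurable_from_subalg[OF subalg_F])
  have "second_moment M X W J \<Theta> Q b = (\<integral>\<^sup>+\<omega>. (\<Sum>n. h n \<omega>) \<partial>mixture M \<Theta> Q)"
    unfolding second_moment_def h_def
    by (intro nn_integral_cong weight_suminf[where g = "\<lambda>x. ennreal (x\<^sup>2)"]) auto
  also have "\<dots> = (\<Sum>n. \<integral>\<^sup>+\<omega>. h n \<omega> \<partial>mixture M \<Theta> Q)"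
    using hM by (intro nn_integral_suminf) (simp add: measurable_cong_sets[OF sets_mixture refl])
  also have "\<dots> = (\<Sum>n. \<integral>\<^sup>+\<omega>. ennreal (inverse (mix_lik n \<omega>)) * indicator (stop_event b n) \<omega> \<partial>M)"
  proof (intro suminf_cong)
    fix n
    have "ennreal (mix_lik n \<omega>) * h n \<omega> = ennreal (inverse (mix_lik n \<omega>)) * indicator (stop_event b n) \<omega>" for \<omega>
    proof -
      have "mix_lik n \<omega> * (inverse (mix_lik n \<omega>))\<^sup>2 = inverse (mix_lik n \<omega>)"
        using mix_lik_pos[of n \<omega>] by (simp add: power2_eq_square)
      then have "ennreal (mix_lik n \<omega>) * ennreal ((inverse (mix_lik n \<omega>))\<^sup>2) = ennreal (inverse (mix_lik n \<omega>))"
        using mix_lik_pos[of n \<omega>] by (simp flip: ennreal_mult')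
      then show ?thesis by (simp add: h_def flip: mult.assoc)
    qed
    then show "(\<integral>\<^sup>+\<omega>. h n \<omega> \<partial>mixture M \<Theta> Q)
        = (\<integral>\<^sup>+\<omega>. ennreal (inverse (mix_lik n \<omega>)) * indicator (stop_event b n) \<omega> \<partial>M)"
      by (simp add: nn_integral_mixture_F[OF h])
  qed
  finally show ?thesis .
qed

lemma stopped_likelihood_le_1:
  assumes "\<theta> \<in> eff_dom (log_mgf M (X 1))" and b: "b > 0"
  shows "(\<Sum>n. \<integral>\<^sup>+\<omega>. ennreal (lik \<theta> n \<omega>) * indicator (stop_event b n) \<omega> \<partial>M) \<le> 1"
  unfolding lik_def tilt_walk_prod
  using law.log_mgf_real(2)[of \<theta>] assms stop_event_F[OF b] disjoint_stop_event
  by (intro optional_stopping) (auto simp: log_mgf_law simp del: One_nat_def)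

text \<open>Keep a single term of the mixture: when \<open>W j\<close> is hit, the inverse
  likelihood of \<open>\<gamma> j\<close> is at most \<open>exp (- R * b)\<close> times the
  likelihood of \<open>\<alpha> j - \<gamma> j\<close>, whose stopped mean is at most 1. Summing
  over all \<open>j\<close> avoids deciding which set is hit and costs the factor
  \<open>J\<close>.\<close>

lemma second_moment_upper:
  assumes b: "b > 0"
    and dual: "\<And>j. j \<in> {1..J} \<Longrightarrow> \<exists>\<gamma>\<in>\<Theta>. \<exists>\<alpha>. log_mgf M (X 1) (\<alpha> - \<gamma>) \<le> ereal (- real_of_ereal (log_mgf M (X 1) \<gamma>))
        \<and> (\<forall>y\<in>W j. R \<le> \<alpha> \<bullet> y)"
  shows "second_moment M X W J \<Theta> Q b \<le> ennreal (real J * real (card \<Theta>) * exp (- R * b))"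
proof -
  let ?L = "log_mgf M (X 1)"
  obtain \<gamma> \<alpha> where ga: "\<And>j. j \<in> {1..J} \<Longrightarrow> \<gamma> j \<in> \<Theta> \<and> ?L (\<alpha> j - \<gamma> j) \<le> ereal (- real_of_ereal (?L (\<gamma> j)))
        \<and> (\<forall>y\<in>W j. R \<le> \<alpha> j \<bullet> y)"
    using dual by metis
  define \<theta> where "\<theta> = (\<lambda>j. \<alpha> j - \<gamma> j)"
  have \<theta>: "\<theta> j \<in> eff_dom ?L" if "j \<in> {1..J}" for j
    using ga[OF that] by (auto simp: \<theta>_def eff_dom_def)
  define C where "C = real (card \<Theta>) * exp (- R * b)"
  have C: "C \<ge> 0" by (simp add: C_def)
  have pw: "inverse (mix_lik n \<omega>) \<le> (\<Sum>j=1..J. C * lik (\<theta> j) n \<omega>)" if \<omega>: "\<omega> \<in> stop_event b n" for n \<omega>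
  proof -
    obtain j where j: "j \<in> {1..J}" "walk X n \<omega> \<in> (\<lambda>x. b *\<^sub>R x) ` W j"
      using stop_event_hit[OF \<omega>] .
    then obtain y where y: "y \<in> W j" "walk X n \<omega> = b *\<^sub>R y" by auto
    have "b * R \<le> b * (\<alpha> j \<bullet> y)" using ga[OF j(1)] y b by (intro mult_left_mono) auto
    then have ay: "R * b \<le> \<alpha> j \<bullet> walk X n \<omega>" by (simp add: y(2) mult.commute)
    \<comment> \<open>The dual constraint gives the terms proportional to \<open>n\<close> the right
      sign, so the bound does not depend on the hitting time.\<close>
    have "real_of_ereal (?L (\<theta> j)) \<le> - real_of_ereal (?L (\<gamma> j))"
      using ga[OF j(1)] law.log_mgf_real(1)[of "\<theta> j"] \<theta>[OF j(1)] unfolding log_mgf_law \<theta>_def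
      by (metis ereal_less_eq(3))
    then have "real n * real_of_ereal (?L (\<theta> j)) \<le> real n * - real_of_ereal (?L (\<gamma> j))"
      by (intro mult_left_mono) auto
    then have "exp (- (\<gamma> j \<bullet> walk X n \<omega> - real n * real_of_ereal (?L (\<gamma> j))))
        \<le> exp (- R * b + (\<theta> j \<bullet> walk X n \<omega> - real n * real_of_ereal (?L (\<theta> j))))"
      using ay by (simp add: \<theta>_def inner_diff_left)
    then have inv: "inverse (lik (\<gamma> j) n \<omega>) \<le> exp (- R * b) * lik (\<theta> j) n \<omega>"
      by (simp only: lik_def exp_minus[symmetric] exp_add[symmetric] exp_le_cancel_iff)
    have "lik (\<gamma> j) n \<omega> \<le> (\<Sum>\<theta>\<in>\<Theta>. lik \<theta> n \<omega>)"
      using ga[OF j(1)] fin lik_pos by (intro member_le_sum) (auto simp: less_imp_le)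
    then have "lik (\<gamma> j) n \<omega> / real (card \<Theta>) \<le> mix_lik n \<omega>"
      unfolding mix_lik_def using card_pos by (intro divide_right_mono) auto
    then have "inverse (mix_lik n \<omega>) \<le> inverse (lik (\<gamma> j) n \<omega> / real (card \<Theta>))"
      using card_pos lik_pos by (intro le_imp_inverse_le divide_pos_pos) auto
    also have "\<dots> = real (card \<Theta>) * inverse (lik (\<gamma> j) n \<omega>)" by (simp add: field_simps)
    also have "\<dots> \<le> real (card \<Theta>) * (exp (- R * b) * lik (\<theta> j) n \<omega>)"
      using inv by (intro mult_left_mono) auto
    also have "\<dots> = C * lik (\<theta> j) n \<omega>" by (simp add: C_def)
    also have "\<dots> \<le> (\<Sum>j=1..J. C * lik (\<theta> j) n \<omega>)"
      using j(1) C lik_pos by (intro member_le_sum) (auto simp: less_imp_le)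
    finally show ?thesis .
  qed
  note stop_event_sets[OF b, measurable]
  have "second_moment M X W J \<Theta> Q b
      \<le> (\<Sum>n. \<integral>\<^sup>+\<omega>. (\<Sum>j=1..J. ennreal C * (ennreal (lik (\<theta> j) n \<omega>) * indicator (stop_event b n) \<omega>)) \<partial>M)"
    unfolding second_moment_suminf[OF b]
  proof (intro suminf_le nn_integral_mono)
    fix n \<omega>
    show "ennreal (inverse (mix_lik n \<omega>)) * indicator (stop_event b n) \<omega>
        \<le> (\<Sum>j=1..J. ennreal C * (ennreal (lik (\<theta> j) n \<omega>) * indicator (stop_event b n) \<omega>))"
    proof (cases "\<omega> \<in> stop_event b n")
      case True
      have "ennreal (inverse (mix_lik n \<omega>)) \<le> ennreal (\<Sum>j=1..J. C * lik (\<theta> j) n \<omega>)"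
        using pw[OF True] by (rule ennreal_leI)
      also have "\<dots> = (\<Sum>j=1..J. ennreal C * ennreal (lik (\<theta> j) n \<omega>))"
        using C lik_pos by (subst sum_ennreal[symmetric]) (auto simp: less_imp_le ennreal_mult)
      finally show ?thesis using True by simp
    qed simp
  qed auto
  also have "\<dots> = (\<Sum>j=1..J. ennreal C * (\<Sum>n. \<integral>\<^sup>+\<omega>. ennreal (lik (\<theta> j) n \<omega>) * indicator (stop_event b n) \<omega> \<partial>M))"
    by (simp add: nn_integral_sum nn_integral_cmult suminf_sum)
  also have "\<dots> \<le> (\<Sum>j=1..J. ennreal C * 1)"
    using \<theta> b by (intro sum_mono mult_left_mono stopped_likelihood_le_1) auto
  also have "\<dots> = ennreal (real J * real (card \<Theta>) * exp (- R * b))"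
    by (simp add: C_def ennreal_of_nat_eq_real_of_nat mult.assoc flip: ennreal_mult')
  finally show ?thesis .
qed

text \<open>Cauchy-Schwarz for the square roots of the weight and of its inverse, whose product is
  the indicator of the rare event. The inverse integrates to the probability of that event under the
  mixture, which is at most 1.\<close>

lemma second_moment_lower:
  assumes b: "b > 0"
  shows "ennreal ((prob (rare_event M X W J b))\<^sup>2) \<le> second_moment M X W J \<Theta> Q b"
proof -
  note stop_event_sets[OF b, measurable] rare_event_sets[OF b, measurable]
  define f where "f = (\<lambda>\<omega>. \<Sum>n. ennreal (sqrt (inverse (mix_lik n \<omega>))) * indicator (stop_event b n) \<omega>)"
  define g where "g = (\<lambda>\<omega>. \<Sum>n. ennreal (sqrt (mix_lik n \<omega>)) * indicator (stop_event b n) \<omega>)"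
  have [measurable]: "f \<in> borel_measurable M" "g \<in> borel_measurable M"
    unfolding f_def g_def by measurable
  have on: "f \<omega> = ennreal (sqrt (inverse (mix_lik n \<omega>)))" "g \<omega> = ennreal (sqrt (mix_lik n \<omega>))"
    if n: "\<omega> \<in> stop_event b n" for n \<omega>
    unfolding f_def g_def using suminf_cmult_indicator[OF disjoint_stop_event n] by simp_all
  have off: "f \<omega> = 0" "g \<omega> = 0" if "\<omega> \<notin> rare_event M X W J b" for \<omega>
    using that by (auto simp: f_def g_def rare_event_eq)
  have fg: "f \<omega> * g \<omega> = indicator (rare_event M X W J b) \<omega>" for \<omega>
  proof (cases "\<omega> \<in> rare_event M X W J b")
    case True
    then obtain n where n: "\<omega> \<in> stop_event b n" by (auto simp: rare_event_eq)
    have "sqrt (inverse (mix_lik n \<omega>)) * sqrt (mix_lik n \<omega>) = 1"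
      using mix_lik_pos[of n \<omega>] by (simp add: real_sqrt_inverse)
    then show ?thesis using True mix_lik_pos[of n \<omega>] by (simp add: on[OF n] flip: ennreal_mult')
  qed (simp add: off)
  have sq: "(f \<omega>)\<^sup>2 = (\<Sum>n. ennreal (inverse (mix_lik n \<omega>)) * indicator (stop_event b n) \<omega>)"
    "(g \<omega>)\<^sup>2 = (\<Sum>n. ennreal (mix_lik n \<omega>) * indicator (stop_event b n) \<omega>)" for \<omega>
  proof -
    have "(f \<omega>)\<^sup>2 = (\<Sum>n. ennreal (inverse (mix_lik n \<omega>)) * indicator (stop_event b n) \<omega>) \<and>
    (g \<omega>)\<^sup>2 = (\<Sum>n. ennreal (mix_lik n \<omega>) * indicator (stop_event b n) \<omega>)"
    proof (cases "\<omega> \<in> rare_event M X W J b")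
      case True
      then obtain n where n: "\<omega> \<in> stop_event b n" by (auto simp: rare_event_eq)
      show ?thesis using mix_lik_pos[of n \<omega>]
        by (simp add: on[OF n] suminf_cmult_indicator[OF disjoint_stop_event n] ennreal_power)
    next
      case False
      then have "\<omega> \<notin> stop_event b n" for n by (auto simp: rare_event_eq)
      then show ?thesis by (simp add: off[OF False])
    qed
    then show "(f \<omega>)\<^sup>2 = (\<Sum>n. ennreal (inverse (mix_lik n \<omega>)) * indicator (stop_event b n) \<omega>)"
    "(g \<omega>)\<^sup>2 = (\<Sum>n. ennreal (mix_lik n \<omega>) * indicator (stop_event b n) \<omega>)" by auto
  qed
  have "(\<integral>\<^sup>+\<omega>. (g \<omega>)\<^sup>2 \<partial>M) = (\<Sum>n. \<integral>\<^sup>+\<omega>. ennreal (mix_lik n \<omega>) * indicator (stop_event b n) \<omega> \<partial>M)"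
    unfolding sq by (rule nn_integral_suminf) measurable
  also have "\<dots> = (\<Sum>n. \<integral>\<^sup>+\<omega>. indicator (stop_event b n) \<omega> \<partial>mixture M \<Theta> Q)"
    using stop_event_F[OF b] by (intro suminf_cong nn_integral_mixture_F[symmetric] borel_measurable_indicator)
  also have "\<dots> = (\<integral>\<^sup>+\<omega>. (\<Sum>n. indicator (stop_event b n) \<omega>) \<partial>mixture M \<Theta> Q)"
    by (rule nn_integral_suminf[symmetric]) measurable
  also have "\<dots> \<le> (\<integral>\<^sup>+\<omega>. 1 \<partial>mixture M \<Theta> Q)"
  proof (rule nn_integral_mono)
    fix \<omega> show "(\<Sum>n. indicator (stop_event b n) \<omega> :: ennreal) \<le> 1"
      unfolding suminf_indicator[OF disjoint_stop_event] by (simp add: indicator_def)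
  qed
  \<comment> \<open>Constants are measurable for \<open>F 0\<close>, where \<open>mix_lik\<close>
    equals 1, so the mixture has total mass 1.\<close>
  also have "\<dots> = 1"
    using nn_integral_mixture_F[of "\<lambda>_. 1" 0] card_pos
    by (simp add: mix_lik_def lik_def walk_def emeasure_space_1)
  finally have g1: "(\<integral>\<^sup>+\<omega>. (g \<omega>)\<^sup>2 \<partial>M) \<le> 1" .
  have "ennreal ((prob (rare_event M X W J b))\<^sup>2) = (\<integral>\<^sup>+\<omega>. f \<omega> * g \<omega> \<partial>M)\<^sup>2"
    unfolding fg by (simp add: emeasure_eq_measure ennreal_power)
  also have "\<dots> \<le> (\<integral>\<^sup>+\<omega>. (f \<omega>)\<^sup>2 \<partial>M) * (\<integral>\<^sup>+\<omega>. (g \<omega>)\<^sup>2 \<partial>M)"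
    by (rule Cauchy_Schwarz_nn_integral) measurable
  also have "\<dots> \<le> (\<integral>\<^sup>+\<omega>. (f \<omega>)\<^sup>2 \<partial>M) * 1" using g1 by (intro mult_left_mono) auto
  also have "\<dots> = second_moment M X W J \<Theta> Q b"
    unfolding sq second_moment_suminf[OF b] by (subst nn_integral_suminf) auto
  finally show ?thesis .
qed

end

section \<open>Asymptotic efficiency\<close>

text \<open>A squeeze: the lower bound on \<open>p\<close> together with
  \<open>(p b)\<^sup>2 \<le> s b\<close> bounds both rates from below, and the upper bound on
  \<open>s\<close> bounds both from above.\<close>

lemma exponential_rates:
  fixes p s :: "real \<Rightarrow> real"
  assumes K: "K > 0"
    and ps: "\<forall>\<^sub>F b in at_top. (p b)\<^sup>2 \<le> s b"
    and up: "\<forall>\<^sub>F b in at_top. s b \<le> K * exp (- (2 * r) * b)"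
    and low: "\<And>\<epsilon>. \<epsilon> > 0 \<Longrightarrow> \<forall>\<^sub>F b in at_top. 1 / 2 * exp (- (r + \<epsilon>) * b) \<le> p b"
  shows "((\<lambda>b. 1 / b * ln (p b)) \<longlongrightarrow> - r) at_top"
    and "((\<lambda>b. 1 / b * ln (s b)) \<longlongrightarrow> - (2 * r)) at_top"
    and "\<forall>\<^sub>F b in at_top. 0 < p b"
proof -
  have pos: "\<forall>\<^sub>F b in at_top. 0 < p b"
    using low[of 1, OF zero_less_one]
  proof eventually_elim
    case (elim b)
    have "0 < 1 / 2 * exp (- (r + 1) * b)" by simp
    then show ?case using elim by linarith
  qed
  then show "\<forall>\<^sub>F b in at_top. 0 < p b" .
  have sq: "\<forall>\<^sub>F b in at_top. 2 * (1 / b * ln (p b)) \<le> 1 / b * ln (s b)"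
    using ps pos eventually_gt_at_top[of 0]
  proof eventually_elim
    case (elim b)
    have "ln ((p b)\<^sup>2) \<le> ln (s b)" using elim by (subst ln_le_cancel_iff) (auto intro: less_le_trans[of _ "(p b)\<^sup>2"])
    then have "2 * ln (p b) \<le> ln (s b)" using elim by (simp add: ln_realpow)
    then show ?case using elim by (simp add: divide_right_mono)
  qed
  have upl: "\<forall>\<^sub>F b in at_top. 1 / b * ln (s b) \<le> ln K / b - 2 * r"
    using ps pos up eventually_gt_at_top[of 0]
  proof eventually_elim
    case (elim b)
    have "s b > 0" using elim by (auto intro: less_le_trans[of _ "(p b)\<^sup>2"])
    then have "ln (s b) \<le> ln (K * exp (- (2 * r) * b))" using elim K by (subst ln_le_cancel_iff) auto
    also have "\<dots> = ln K - 2 * r * b" using K by (simp add: ln_mult)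
    finally have "1 / b * ln (s b) \<le> 1 / b * (ln K - 2 * r * b)"
      using elim by (intro mult_left_mono) auto
    then show ?case using elim by (simp add: field_simps)
  qed
  have lowl: "\<forall>\<^sub>F b in at_top. - r - e < 1 / b * ln (p b)" if e: "e > 0" for e
  proof -
    \<comment> \<open>Half of \<open>e\<close> absorbs the prefactor \<open>1 / 2\<close>, the other
      half the loss in the exponent.\<close>
    have "\<forall>\<^sub>F b in at_top. ln 2 / b < e / 2"
      using e by real_asymp
    moreover have "\<forall>\<^sub>F b in at_top. 1 / 2 * exp (- (r + e / 2) * b) \<le> p b"
      by (rule low) (use e in simp)
    ultimately show ?thesis using eventually_gt_at_top[of 0]
    proof eventually_elim
      case (elim b)
      have "ln (1 / 2 * exp (- (r + e / 2) * b)) \<le> ln (p b)"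
        using elim by (subst ln_le_cancel_iff) (auto intro: less_le_trans[of _ "1 / 2 * exp (- (r + e / 2) * b)"])
      then have "- ln 2 - (r + e / 2) * b \<le> ln (p b)" by (simp add: ln_mult ln_div algebra_simps)
      then have "1 / b * (- ln 2 - (r + e / 2) * b) \<le> 1 / b * ln (p b)"
        using elim by (intro mult_left_mono) auto
      moreover have "1 / b * (- ln 2 - (r + e / 2) * b) = - (ln 2 / b) - (r + e / 2)"
        using elim by (simp add: field_simps)
      ultimately have "- (ln 2 / b) - (r + e / 2) \<le> 1 / b * ln (p b)" by (simp only:)
      moreover have "- r - e < - (ln 2 / b) - (r + e / 2)" using \<open>ln 2 / b < e / 2\<close> by linarith
      ultimately show ?case by (rule less_le_trans[rotated])
    qed
  qed
  have up2: "\<forall>\<^sub>F b in at_top. 1 / b * ln (s b) < - (2 * r) + e" if e: "e > 0" for e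
  proof -
    have "\<forall>\<^sub>F b in at_top. ln K / b < e" using e by real_asymp
    with upl show ?thesis by eventually_elim linarith
  qed
  show "((\<lambda>b. 1 / b * ln (p b)) \<longlongrightarrow> - r) at_top"
  proof (rule order_tendstoI)
    fix a assume "a < - r"
    from lowl[of "- r - a"] this show "\<forall>\<^sub>F b in at_top. a < 1 / b * ln (p b)" by simp
  next
    fix a assume a: "- r < a"
    then have "2 * (a + r) > 0" by simp
    from up2[OF this] sq show "\<forall>\<^sub>F b in at_top. 1 / b * ln (p b) < a"
      by eventually_elim (simp add: algebra_simps)
  qed
  show "((\<lambda>b. 1 / b * ln (s b)) \<longlongrightarrow> - (2 * r)) at_top"
  proof (rule order_tendstoI)
    fix a assume "a < - (2 * r)"
    then have "(- (2 * r) - a) / 2 > 0" by simp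
    from lowl[OF this] sq show "\<forall>\<^sub>F b in at_top. a < 1 / b * ln (s b)"
      by eventually_elim (simp add: field_simps)
  next
    fix a assume "- (2 * r) < a"
    from up2[of "a + 2 * r"] this show "\<forall>\<^sub>F b in at_top. 1 / b * ln (s b) < a" by simp
  qed
qed

lemma log_ennreal_ennreal: "x > 0 \<Longrightarrow> log_ennreal (ennreal x) = ereal (ln x)"
  by (simp add: log_ennreal_def)

theorem theorem3p4:
  fixes M :: "'a measure"
    and X :: "nat \<Rightarrow> 'a \<Rightarrow> 'd::euclidean_space"
    and W :: "nat \<Rightarrow> 'd set"
    and J :: nat
    and \<C> :: "nat set"
    and \<Theta> :: "'d set"
    and \<beta> :: "nat \<Rightarrow> 'd"
    and Q :: "'d \<Rightarrow> 'a measure"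
  assumes "prob_space M"
    and indep: "prob_space.indep_vars M (\<lambda>_. borel) X {1..}"
    and ident: "\<And>i. i \<ge> 1 \<Longrightarrow> distr M borel (X i) = distr M borel (X 1)"
    and W_open: "\<And>j. j \<in> {0..J} \<Longrightarrow> open (W j)"
    and W_convex: "\<And>j. j \<in> {1..J} \<Longrightarrow> convex (W j)"
    and C1: "\<exists>\<delta>>0. \<forall>j\<in>{1..J}.
               pos_cone (ball (prob_space.expectation M (X 1)) \<delta>) \<inter> W j = {}"
    and C2a: "open (eff_dom (log_mgf M (X 1)))"
    and C2b: "\<And>j. j \<in> {1..J} \<Longrightarrow>
               interior (pos_cone (eff_dom (legendre (log_mgf M (X 1))))) \<inter> W j \<noteq> {}"
    and C3a: "\<And>j j'. \<lbrakk>j \<in> {0..J}; j' \<in> {0..J}; j \<noteq> j'\<rbrakk> \<Longrightarrow>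
               pos_cone (W j) \<inter> pos_cone (W j') = {}"
    and C3b: "\<exists>\<delta>>0. \<forall>j\<in>{0..J}. ball 0 \<delta> \<inter> W j = {}"
    and C_sub: "\<C> \<subseteq> {1..J}" and C_ne: "\<C> \<noteq> {}"
    and Theta: "finite \<Theta>" "\<Theta> \<subseteq> eff_dom (log_mgf M (X 1))"
    and tilted: "\<And>\<theta>. \<theta> \<in> \<Theta> \<Longrightarrow> tilted_measure M X \<theta> (Q \<theta>)"
    and beta: "\<And>j. j \<in> \<C> \<Longrightarrow> optimal_tilting (log_mgf M (X 1)) (W j) (\<beta> j)"
    and beta_Theta: "\<beta> ` \<C> \<subseteq> \<Theta>"
    and gamma: "\<And>j. j \<in> {1..J} - \<C> \<Longrightarrow>
               \<exists>\<gamma>\<in>\<Theta>. tilt_v (log_mgf M (X 1)) \<gamma> (W j)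
                      \<ge> 2 * (MIN i\<in>\<C>. set_rate (log_mgf M (X 1)) (W i))"
  shows "(MIN j\<in>{1..J}. set_rate (log_mgf M (X 1)) (W j))
           = (MIN j\<in>\<C>. set_rate (log_mgf M (X 1)) (W j))
       \<and> asymptotically_efficient M X W J \<Theta> Q
       \<and> ((\<lambda>b. ereal (1 / b) * log_ennreal (second_moment M X W J \<Theta> Q b)) \<longlongrightarrow>
            - (2 * (MIN j\<in>{1..J}. set_rate (log_mgf M (X 1)) (W j)))) at_top
       \<and> ((\<lambda>b. ereal (1 / b) * log_ennreal (emeasure M (rare_event M X W J b))) \<longlongrightarrow>
            - (MIN j\<in>{1..J}. set_rate (log_mgf M (X 1)) (W j))) at_top"
proof -
  interpret prob_space M by fact
  interpret iid_walk M X by unfold_locales (fact indep, fact ident)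
  let ?L = "log_mgf M (X 1)"
  have "J \<ge> 1" using C_sub C_ne by auto
  have Th_ne: "\<Theta> \<noteq> {}" using beta_Theta C_ne by blast
  interpret mixture_sampling M X W J \<Theta> Q
    by unfold_locales (use \<open>J \<ge> 1\<close> W_open Theta Th_ne tilted in auto)
  obtain \<delta>1 where \<delta>1: "\<delta>1 > 0" "\<And>j. j \<in> {1..J} \<Longrightarrow> pos_cone (ball (expectation (X 1)) \<delta>1) \<inter> W j = {}"
    using C1 by blast
  obtain \<delta>0 where \<delta>0: "\<delta>0 > 0" "\<And>j. j \<in> {0..J} \<Longrightarrow> ball 0 \<delta>0 \<inter> W j = {}"
    using C3b by blast
  have W_ne: "W j \<noteq> {}" if "j \<in> {1..J}" for j using C2b[OF that] by auto
  have mean: "(\<integral>x. x \<partial>distr M borel (X 1)) = expectation (X 1)"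
    by (subst integral_distr) auto
  have rate_pos: "set_rate ?L (W j) > 0" if j: "j \<in> {1..J}" for j
    using law.set_rate_pos[of "W j" \<delta>1 \<delta>0] C2a W_convex[OF j] W_ne[OF j] \<delta>1(1) \<delta>1(2)[OF j] \<delta>0(1) \<delta>0(2)[of j] j
    unfolding log_mgf_law mean by simp
  have finC: "finite \<C>" using C_sub finite_subset by blast
  have "(MIN j\<in>\<C>. set_rate ?L (W j)) \<in> (\<lambda>j. set_rate ?L (W j)) ` \<C>"
    using finC C_ne by (intro Min_in) auto
  then obtain j0 where j0: "j0 \<in> \<C>" "(MIN j\<in>\<C>. set_rate ?L (W j)) = set_rate ?L (W j0)" by auto
  have j0': "j0 \<in> {1..J}" using j0 C_sub by auto
  obtain y0 where y0: "y0 \<in> W j0" using W_ne[OF j0'] by blast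
  \<comment> \<open>The optimal tilting caps the rate at any point of \<open>W j0\<close>, so the
    minimum over \<C> is a positive real number.\<close>
  have "set_rate ?L (W j0) \<le> ereal (\<beta> j0 \<bullet> y0)"
    using beta[OF j0(1)] y0 by (auto simp: optimal_tilting_def)
  then obtain r where r: "set_rate ?L (W j0) = ereal r" "r > 0"
    using rate_pos[OF j0'] by (cases "set_rate ?L (W j0)") auto
  have minC: "(MIN j\<in>\<C>. set_rate ?L (W j)) = ereal r" using j0(2) r by simp
  have C_ge: "ereal r \<le> set_rate ?L (W j)" if "j \<in> \<C>" for j
    unfolding minC[symmetric] using finC that by (intro Min_le) auto
  \<comment> \<open>This feeds both the second moment bound and, through halving \<alpha>, the
    comparison of the rates.\<close>
  have dual: "\<exists>\<gamma>\<in>\<Theta>. \<exists>\<alpha>. ?L (\<alpha> - \<gamma>) \<le> ereal (- real_of_ereal (?L \<gamma>)) \<and> (\<forall>y\<in>W j. 2 * r \<le> \<alpha> \<bullet> y)"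
    if j: "j \<in> {1..J}" for j
  proof (cases "j \<in> \<C>")
    case True
    have L0: "?L (\<beta> j) = 0" using beta[OF True] by (simp add: optimal_tilting_def)
    have ge: "r \<le> \<beta> j \<bullet> y" if "y \<in> W j" for y
    proof -
      have "ereal r \<le> ereal (\<beta> j \<bullet> y)"
        using order_trans[OF C_ge[OF True], of "ereal (\<beta> j \<bullet> y)"] beta[OF True] that
        by (auto simp: optimal_tilting_def)
      then show ?thesis by simp
    qed
    \<comment> \<open>The shifted vector is again \<open>\<beta> j\<close>, where \<Lambda>
      vanishes, so doubling remains admissible.\<close>
    have "2 *\<^sub>R \<beta> j - \<beta> j = \<beta> j" by (simp add: scaleR_2)
    then have "?L (2 *\<^sub>R \<beta> j - \<beta> j) \<le> ereal (- real_of_ereal (?L (\<beta> j)))"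
      by (simp only: L0) (simp add: zero_ereal_def)
    moreover have "\<forall>y\<in>W j. 2 * r \<le> (2 *\<^sub>R \<beta> j) \<bullet> y" using ge by simp
    moreover have "\<beta> j \<in> \<Theta>" using beta_Theta True by auto
    ultimately show ?thesis by blast
  next
    case False
    then obtain \<gamma> where \<gamma>: "\<gamma> \<in> \<Theta>" "tilt_v ?L \<gamma> (W j) \<ge> 2 * ereal r"
      using gamma[of j] j unfolding minC by auto
    have "\<exists>\<alpha>. ?L (\<alpha> - \<gamma>) \<le> ereal (- real_of_ereal (?L \<gamma>)) \<and> (\<forall>y\<in>W j. 2 * r \<le> \<alpha> \<bullet> y)"
      using law.dual_of_tilt_v[of \<gamma> "W j" "2 * r"] \<gamma> Theta(2) W_convex[OF j] W_ne[OF j] C2b[OF j]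
      unfolding log_mgf_law by auto
    then show ?thesis using \<gamma>(1) by blast
  qed
  \<comment> \<open>Half of the dual vector is feasible for \<open>rate_I\<close>, so sets outside
    \<C> cannot have a smaller rate.\<close>
  have all_ge: "ereal r \<le> set_rate ?L (W j)" if j: "j \<in> {1..J}" for j
  proof -
    obtain \<gamma> \<alpha> where ga: "\<gamma> \<in> \<Theta>" "?L (\<alpha> - \<gamma>) \<le> ereal (- real_of_ereal (?L \<gamma>))"
      "\<And>y. y \<in> W j \<Longrightarrow> 2 * r \<le> \<alpha> \<bullet> y" using dual[OF j] by blast
    have "?L ((1 / 2) *\<^sub>R \<alpha>) \<le> 0"
      using law.log_mgf_midpoint_nonpos[of \<gamma> \<alpha>] ga(1,2) Theta(2) unfolding log_mgf_law by auto
    moreover have "r \<le> ((1 / 2) *\<^sub>R \<alpha>) \<bullet> y" if "y \<in> W j" for y using ga(3)[OF that] by simp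
    ultimately show ?thesis by (intro law.set_rate_geI[unfolded log_mgf_law]) blast
  qed
  have minJ: "(MIN j\<in>{1..J}. set_rate ?L (W j)) = ereal r"
  proof (rule antisym)
    show "(MIN j\<in>{1..J}. set_rate ?L (W j)) \<le> ereal r"
      unfolding r(1)[symmetric] using j0' by (intro Min_le) auto
    show "ereal r \<le> (MIN j\<in>{1..J}. set_rate ?L (W j))"
      using all_ge j0' by (subst Min_ge_iff) auto
  qed
  define p where "p = (\<lambda>b. prob (rare_event M X W J b))"
  define s where "s = (\<lambda>b. enn2real (second_moment M X W J \<Theta> Q b))"
  define K where "K = real J * real (card \<Theta>)"
  have K: "K > 0" using \<open>J \<ge> 1\<close> card_pos by (simp add: K_def)
  have up: "second_moment M X W J \<Theta> Q b \<le> ennreal (K * exp (- (2 * r) * b))" if "b > 0" for b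
    unfolding K_def using second_moment_upper[OF that dual] .
  \<comment> \<open>The upper bound makes the second moment finite, so it can be treated as a real
    number.\<close>
  have sm: "second_moment M X W J \<Theta> Q b = ennreal (s b)" if "b > 0" for b
    unfolding s_def using up[OF that] by (subst ennreal_enn2real) (auto simp: le_less_trans)
  have ev_up: "\<forall>\<^sub>F b in at_top. s b \<le> K * exp (- (2 * r) * b)"
    using eventually_gt_at_top[of 0]
  proof eventually_elim
    case (elim b)
    then show ?case using up[OF elim] K unfolding sm[OF elim] by (subst (asm) ennreal_le_iff) auto
  qed
  have ev_ps: "\<forall>\<^sub>F b in at_top. (p b)\<^sup>2 \<le> s b"
    using eventually_gt_at_top[of 0]
  proof eventually_elim
    case (elim b)
    then show ?case using second_moment_lower[OF elim] unfolding sm[OF elim] p_def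
      by (subst (asm) ennreal_le_iff) (auto simp: s_def)
  qed
  have ev_low: "\<forall>\<^sub>F b in at_top. 1 / 2 * exp (- (r + \<epsilon>) * b) \<le> p b" if \<epsilon>: "\<epsilon> > 0" for \<epsilon>
  proof -
    \<comment> \<open>Half of \<epsilon> pays for a near-optimal density, the other half for the
      tube.\<close>
    have "set_rate law.\<Lambda> (W j0) < ereal (r + \<epsilon> / 2)"
      unfolding log_mgf_law using r \<epsilon> by simp
    then obtain f t where ft: "law.tame_density f" "t > 0" "t *\<^sub>R law.tame_mean f \<in> W j0"
      "t * law.rel_ent f < r + \<epsilon> / 2"
      using law.primal_of_set_rate[of "W j0" "r + \<epsilon> / 2"] W_convex[OF j0'] W_ne[OF j0'] C2b[OF j0']
      unfolding log_mgf_law by blast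
    have "\<forall>\<^sub>F b in at_top. 1 / 2 * exp (- (t * law.rel_ent f + \<epsilon> / 2) * b) \<le> prob (rare_event M X W J b)"
      using rare_event_lower[OF j0' ft(1-3) _ \<delta>0(1), of "\<epsilon> / 2"] C3a[of j0 0] \<delta>0(2)[of 0] j0' \<epsilon> by simp
    with eventually_gt_at_top[of 0] show ?thesis
    proof eventually_elim
      case (elim b)
      have "(t * law.rel_ent f + \<epsilon> / 2) * b \<le> (r + \<epsilon>) * b" using ft(4) elim by (intro mult_right_mono) auto
      then have "1 / 2 * exp (- (r + \<epsilon>) * b) \<le> 1 / 2 * exp (- (t * law.rel_ent f + \<epsilon> / 2) * b)"
        by (simp add: algebra_simps)
      also have "\<dots> \<le> p b" using elim by (simp only: p_def)
      finally show ?case .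
    qed
  qed
  have rates: "((\<lambda>b. 1 / b * ln (p b)) \<longlongrightarrow> - r) at_top"
    "((\<lambda>b. 1 / b * ln (s b)) \<longlongrightarrow> - (2 * r)) at_top" "\<forall>\<^sub>F b in at_top. 0 < p b"
    by (rule exponential_rates[OF K ev_ps ev_up], rule ev_low, assumption)+
  have logs: "\<forall>\<^sub>F b in at_top. b > 0 \<and> log_ennreal (second_moment M X W J \<Theta> Q b) = ereal (ln (s b)) \<and>
      log_ennreal (emeasure M (rare_event M X W J b)) = ereal (ln (p b))"
    using rates(3) ev_ps eventually_gt_at_top[of 0]
  proof eventually_elim
    case (elim b)
    then have "s b > 0" by (auto intro: less_le_trans[of _ "(p b)\<^sup>2"])
    then show ?case using elim
      by (simp add: sm log_ennreal_ennreal emeasure_eq_measure p_def)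
  qed
  have lim_s: "((\<lambda>b. ereal (1 / b) * log_ennreal (second_moment M X W J \<Theta> Q b)) \<longlongrightarrow> ereal (- (2 * r))) at_top"
  proof (rule Lim_transform_eventually)
    show "((\<lambda>b. ereal (1 / b * ln (s b))) \<longlongrightarrow> ereal (- (2 * r))) at_top" using rates(2) by (rule tendsto_ereal)
    show "\<forall>\<^sub>F b in at_top. ereal (1 / b * ln (s b)) = ereal (1 / b) * log_ennreal (second_moment M X W J \<Theta> Q b)"
      using logs by eventually_elim simp
  qed
  have lim_p: "((\<lambda>b. ereal (1 / b) * log_ennreal (emeasure M (rare_event M X W J b))) \<longlongrightarrow> ereal (- r)) at_top"
  proof (rule Lim_transform_eventually)
    show "((\<lambda>b. ereal (1 / b * ln (p b))) \<longlongrightarrow> ereal (- r)) at_top" using rates(1) by (rule tendsto_ereal)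
    show "\<forall>\<^sub>F b in at_top. ereal (1 / b * ln (p b)) = ereal (1 / b) * log_ennreal (emeasure M (rare_event M X W J b))"
      using logs by eventually_elim simp
  qed
  have "asymptotically_efficient M X W J \<Theta> Q"
    unfolding asymptotically_efficient_def
  proof (rule Lim_transform_eventually)
    have "((\<lambda>b. (1 / b * ln (s b)) / (2 * (1 / b * ln (p b)))) \<longlongrightarrow> - (2 * r) / (2 * - r)) at_top"
      using rates(1,2) r(2) by (intro tendsto_intros) auto
    then have "((\<lambda>b. (1 / b * ln (s b)) / (2 * (1 / b * ln (p b)))) \<longlongrightarrow> 1) at_top" using r(2) by simp
    then show "((\<lambda>b. ereal ((1 / b * ln (s b)) / (2 * (1 / b * ln (p b))))) \<longlongrightarrow> 1) at_top"
      unfolding one_ereal_def by (rule tendsto_ereal)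
    \<comment> \<open>Positivity of \<open>r\<close> makes \<open>ln (p b)\<close> eventually
      nonzero, so the factors \<open>1 / b\<close> cancel and the extended quotient agrees with the
      real one.\<close>
    have "\<forall>\<^sub>F b in at_top. 1 / b * ln (p b) < 0"
      using order_tendstoD(2)[OF rates(1)] r(2) by simp
    with logs show "\<forall>\<^sub>F b in at_top. ereal ((1 / b * ln (s b)) / (2 * (1 / b * ln (p b)))) =
        log_ennreal (second_moment M X W J \<Theta> Q b) / (2 * log_ennreal (emeasure M (rare_event M X W J b)))"
    proof eventually_elim
      case (elim b)
      then have "ln (p b) \<noteq> 0" by auto
      have two: "(2 :: ereal) = ereal 2" by simp
      have "log_ennreal (second_moment M X W J \<Theta> Q b) / (2 * log_ennreal (emeasure M (rare_event M X W J b)))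
          = ereal (ln (s b)) / ereal (2 * ln (p b))"
        using elim by (simp only: two times_ereal.simps)
      also have "\<dots> = ereal (ln (s b) / (2 * ln (p b)))" using \<open>ln (p b) \<noteq> 0\<close> by simp
      finally show ?case using elim by simp
    qed
  qed
  then show ?thesis
    using lim_s lim_p unfolding minJ minC by simp
qed

end
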